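(* Let $(\pi,\mathcal V)=\mathbf{St}_e(\tau)$ be the level $0$ discrete series representation of $G=\mathrm{GL}_n(F)$ attached to $\tau$, with simple type $(J,\lambda)$. Let $w\in W$, $\tilde w\in\tilde W$, and let $\Psi\in\bar{\mathcal H}_\lambda$ satisfy $\varphi\star\Psi=\chi(\varphi)\Psi$ for all $\varphi\in\mathcal H_\lambda$. Let $c_{\Psi,w,\tilde w}$ be the matrix coefficient of $\pi$ attached to the vector $\bar f_w\in\mathcal V$ and to the linear form $\Lambda_{\Psi,\tilde w}\in\tilde{\mathcal V}$. (a) One has $$c_{\Psi,w,\tilde w}(g)=\langle w,\Psi(g^{-1})\tilde w\rangle_\lambda,\qquad g\in G,$$ where $\langle\ ,\ \rangle_\lambda$ is the natural pairing between $W$ and $\tilde W$. (b) Assume $\Psi\neq0$. Then there exist $J$-equivariant embeddings $W\subset\mathcal V$ and $\tilde W\subset\tilde{\mathcal V}$ such that $c_{\Psi,w,\tilde w}$ is the matrix coefficient of $\pi$ attached to the vector $w\in\mathcal V$ and to the linear form $\tilde w\in\tilde{\mathcal V}$.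
   Context: $F$ is a non-archimedean, non-discrete, locally compact field of any characteristic, with ring of integers $\mathfrak o_F$, maximal ideal $\mathfrak p_F$, uniformizer $\varpi_F$, residue field $k_F$ of cardinality $q$, normalized absolute value $\|\ \|$. All representations are on complex vector spaces. Fix $n\geqslant 2$, positive integers $e,f$ with $ef=n$, and put $G=\mathrm{GL}_n(F)$. Representation: $\tau$ is an irreducible unitary level $0$ supercuspidal representation of $\mathrm{GL}_f(F)$; that is, there are an irreducible cuspidal representation $\bar\lambda_0$ of $\mathrm{GL}_f(k_F)$, with inflation $\lambda_0$ to $\mathrm{GL}_f(\mathfrak o_F)$ (space $X_0$), and an extension $\Lambda_0$ of $\lambda_0$ to $F^\times\mathrm{GL}_f(\mathfrak o_F)$ with $\tau\simeq \mathrm{ind}_{F^\times \mathrm{GL}_f(\mathfrak o_F)}^{\mathrm{GL}_f(F)}\Lambda_0$. Write $\tau^a=\|\det\|^a\tau$. $\mathbf{St}_e(\tau)$ is the unique irreducible quotient of the representation of $G$ obtained by normalized parabolic induction from the representation $\tau^{(1-e)/2}\otimes\tau^{(3-e)/2}\otimes\cdots\otimes\tau^{(e-1)/2}$ of the standard Levi subgroup $\mathrm{GL}_f(F)^{e}$. Put $(\pi,\mathcal V)=\mathbf{St}_e(\tau)$, with contragredient $(\tilde\pi,\tilde{\mathcal V})$. The matrix coefficient attached to $v\in\mathcal V$, $\tilde v\in\tilde{\mathcal V}$ is $g\mapsto\langle\pi(g)v,\tilde v\rangle$. Type: $\mathfrak A$ is the $\mathfrak o_F$-order of $f\times f$ block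 matrices $(a_{ij})_{1\le i,j\le e}$ with $a_{ij}\in M_f(\mathfrak o_F)$ if $j\ge i$ and $a_{ij}\in\mathfrak p_F M_f(\mathfrak o_F)$ if $j<i$; $\mathfrak P$ is its Jacobson radical, $J=\mathfrak A^\times$, $J^1=1+\mathfrak P$, so $J/J^1\simeq\mathrm{GL}_f(k_F)^e$. $\lambda$ is the inflation of $\bar\lambda_0^{\otimes e}$ to $J$, with space $W=X_0^{\otimes e}$; $(\tilde\lambda,\tilde W)$ is its contragredient. Hecke algebra: $\bar{\mathcal H}_\lambda$ is the space of all functions $\Psi:G\to\mathrm{End}_{\mathbb C}(\tilde W)$ (no support condition) with $\Psi(j_1gj_2)=\tilde\lambda(j_1)\circ\Psi(g)\circ\tilde\lambda(j_2)$ for $j_1,j_2\in J$, $g\in G$; $\mathcal H_\lambda\subset\bar{\mathcal H}_\lambda$ is the subspace of compactly supported ones. For $\varphi\in\mathcal H_\lambda,\Psi\in\bar{\mathcal H}_\lambda$, $(\varphi\star\Psi)(g)=\sum_{x\in J\backslash G}\varphi(gx^{-1})\Psi(x)$ (a finite sum); this makes $\mathcal H_\lambda$ an algebra (convolution for the Haar measure on $G$ giving $J$ volume $1$). Module: $\mathfrak X=\mathrm{ind}_J^G\lambda$ is the space of compactly supported $f:G\to W$ with $f(jg)=\lambda(j)f(g)$, $G$ acting by right translation; $\mathrm{Ind}_J^G\tilde\lambda$ is the space of smooth functions $\Lambda:G\to\tilde W$ with $\Lambda(jg)=\tilde\lambda(j)\Lambda(g)$; it is identified with the contragredient of $\mathfrak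 X$ by $\langle f,\Lambda\rangle=\sum_{x\in J\backslash G}\langle f(x),\Lambda(x)\rangle_\lambda$. For $\varphi\in\mathcal H_\lambda$ put $\tilde\varphi(g)={}^t\varphi(g^{-1})\in\mathrm{End}_{\mathbb C}(W)$ and $(\tilde\varphi\star f)(g)=\sum_{x\in G/J}\tilde\varphi(x)f(x^{-1}g)$. $\mathrm{Hom}_J(W,\mathcal V)\simeq\mathrm{Hom}_G(\mathfrak X,\mathcal V)$ is a left $\mathcal H_\lambda$-module by $(\varphi\cdot\alpha)(f)=\alpha(\tilde\varphi\star f)$. It is known to be one-dimensional; $\chi$ is the resulting character of $\mathcal H_\lambda$. Models: $\mathcal V$ is identified with $\mathfrak X/\mathfrak X_\chi$, where $\mathfrak X_\chi$ is the span of all $\tilde\varphi\star f-\chi(\varphi)f$ ($f\in\mathfrak X,\varphi\in\mathcal H_\lambda$); correspondingly $\tilde{\mathcal V}=\{\Lambda\in\mathrm{Ind}_J^G\tilde\lambda\ ;\ \varphi\star\Lambda=\chi(\varphi)\Lambda\ \forall\varphi\in\mathcal H_\lambda\}$, where $(\varphi\star\Lambda)(g)=\sum_{x\in J\backslash G}\varphi(gx^{-1})\Lambda(x)$. For $w\in W$, $f_w\in\mathfrak X$ is the function supported on $J$ with $f_w(j)=\lambda(j)w$, and $\bar f_w$ is its image in $\mathcal V$. For $\tilde w\in\tilde W$, $\Lambda_{\Psi,\tilde w}(g)=\Psi(g)(\tilde w)$; this lies in $\tilde{\mathcal V}$ when $\varphi\star\Psi=\chi(\varphi)\Psi$ for all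 $\varphi$. *)

theory Defs
  imports
    Complex_Main
    "HOL-Library.Function_Algebras"
    "HOL-Algebra.Left_Coset"
    "HOL-Analysis.Abstract_Topological_Spaces"
    "HOL-Analysis.Function_Topology"
    "Jordan_Normal_Form.Determinant"
begin

section \<open>Complex vector spaces\<close>

class complex_space = ab_group_add +
  fixes scaleC :: "complex \<Rightarrow> 'a \<Rightarrow> 'a"  (infixr \<open>*\<^sub>C\<close> 75)
  assumes scaleC_add_right: "a *\<^sub>C (x + y) = a *\<^sub>C x + a *\<^sub>C y"
    and scaleC_add_left: "(a + b) *\<^sub>C x = a *\<^sub>C x + b *\<^sub>C x"
    and scaleC_scaleC: "a *\<^sub>C b *\<^sub>C x = (a * b) *\<^sub>C x"
    and scaleC_one: "1 *\<^sub>C x = x"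

interpretation cspace: vector_space "scaleC :: complex \<Rightarrow> 'a::complex_space \<Rightarrow> 'a"
  by unfold_locales (simp_all add: scaleC_add_right scaleC_add_left scaleC_scaleC scaleC_one)

abbreviation clinear :: "('a::complex_space \<Rightarrow> 'b::complex_space) \<Rightarrow> bool" where
  "clinear \<equiv> Vector_Spaces.linear scaleC scaleC"

instantiation complex :: complex_space
begin
definition scaleC_complex :: "complex \<Rightarrow> complex \<Rightarrow> complex" where
  "scaleC_complex a x = a * x"
instance
  by standard (simp_all add: scaleC_complex_def algebra_simps)
end

instantiation "fun" :: (type, complex_space) complex_space
begin
definition scaleC_fun :: "complex \<Rightarrow> ('a \<Rightarrow> 'b) \<Rightarrow> 'a \<Rightarrow> 'b" where
  "scaleC_fun a f = (\<lambda>x. a *\<^sub>C f x)"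
instance
  by standard (simp_all add: scaleC_fun_def fun_eq_iff scaleC_add_right scaleC_add_left
      scaleC_scaleC scaleC_one)
end

typedef (overloaded) 'a cdual = "{l :: 'a::complex_space \<Rightarrow> complex. clinear l}"
  morphisms pair_form Abs_cdual
  by (rule exI[of _ "\<lambda>_. 0"]) (auto intro!: Vector_Spaces.linear.intro cspace.vector_space_axioms
      module_hom.intro module_hom_axioms.intro cspace.module_axioms)

setup_lifting type_definition_cdual

lemma clinear_iff:
  "clinear l \<longleftrightarrow> (\<forall>x y. l (x + y) = l x + l y) \<and> (\<forall>a x. l (a *\<^sub>C x) = a *\<^sub>C l x)"
  by (auto simp: Vector_Spaces.linear_iff cspace.vector_space_axioms)

instantiation cdual :: (complex_space) complex_space
begin
lift_definition zero_cdual :: "'a cdual" is "\<lambda>_. 0"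
  by (simp add: clinear_iff scaleC_complex_def)
lift_definition plus_cdual :: "'a cdual \<Rightarrow> 'a cdual \<Rightarrow> 'a cdual" is "\<lambda>l m x. l x + m x"
  by (simp add: clinear_iff scaleC_complex_def algebra_simps)
lift_definition minus_cdual :: "'a cdual \<Rightarrow> 'a cdual \<Rightarrow> 'a cdual" is "\<lambda>l m x. l x - m x"
  by (simp add: clinear_iff scaleC_complex_def algebra_simps)
lift_definition uminus_cdual :: "'a cdual \<Rightarrow> 'a cdual" is "\<lambda>l x. - l x"
  by (simp add: clinear_iff scaleC_complex_def)
lift_definition scaleC_cdual :: "complex \<Rightarrow> 'a cdual \<Rightarrow> 'a cdual" is "\<lambda>a l x. a * l x"
  by (simp add: clinear_iff scaleC_complex_def algebra_simps)
instance
  by standard (transfer; simp add: fun_eq_iff algebra_simps)+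
end

definition pairing :: "'a::complex_space \<Rightarrow> 'a cdual \<Rightarrow> complex"  (\<open>\<langle>_, _\<rangle>\<close>) where
  "\<langle>v, l\<rangle> = pair_form l v"

definition ctranspose :: "('a::complex_space \<Rightarrow> 'b::complex_space) \<Rightarrow> 'b cdual \<Rightarrow> 'a cdual" where
  "ctranspose L l = Abs_cdual (\<lambda>v. \<langle>L v, l\<rangle>)"

text \<open>The transpose of an endomorphism of the dual of a finite-dimensional space \<open>'a\<close>, viewed as
  an endomorphism of \<open>'a\<close> through biduality.\<close>

definition cpretranspose :: "('a::complex_space cdual \<Rightarrow> 'a cdual) \<Rightarrow> 'a \<Rightarrow> 'a" where
  "cpretranspose M v = (THE u. \<forall>l. \<langle>u, l\<rangle> = \<langle>v, M l\<rangle>)"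

text \<open>Families indexed by \<open>{..<e}\<close> are functions on \<open>nat\<close> of which only the first \<open>e\<close> values
  matter.\<close>

definition multilinear :: "nat \<Rightarrow> ((nat \<Rightarrow> 'a::complex_space) \<Rightarrow> 'b::complex_space) \<Rightarrow> bool" where
  "multilinear e m \<longleftrightarrow>
     (\<forall>x y. (\<forall>i<e. x i = y i) \<longrightarrow> m x = m y) \<and> (\<forall>i<e. \<forall>x. clinear (\<lambda>v. m (x(i := v))))"

text \<open>\<open>'b\<close>, with the multilinear map \<open>T\<close>, is an \<open>e\<close>-th tensor power of \<open>'a\<close> (universal property).
  Since the pure tensors span \<open>'b\<close>, factorizations are unique, and over a field it is enough to
  factor scalar-valued multilinear maps: every linear form on the algebraic tensor power then factors
  through the canonical surjection onto \<open>'b\<close>, which is therefore injective.\<close>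

definition tensor_power :: "nat \<Rightarrow> ((nat \<Rightarrow> 'a::complex_space) \<Rightarrow> 'b::complex_space) \<Rightarrow> bool" where
  "tensor_power e T \<longleftrightarrow>
     multilinear e T \<and> cspace.span (range T) = UNIV \<and>
     (\<forall>m :: (nat \<Rightarrow> 'a) \<Rightarrow> complex. multilinear e m \<longrightarrow> (\<exists>l. clinear l \<and> (\<forall>x. m x = l (T x))))"

definition tensor_map ::
    "((nat \<Rightarrow> 'a::complex_space) \<Rightarrow> 'b::complex_space) \<Rightarrow> (nat \<Rightarrow> 'a \<Rightarrow> 'a) \<Rightarrow> 'b \<Rightarrow> 'b" where
  "tensor_map T A = (THE L. clinear L \<and> (\<forall>x. L (T x) = T (\<lambda>i. A i (x i))))"


section \<open>Representations\<close>

text \<open>A representation of \<open>H\<close> on the subspace \<open>S\<close> of an ambient space. The values of \<open>\<rho>\<close> off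
  \<open>carrier H\<close> and off \<open>S\<close> are irrelevant.\<close>

definition linear_on_space ::
    "'v::complex_space set \<Rightarrow> ('v \<Rightarrow> 'w::complex_space) \<Rightarrow> bool" where
  "linear_on_space S L \<longleftrightarrow>
     (\<forall>x\<in>S. \<forall>y\<in>S. L (x + y) = L x + L y) \<and> (\<forall>a. \<forall>x\<in>S. L (a *\<^sub>C x) = a *\<^sub>C L x)"

definition representation ::
    "('g, 'm) monoid_scheme \<Rightarrow> 'v::complex_space set \<Rightarrow> ('g \<Rightarrow> 'v \<Rightarrow> 'v) \<Rightarrow> bool" where
  "representation H S \<rho> \<longleftrightarrow>
     cspace.subspace S \<and>
     (\<forall>g\<in>carrier H. \<rho> g ` S \<subseteq> S \<and> linear_on_space S (\<rho> g)) \<and>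
     (\<forall>v\<in>S. \<rho> \<one>\<^bsub>H\<^esub> v = v) \<and>
     (\<forall>g\<in>carrier H. \<forall>h\<in>carrier H. \<forall>v\<in>S. \<rho> (g \<otimes>\<^bsub>H\<^esub> h) v = \<rho> g (\<rho> h v))"

definition irreducible_representation ::
    "('g, 'm) monoid_scheme \<Rightarrow> 'v::complex_space set \<Rightarrow> ('g \<Rightarrow> 'v \<Rightarrow> 'v) \<Rightarrow> bool" where
  "irreducible_representation H S \<rho> \<longleftrightarrow>
     representation H S \<rho> \<and> S \<noteq> {0} \<and>
     (\<forall>U. cspace.subspace U \<and> U \<subseteq> S \<and> (\<forall>g\<in>carrier H. \<rho> g ` U \<subseteq> U) \<longrightarrow> U = {0} \<or> U = S)"

definition intertwiner ::
    "('g, 'm) monoid_scheme \<Rightarrow> 'v::complex_space set \<Rightarrow> ('g \<Rightarrow> 'v \<Rightarrow> 'v) \<Rightarrow>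
     'w::complex_space set \<Rightarrow> ('g \<Rightarrow> 'w \<Rightarrow> 'w) \<Rightarrow> ('v \<Rightarrow> 'w) \<Rightarrow> bool" where
  "intertwiner H S \<rho> S' \<rho>' \<alpha> \<longleftrightarrow>
     linear_on_space S \<alpha> \<and> \<alpha> ` S \<subseteq> S' \<and> (\<forall>g\<in>carrier H. \<forall>v\<in>S. \<alpha> (\<rho> g v) = \<rho>' g (\<alpha> v))"

definition isomorphic_representations ::
    "('g, 'm) monoid_scheme \<Rightarrow> 'v::complex_space set \<Rightarrow> ('g \<Rightarrow> 'v \<Rightarrow> 'v) \<Rightarrow>
     'w::complex_space set \<Rightarrow> ('g \<Rightarrow> 'w \<Rightarrow> 'w) \<Rightarrow> bool" where
  "isomorphic_representations H S \<rho> S' \<rho>' \<longleftrightarrow>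
     (\<exists>\<alpha>. intertwiner H S \<rho> S' \<rho>' \<alpha> \<and> bij_betw \<alpha> S S')"

text \<open>\<open>p\<close> induces an isomorphism from \<open>S / K\<close> onto \<open>S'\<close>, compatible with the action of \<open>H\<close>.\<close>

definition quotient_map_of_representations ::
    "('g, 'm) monoid_scheme \<Rightarrow> 'v::complex_space set \<Rightarrow> ('g \<Rightarrow> 'v \<Rightarrow> 'v) \<Rightarrow> 'v set \<Rightarrow>
     'w::complex_space set \<Rightarrow> ('g \<Rightarrow> 'w \<Rightarrow> 'w) \<Rightarrow> ('v \<Rightarrow> 'w) \<Rightarrow> bool" where
  "quotient_map_of_representations H S \<rho> K S' \<rho>' p \<longleftrightarrow>
     intertwiner H S \<rho> S' \<rho>' p \<and> p ` S = S' \<and> {x \<in> S. p x = 0} = K"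

definition unitary_representation ::
    "('g, 'm) monoid_scheme \<Rightarrow> ('g \<Rightarrow> 'v::complex_space \<Rightarrow> 'v) \<Rightarrow> bool" where
  "unitary_representation H \<rho> \<longleftrightarrow>
     representation H UNIV \<rho> \<and>
     (\<exists>B :: 'v \<Rightarrow> 'v \<Rightarrow> complex.
        (\<forall>y. clinear (\<lambda>x. B x y)) \<and> (\<forall>x y. B y x = cnj (B x y)) \<and>
        (\<forall>x. x \<noteq> 0 \<longrightarrow> Re (B x x) > 0) \<and>
        (\<forall>g\<in>carrier H. \<forall>x y. B (\<rho> g x) (\<rho> g y) = B x y))"

definition contragredient_action ::
    "('g, 'm) monoid_scheme \<Rightarrow> ('g \<Rightarrow> 'v::complex_space \<Rightarrow> 'v) \<Rightarrow> 'g \<Rightarrow> 'v cdual \<Rightarrow> 'v cdual" where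
  "contragredient_action H \<rho> g = ctranspose (\<rho> (inv\<^bsub>H\<^esub> g))"

definition smooth_vector ::
    "('g, 'm) monoid_scheme \<Rightarrow> 'g topology \<Rightarrow> ('g \<Rightarrow> 'v \<Rightarrow> 'v) \<Rightarrow> 'v \<Rightarrow> bool" where
  "smooth_vector H T \<rho> v \<longleftrightarrow> openin T {g \<in> carrier H. \<rho> g v = v}"

definition smooth_dual ::
    "('g, 'm) monoid_scheme \<Rightarrow> 'g topology \<Rightarrow> ('g \<Rightarrow> 'v::complex_space \<Rightarrow> 'v) \<Rightarrow> 'v cdual set" where
  "smooth_dual H T \<rho> = {l. smooth_vector H T (contragredient_action H \<rho>) l}"

definition matrix_coefficient ::
    "('g \<Rightarrow> 'v::complex_space \<Rightarrow> 'v) \<Rightarrow> 'v \<Rightarrow> 'v cdual \<Rightarrow> 'g \<Rightarrow> complex" where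
  "matrix_coefficient \<rho> v l = (\<lambda>g. \<langle>\<rho> g v, l\<rangle>)"

text \<open>Functions on a group are extended by \<open>0\<close> outside its carrier.\<close>

definition right_translation ::
    "('g, 'm) monoid_scheme \<Rightarrow> 'g \<Rightarrow> ('g \<Rightarrow> 'v::zero) \<Rightarrow> 'g \<Rightarrow> 'v" where
  "right_translation G g f = (\<lambda>x. if x \<in> carrier G then f (x \<otimes>\<^bsub>G\<^esub> g) else 0)"

definition equivariant_functions ::
    "('g, 'm) monoid_scheme \<Rightarrow> 'g set \<Rightarrow> ('g \<Rightarrow> 'v::zero \<Rightarrow> 'v) \<Rightarrow> ('g \<Rightarrow> 'v) set" where
  "equivariant_functions G H \<rho> =
     {f. (\<forall>g. g \<notin> carrier G \<longrightarrow> f g = 0) \<and>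
         (\<forall>h\<in>H. \<forall>g\<in>carrier G. f (h \<otimes>\<^bsub>G\<^esub> g) = \<rho> h (f g))}"

definition compactly_supported :: "'g topology \<Rightarrow> ('g \<Rightarrow> 'v::zero) \<Rightarrow> bool" where
  "compactly_supported T f \<longleftrightarrow> (\<exists>C. compactin T C \<and> (\<forall>g. f g \<noteq> 0 \<longrightarrow> g \<in> C))"

definition smooth_induction ::
    "('g, 'm) monoid_scheme \<Rightarrow> 'g topology \<Rightarrow> 'g set \<Rightarrow> ('g \<Rightarrow> 'v::zero \<Rightarrow> 'v) \<Rightarrow> ('g \<Rightarrow> 'v) set" where
  "smooth_induction G T H \<rho> =
     {f \<in> equivariant_functions G H \<rho>. smooth_vector G T (right_translation G) f}"

definition compact_induction ::
    "('g, 'm) monoid_scheme \<Rightarrow> 'g topology \<Rightarrow> 'g set \<Rightarrow> ('g \<Rightarrow> 'v::zero \<Rightarrow> 'v) \<Rightarrow> ('g \<Rightarrow> 'v) set" where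
  "compact_induction G T H \<rho> =
     {f \<in> smooth_induction G T H \<rho>.
        \<exists>C. compactin T C \<and> (\<forall>g. f g \<noteq> 0 \<longrightarrow> g \<in> H <#>\<^bsub>G\<^esub> C)}"


section \<open>The Hecke algebra of a representation of an open compact subgroup\<close>

text \<open>Sum over a set of cosets of a function of representatives. In all uses the summand does not
  depend on the representatives, and all but finitely many terms vanish.\<close>

definition coset_sum :: "'g set set \<Rightarrow> ('g \<Rightarrow> 'v::comm_monoid_add) \<Rightarrow> 'v" where
  "coset_sum \<C> t =
     (\<Sum>C \<in> {C \<in> \<C>. t (SOME x. x \<in> C) \<noteq> 0}. t (SOME x. x \<in> C))"

definition hecke_space ::
    "('g, 'm) monoid_scheme \<Rightarrow> 'g set \<Rightarrow> ('g \<Rightarrow> 'w::complex_space \<Rightarrow> 'w) \<Rightarrow>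
     ('g \<Rightarrow> 'w cdual \<Rightarrow> 'w cdual) set" where
  "hecke_space G J lam =
     {\<Psi>. (\<forall>g. g \<notin> carrier G \<longrightarrow> \<Psi> g = 0) \<and> (\<forall>g\<in>carrier G. clinear (\<Psi> g)) \<and>
         (\<forall>j\<^sub>1\<in>J. \<forall>j\<^sub>2\<in>J. \<forall>g\<in>carrier G.
            \<Psi> (j\<^sub>1 \<otimes>\<^bsub>G\<^esub> g \<otimes>\<^bsub>G\<^esub> j\<^sub>2) =
              contragredient_action G lam j\<^sub>1 \<circ> \<Psi> g \<circ> contragredient_action G lam j\<^sub>2)}"

definition hecke_algebra ::
    "('g, 'm) monoid_scheme \<Rightarrow> 'g topology \<Rightarrow> 'g set \<Rightarrow> ('g \<Rightarrow> 'w::complex_space \<Rightarrow> 'w) \<Rightarrow>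
     ('g \<Rightarrow> 'w cdual \<Rightarrow> 'w cdual) set" where
  "hecke_algebra G T J lam = {\<phi> \<in> hecke_space G J lam. compactly_supported T \<phi>}"

text \<open>\<open>\<phi> \<star> \<Psi>\<close>; the sum of endomorphisms is the pointwise one.\<close>

definition hecke_conv ::
    "('g, 'm) monoid_scheme \<Rightarrow> 'g set \<Rightarrow> ('g \<Rightarrow> 'u \<Rightarrow> 'v::comm_monoid_add) \<Rightarrow>
     ('g \<Rightarrow> 'z \<Rightarrow> 'u) \<Rightarrow> 'g \<Rightarrow> 'z \<Rightarrow> 'v" where
  "hecke_conv G J \<phi> \<Psi> = (\<lambda>g l. if g \<in> carrier G
     then coset_sum (rcosets\<^bsub>G\<^esub> J) (\<lambda>x. \<phi> (g \<otimes>\<^bsub>G\<^esub> inv\<^bsub>G\<^esub> x) (\<Psi> x l)) else 0)"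

definition hecke_tilde ::
    "('g, 'm) monoid_scheme \<Rightarrow> ('g \<Rightarrow> 'w::complex_space cdual \<Rightarrow> 'w cdual) \<Rightarrow> 'g \<Rightarrow> 'w \<Rightarrow> 'w" where
  "hecke_tilde G \<phi> g = cpretranspose (\<phi> (inv\<^bsub>G\<^esub> g))"

definition hecke_act ::
    "('g, 'm) monoid_scheme \<Rightarrow> 'g set \<Rightarrow> ('g \<Rightarrow> 'w::complex_space cdual \<Rightarrow> 'w cdual) \<Rightarrow>
     ('g \<Rightarrow> 'w) \<Rightarrow> 'g \<Rightarrow> 'w" where
  "hecke_act G J \<phi> f = (\<lambda>g. if g \<in> carrier G
     then coset_sum (lcosets\<^bsub>G\<^esub> J) (\<lambda>x. hecke_tilde G \<phi> x (f (inv\<^bsub>G\<^esub> x \<otimes>\<^bsub>G\<^esub> g))) else 0)"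

text \<open>The space \<open>ind\<^sub>J\<^sup>G lam\<close>, with \<open>right_translation G\<close>.\<close>

definition type_module ::
    "('g, 'm) monoid_scheme \<Rightarrow> 'g topology \<Rightarrow> 'g set \<Rightarrow> ('g \<Rightarrow> 'w::complex_space \<Rightarrow> 'w) \<Rightarrow>
     ('g \<Rightarrow> 'w) set" where
  "type_module G T J lam = {f \<in> equivariant_functions G J lam. compactly_supported T f}"

text \<open>The scalar by which \<open>\<phi>\<close> acts on \<open>Hom\<^sub>G (ind\<^sub>J\<^sup>G lam, \<pi>)\<close> when the latter is one-dimensional.\<close>

definition hecke_character ::
    "('g, 'm) monoid_scheme \<Rightarrow> 'g topology \<Rightarrow> 'g set \<Rightarrow> ('g \<Rightarrow> 'w::complex_space \<Rightarrow> 'w) \<Rightarrow>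
     ('g \<Rightarrow> 'v::complex_space \<Rightarrow> 'v) \<Rightarrow> ('g \<Rightarrow> 'w cdual \<Rightarrow> 'w cdual) \<Rightarrow> complex" where
  "hecke_character G T J lam \<pi> \<phi> =
     (THE c. \<forall>\<alpha>. intertwiner G (type_module G T J lam) (right_translation G) UNIV \<pi> \<alpha> \<longrightarrow>
        (\<forall>f\<in>type_module G T J lam. \<alpha> (hecke_act G J \<phi> f) = c *\<^sub>C \<alpha> f))"

definition eigen_relations ::
    "('g, 'm) monoid_scheme \<Rightarrow> 'g topology \<Rightarrow> 'g set \<Rightarrow> ('g \<Rightarrow> 'w::complex_space \<Rightarrow> 'w) \<Rightarrow>
     (('g \<Rightarrow> 'w cdual \<Rightarrow> 'w cdual) \<Rightarrow> complex) \<Rightarrow> ('g \<Rightarrow> 'w) set" where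
  "eigen_relations G T J lam chi =
     cspace.span {hecke_act G J \<phi> f - chi \<phi> *\<^sub>C f | \<phi> f.
       \<phi> \<in> hecke_algebra G T J lam \<and> f \<in> type_module G T J lam}"

definition type_pairing ::
    "('g, 'm) monoid_scheme \<Rightarrow> 'g set \<Rightarrow> ('g \<Rightarrow> 'w::complex_space) \<Rightarrow> ('g \<Rightarrow> 'w cdual) \<Rightarrow> complex" where
  "type_pairing G J f \<Lambda> = coset_sum (rcosets\<^bsub>G\<^esub> J) (\<lambda>x. \<langle>f x, \<Lambda> x\<rangle>)"

definition type_vector :: "'g set \<Rightarrow> ('g \<Rightarrow> 'w \<Rightarrow> 'w) \<Rightarrow> 'w \<Rightarrow> 'g \<Rightarrow> 'w::zero" where
  "type_vector J lam w = (\<lambda>g. if g \<in> J then lam g w else 0)"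

text \<open>If \<open>p\<close> identifies \<open>\<V>\<close> with a quotient of \<open>ind\<^sub>J\<^sup>G lam\<close>, a function \<open>\<Lambda>\<close> orthogonal to the
  kernel of \<open>p\<close> is identified with the following linear form on \<open>\<V>\<close>.\<close>

definition dual_vector ::
    "('g, 'm) monoid_scheme \<Rightarrow> 'g topology \<Rightarrow> 'g set \<Rightarrow> ('g \<Rightarrow> 'w::complex_space \<Rightarrow> 'w) \<Rightarrow>
     (('g \<Rightarrow> 'w) \<Rightarrow> 'v::complex_space) \<Rightarrow> ('g \<Rightarrow> 'w cdual) \<Rightarrow> 'v cdual" where
  "dual_vector G T J lam p \<Lambda> =
     (THE l. \<forall>f\<in>type_module G T J lam. \<langle>p f, l\<rangle> = type_pairing G J f \<Lambda>)"


section \<open>Local fields and general linear groups\<close>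

definition integer_ring :: "('a \<Rightarrow> real) \<Rightarrow> 'a set" where
  "integer_ring N = {x. N x \<le> 1}"

definition max_ideal :: "('a \<Rightarrow> real) \<Rightarrow> 'a set" where
  "max_ideal N = {x. N x < 1}"

text \<open>\<open>red\<close> presents \<open>'k\<close> as the residue field; its values off the ring of integers are
  irrelevant.\<close>

definition residue_map :: "('a::field \<Rightarrow> real) \<Rightarrow> ('a \<Rightarrow> 'k::field) \<Rightarrow> bool" where
  "residue_map N red \<longleftrightarrow>
     red 1 = 1 \<and>
     (\<forall>x\<in>integer_ring N. \<forall>y\<in>integer_ring N.
        red (x + y) = red x + red y \<and> red (x * y) = red x * red y) \<and>
     {x \<in> integer_ring N. red x = 0} = max_ideal N \<and>
     red ` integer_ring N = UNIV"

text \<open>\<open>'a\<close> is a non-archimedean, non-discrete, locally compact field with residue field \<open>'k\<close> and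
  normalized absolute value \<open>N\<close>.\<close>

definition nonarch_local_field ::
    "('a::{field,topological_space} \<Rightarrow> real) \<Rightarrow> ('a \<Rightarrow> 'k::field) \<Rightarrow> bool" where
  "nonarch_local_field N red \<longleftrightarrow>
     (\<forall>x. N x \<ge> 0) \<and> (\<forall>x. N x = 0 \<longleftrightarrow> x = 0) \<and>
     (\<forall>x y. N (x * y) = N x * N y) \<and> (\<forall>x y. N (x + y) \<le> max (N x) (N y)) \<and>
     (\<forall>U :: 'a set. open U \<longleftrightarrow> (\<forall>x\<in>U. \<exists>\<epsilon>>0. \<forall>y. N (y - x) < \<epsilon> \<longrightarrow> y \<in> U)) \<and>
     \<not> open {0 :: 'a} \<and>
     locally_compact_space (euclidean :: 'a topology) \<and>
     residue_map N red \<and>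
     (\<exists>t. max_ideal N = {t * x | x. x \<in> integer_ring N} \<and> N t = 1 / real CARD('k))"

definition GL :: "nat \<Rightarrow> 'a::field mat monoid" where
  "GL n = units_of (ring_mat TYPE('a) n ())"

definition GL_topology :: "nat \<Rightarrow> 'a::{field,topological_space} mat topology" where
  "GL_topology n = pullback_topology (carrier (GL n))
     (\<lambda>A. restrict (\<lambda>ij. A $$ ij) ({..<n} \<times> {..<n}))
     (product_topology (\<lambda>_. euclidean) ({..<n} \<times> {..<n}))"

definition GL_integral :: "('a::field \<Rightarrow> real) \<Rightarrow> nat \<Rightarrow> 'a mat set" where
  "GL_integral N n = {g \<in> carrier (GL n).
     \<forall>i<n. \<forall>j<n. g $$ (i, j) \<in> integer_ring N \<and> (inv\<^bsub>GL n\<^esub> g) $$ (i, j) \<in> integer_ring N}"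

definition GL_integral_center :: "('a::field \<Rightarrow> real) \<Rightarrow> nat \<Rightarrow> 'a mat set" where
  "GL_integral_center N n = {a \<cdot>\<^sub>m k | a k. a \<noteq> 0 \<and> k \<in> GL_integral N n}"

text \<open>Unipotent radical of the standard parabolic subgroup whose blocks are separated by the cuts
  \<open>c \<in> S\<close> (between the rows \<open>c - 1\<close> and \<open>c\<close>); the subgroup is proper iff \<open>S \<noteq> {}\<close>.\<close>

definition std_unipotent_radical :: "nat \<Rightarrow> nat set \<Rightarrow> 'a::field mat set" where
  "std_unipotent_radical m S = {u \<in> carrier_mat m m. \<forall>i<m. \<forall>j<m.
     \<not> (\<exists>c\<in>S. i < c \<and> c \<le> j) \<longrightarrow> u $$ (i, j) = (if i = j then 1 else 0)}"

text \<open>No proper parabolic subgroup has a nonzero vector fixed by its unipotent radical.\<close>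

definition cuspidal :: "nat \<Rightarrow> ('a::field mat \<Rightarrow> 'v::complex_space \<Rightarrow> 'v) \<Rightarrow> bool" where
  "cuspidal m \<rho> \<longleftrightarrow>
     (\<forall>S. S \<noteq> {} \<and> S \<subseteq> {1..<m} \<longrightarrow>
        (\<forall>x\<in>carrier (GL m). \<forall>v.
           (\<forall>u\<in>std_unipotent_radical m S. \<rho> (x \<otimes>\<^bsub>GL m\<^esub> u \<otimes>\<^bsub>GL m\<^esub> inv\<^bsub>GL m\<^esub> x) v = v) \<longrightarrow> v = 0))"

definition diag_block :: "nat \<Rightarrow> nat \<Rightarrow> 'a mat \<Rightarrow> 'a mat" where
  "diag_block f i A = mat f f (\<lambda>(r, s). A $$ (i * f + r, i * f + s))"

definition std_parabolic :: "nat \<Rightarrow> nat \<Rightarrow> 'a::field mat set" where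
  "std_parabolic e f = {p \<in> carrier (GL (e * f)).
     \<forall>r<e * f. \<forall>s<e * f. s div f < r div f \<longrightarrow> p $$ (r, s) = 0}"

text \<open>The modulus \<open>\<parallel>det (Ad p | Lie N)\<parallel>\<close>: the block \<open>(i, j)\<close>, \<open>i < j\<close>, of \<open>Lie N\<close> is
  transformed by \<open>x \<mapsto> p\<^sub>i x p\<^sub>j\<^sup>-\<^sup>1\<close>.\<close>

definition modulus :: "('a::field \<Rightarrow> real) \<Rightarrow> nat \<Rightarrow> nat \<Rightarrow> 'a mat \<Rightarrow> real" where
  "modulus N e f p =
     (\<Prod>j<e. \<Prod>i<j. (N (Determinant.det (diag_block f i p)) / N (Determinant.det (diag_block f j p))) ^ f)"

text \<open>\<open>\<delta>\<^sub>P\<^sup>1\<^sup>/\<^sup>2 \<otimes> (\<tau>\<^sup>a\<^sub>0 \<otimes> \<dots> \<otimes> \<tau>\<^sup>a\<^sub>e\<^sub>-\<^sub>1)\<close> with \<open>a\<^sub>i = (1 - e)/2 + i\<close>, inflated to the parabolic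
  subgroup; \<open>T\<close> is the tensor map of the \<open>e\<close>-th tensor power of the space of \<open>\<tau>\<close>.\<close>

definition steinberg_datum ::
    "('a::field \<Rightarrow> real) \<Rightarrow> nat \<Rightarrow> nat \<Rightarrow> ('a mat \<Rightarrow> 't::complex_space \<Rightarrow> 't) \<Rightarrow>
     ((nat \<Rightarrow> 't) \<Rightarrow> 'u::complex_space) \<Rightarrow> 'a mat \<Rightarrow> 'u \<Rightarrow> 'u" where
  "steinberg_datum N e f \<tau> T p u =
     complex_of_real (sqrt (modulus N e f p)) *\<^sub>C
     tensor_map T (\<lambda>i x.
       complex_of_real (N (Determinant.det (diag_block f i p)) powr ((1 - real e) / 2 + real i)) *\<^sub>C
       \<tau> (diag_block f i p) x) u"

text \<open>\<open>\<pi>\<close> is a model of \<open>St\<^sub>e(\<tau>)\<close>, the irreducible quotient of the parabolically induced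
  representation.\<close>

definition is_steinberg ::
    "('a::{field,topological_space} \<Rightarrow> real) \<Rightarrow> nat \<Rightarrow> nat \<Rightarrow> ('a mat \<Rightarrow> 't::complex_space \<Rightarrow> 't) \<Rightarrow>
     ((nat \<Rightarrow> 't) \<Rightarrow> 'u::complex_space) \<Rightarrow> ('a mat \<Rightarrow> 'v::complex_space \<Rightarrow> 'v) \<Rightarrow> bool" where
  "is_steinberg N e f \<tau> T \<pi> \<longleftrightarrow>
     irreducible_representation (GL (e * f)) UNIV \<pi> \<and>
     (\<exists>K q. quotient_map_of_representations (GL (e * f))
        (smooth_induction (GL (e * f)) (GL_topology (e * f)) (std_parabolic e f)
           (steinberg_datum N e f \<tau> T))
        (right_translation (GL (e * f))) K UNIV \<pi> q)"

definition level0_supercuspidal ::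
    "('a::{field,topological_space} \<Rightarrow> real) \<Rightarrow> ('a \<Rightarrow> 'k::field) \<Rightarrow> nat \<Rightarrow>
     ('k mat \<Rightarrow> 'x::complex_space \<Rightarrow> 'x) \<Rightarrow> ('a mat \<Rightarrow> 'x \<Rightarrow> 'x) \<Rightarrow>
     ('a mat \<Rightarrow> 't::complex_space \<Rightarrow> 't) \<Rightarrow> bool" where
  "level0_supercuspidal N red f lam\<^sub>0 Lam\<^sub>0 \<tau> \<longleftrightarrow>
     irreducible_representation (GL f) UNIV lam\<^sub>0 \<and> cuspidal f lam\<^sub>0 \<and>
     representation ((GL f)\<lparr>carrier := GL_integral_center N f\<rparr>) UNIV Lam\<^sub>0 \<and>
     (\<forall>k\<in>GL_integral N f. Lam\<^sub>0 k = lam\<^sub>0 (map_mat red k)) \<and>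
     isomorphic_representations (GL f) UNIV \<tau>
       (compact_induction (GL f) (GL_topology f) (GL_integral_center N f) Lam\<^sub>0)
       (right_translation (GL f))"

definition block_order :: "('a \<Rightarrow> real) \<Rightarrow> nat \<Rightarrow> nat \<Rightarrow> 'a mat set" where
  "block_order N e f = {A \<in> carrier_mat (e * f) (e * f).
     \<forall>r<e * f. \<forall>s<e * f.
       A $$ (r, s) \<in> (if r div f \<le> s div f then integer_ring N else max_ideal N)}"

definition block_parahoric :: "('a::field \<Rightarrow> real) \<Rightarrow> nat \<Rightarrow> nat \<Rightarrow> 'a mat set" where
  "block_parahoric N e f =
     {g \<in> carrier (GL (e * f)). g \<in> block_order N e f \<and> inv\<^bsub>GL (e * f)\<^esub> g \<in> block_order N e f}"

text \<open>The projection of the parahoric subgroup onto its reductive quotient is reduction of the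
  diagonal blocks.\<close>

definition simple_type ::
    "('a \<Rightarrow> 'k) \<Rightarrow> nat \<Rightarrow> ((nat \<Rightarrow> 'x::complex_space) \<Rightarrow> 'w::complex_space) \<Rightarrow>
     ('k mat \<Rightarrow> 'x \<Rightarrow> 'x) \<Rightarrow> 'a mat \<Rightarrow> 'w \<Rightarrow> 'w" where
  "simple_type red f T lam\<^sub>0 j = tensor_map T (\<lambda>i. lam\<^sub>0 (map_mat red (diag_block f i j)))"

end

theory Submission
  imports Defs "HOL-Computational_Algebra.Fundamental_Theorem_Algebra"
begin

text \<open>
Write \<open>W\<close> for the space of \<open>lam\<close> and \<open>\<X>\<close> for the module \<open>ind\<^sub>J\<^sup>G lam\<close>, of which the space of \<open>\<pi>\<close> is
the quotient by the relations \<open>\<phi> f - chi(\<phi>) f\<close>.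

The pairing of \<open>\<X>\<close> with equivariant functions from \<open>G\<close> to the dual of \<open>W\<close> makes the action of a
Hecke operator \<open>\<phi>\<close> on \<open>\<X>\<close> adjoint to convolution by \<open>\<phi>\<close> (\<open>type_pairing_hecke_act\<close>). If \<open>\<Psi>\<close> is an eigenvector for all convolutions, pairing with
\<open>g \<mapsto> \<Psi>(g) l\<close> therefore kills the relations and descends to a linear form on the quotient
(\<open>pairing_dual_form\<close>). Evaluated on the translate by \<open>g\<close> of the function attached to \<open>w\<close>, whose support is
the single coset \<open>J g\<inverse>\<close>, the form gives \<open>\<langle>w, \<Psi>(g\<inverse>) l\<rangle>\<close>: this is the formula for the matrix coefficient
(\<open>matrix_coefficient_formula\<close>).

The maps sending \<open>w\<close> to the image of the function attached to \<open>w\<close>, and \<open>l\<close> to the form attached to \<open>l\<close>, are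
\<open>J\<close>-equivariant, so the kernel of the first and the annihilator in \<open>W\<close> of the kernel of the second are
\<open>J\<close>-stable. By the formula, each map is either injective or forces \<open>\<Psi> = 0\<close>, as soon as \<open>lam\<close> is
irreducible (\<open>embed_inj\<close>, \<open>dual_form_inj\<close>).

Irreducibility of \<open>lam\<close> has two sources. Reduction of the diagonal blocks maps \<open>J\<close> onto \<open>GL\<^sub>f(k)\<^sup>e\<close>
(\<open>block_reduction_surj\<close>), and the \<open>e\<close>-th tensor power of an irreducible representation of a finite group \<open>H\<close> is
irreducible for \<open>H\<^sup>e\<close> (\<open>tensor_power_irreducible\<close>); the latter rests on Burnside's theorem that the group elements span
all endomorphisms, which is deduced from Schur's lemma by averaging.

Two topological points remain. Every subgroup that contains the matrices congruent to 1 modulo the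
maximal ideal is open (\<open>coset_open\<close>); this makes the coset sums finite and the forms smooth. And \<open>J\<close> must lie in a
compact set for the functions attached to vectors of \<open>W\<close> to belong to \<open>\<X>\<close>; this follows from \<open>\<X>\<close> having a
nonzero element at all (\<open>J_in_compact\<close>).
\<close>

section \<open>Finite-dimensional complex vector spaces and their duals\<close>

lemma clinear_add: "clinear L \<Longrightarrow> L (x + y) = L x + L y"
  and clinear_scale: "clinear L \<Longrightarrow> L (a *\<^sub>C x) = a *\<^sub>C L x"
  by (simp_all add: clinear_iff)

lemma clinear_zero: "clinear L \<Longrightarrow> L 0 = 0"
  using clinear_add[of L 0 0] by simp

lemma clinear_uminus: "clinear L \<Longrightarrow> L (- x) = - L x"
  using clinear_add[of L x "- x"] by (simp add: clinear_zero eq_neg_iff_add_eq_0 add.commute)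

lemma clinear_diff: "clinear L \<Longrightarrow> L (x - y) = L x - L y"
  using clinear_add[of L x "- y"] by (simp add: clinear_uminus)

lemma clinear_sum: "clinear L \<Longrightarrow> L (\<Sum>i\<in>I. f i) = (\<Sum>i\<in>I. L (f i))"
  by (induction I rule: infinite_finite_induct) (simp_all add: clinear_zero clinear_add)

lemma clinear_injI:
  assumes "clinear L" "\<And>x. L x = 0 \<Longrightarrow> x = 0"
  shows "inj L"
proof (rule injI)
  fix x y assume "L x = L y"
  then have "L (x - y) = 0" by (simp add: clinear_diff[OF assms(1)])
  then show "x = y" using assms(2) by fastforce
qed

lemma clinear_id: "clinear (\<lambda>x. x)"
  by (simp add: clinear_iff)

lemma clinear_compose: "clinear L \<Longrightarrow> clinear M \<Longrightarrow> clinear (\<lambda>x. L (M x))"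
  by (simp add: clinear_iff)

lemma clinear_scalar_scale: "clinear L \<Longrightarrow> clinear (\<lambda>x. a *\<^sub>C L x)"
  by (simp add: clinear_iff scaleC_add_right scaleC_scaleC mult.commute)

lemma clinear_plus: "clinear L \<Longrightarrow> clinear M \<Longrightarrow> clinear (\<lambda>x. L x + M x)"
  by (simp add: clinear_iff scaleC_add_right add.assoc add.left_commute)

lemma clinear_const_zero: "clinear (\<lambda>x. 0)"
  by (simp add: clinear_iff)

lemma clinear_lincomb:
  "(\<And>i. i \<in> I \<Longrightarrow> clinear (L i)) \<Longrightarrow> clinear (\<lambda>x. \<Sum>i\<in>I. a i *\<^sub>C L i x)"
  by (induction I rule: infinite_finite_induct) (auto intro!: clinear_plus clinear_scalar_scale clinear_const_zero)

lemma clinear_scale_vector: "clinear l \<Longrightarrow> clinear (\<lambda>x. l x *\<^sub>C v)"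
  by (simp add: clinear_iff scaleC_add_left scaleC_complex_def scaleC_scaleC)

lemma clinear_eq_on_span:
  assumes "clinear L" "clinear M" "cspace.span S = UNIV" "\<And>x. x \<in> S \<Longrightarrow> L x = M x"
  shows "L = M"
proof
  fix x
  have "x \<in> cspace.span S" using assms(3) by simp
  then show "L x = M x"
    by (induction rule: cspace.span_induct_alt)
       (simp_all add: assms clinear_zero clinear_add clinear_scale)
qed

lemma pairing_add_left: "\<langle>x + y, l\<rangle> = \<langle>x, l\<rangle> + \<langle>y, l\<rangle>"
  and pairing_scale_left: "\<langle>a *\<^sub>C x, l\<rangle> = a * \<langle>x, l\<rangle>"
  and clinear_pairing: "clinear (\<lambda>x. \<langle>x, l\<rangle>)"
  using pair_form[of l] by (simp_all add: pairing_def clinear_iff scaleC_complex_def)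

lemma pairing_add_right: "\<langle>x, l + m\<rangle> = \<langle>x, l\<rangle> + \<langle>x, m\<rangle>"
  and pairing_scale_right: "\<langle>x, a *\<^sub>C l\<rangle> = a * \<langle>x, l\<rangle>"
  and pairing_zero_right: "\<langle>x, 0\<rangle> = 0"
  by (simp_all add: pairing_def plus_cdual.rep_eq scaleC_cdual.rep_eq zero_cdual.rep_eq)

lemma pairing_zero_left: "\<langle>0, l\<rangle> = 0"
  by (rule clinear_zero[OF clinear_pairing])

lemma clinear_pairing_right: "clinear (\<lambda>l. \<langle>x, l\<rangle>)"
  by (simp add: clinear_iff pairing_add_right pairing_scale_right scaleC_complex_def)

lemmas pairing_sum_left = clinear_sum[OF clinear_pairing]
lemmas pairing_sum_right = clinear_sum[OF clinear_pairing_right]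

lemma pairing_Abs_cdual: "clinear F \<Longrightarrow> \<langle>x, Abs_cdual F\<rangle> = F x"
  by (simp add: pairing_def Abs_cdual_inverse)

lemma cdual_eqI: "(\<And>x. \<langle>x, l\<rangle> = \<langle>x, m\<rangle>) \<Longrightarrow> l = m"
  by (metis pair_form_inject pairing_def ext)

lemma pairing_ctranspose: "clinear L \<Longrightarrow> \<langle>x, ctranspose L l\<rangle> = \<langle>L x, l\<rangle>"
  unfolding ctranspose_def by (rule pairing_Abs_cdual) (rule clinear_compose[OF clinear_pairing])

definition finite_dimensional :: "'a::complex_space itself \<Rightarrow> bool" where
  "finite_dimensional _ \<longleftrightarrow> (\<exists>S :: 'a set. finite S \<and> cspace.span S = UNIV)"

text \<open>The forms \<open>co b\<close>, for \<open>b\<close> in \<open>B\<close>, are the basis dual to \<open>B\<close>. Linearity is required for every \<open>b\<close>, so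
  that rewriting under sums over \<open>B\<close> needs no membership condition.\<close>

definition dual_bases :: "'a::complex_space set \<Rightarrow> ('a \<Rightarrow> 'a \<Rightarrow> complex) \<Rightarrow> bool" where
  "dual_bases B co \<longleftrightarrow> finite B \<and> (\<forall>b. clinear (co b)) \<and> (\<forall>v. (\<Sum>b\<in>B. co b v *\<^sub>C b) = v) \<and>
     (\<forall>b\<in>B. \<forall>b'\<in>B. co b b' = (if b = b' then 1 else 0))"

lemma dual_basesD:
  assumes "dual_bases B co"
  shows "finite B" "clinear (co b)" "(\<Sum>b\<in>B. co b v *\<^sub>C b) = v"
    "b \<in> B \<Longrightarrow> b' \<in> B \<Longrightarrow> co b b' = (if b = b' then 1 else 0)"
  using assms unfolding dual_bases_def by auto

lemma dual_bases_exist: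
  assumes "finite_dimensional TYPE('a::complex_space)"
  obtains B co where "dual_bases (B :: 'a set) co"
proof -
  obtain S :: "'a set" where S: "finite S" "cspace.span S = UNIV"
    using assms unfolding finite_dimensional_def by blast
  obtain B where B: "B \<subseteq> S" "cspace.independent B" "S \<subseteq> cspace.span B"
    using cspace.maximal_independent_subset[of S] by blast
  have fB: "finite B" using B S finite_subset by blast
  have sp: "cspace.span B = UNIV"
    using cspace.span_minimal[OF B(3)] S(2) cspace.subspace_span by auto
  define co where "co = (\<lambda>b v. cspace.representation B v b)"
  have "clinear (co b)" for b
    using cspace.representation_add[OF B(2)] cspace.representation_scale[OF B(2)] sp
    unfolding co_def clinear_iff by (simp add: scaleC_complex_def)
  moreover have "(\<Sum>b\<in>B. co b v *\<^sub>C b) = v" for v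
    unfolding co_def by (rule cspace.sum_representation_eq[OF B(2)]) (use fB sp in auto)
  moreover have "co b b' = (if b = b' then 1 else 0)" if "b \<in> B" "b' \<in> B" for b b'
    unfolding co_def using cspace.representation_basis[OF B(2) that(2)] by auto
  ultimately show thesis using that fB unfolding dual_bases_def by blast
qed

lemma biduality:
  fixes \<phi> :: "'a::complex_space cdual \<Rightarrow> complex"
  assumes fd: "finite_dimensional TYPE('a)" and lin: "clinear \<phi>"
  obtains u where "\<And>l. \<phi> l = \<langle>u, l\<rangle>"
proof -
  obtain B :: "'a set" and co where "dual_bases B co" using dual_bases_exist[OF fd] .
  note B = dual_basesD[OF this]
  define d where "d b = Abs_cdual (co b)" for b
  have "\<phi> l = \<langle>\<Sum>b\<in>B. \<phi> (d b) *\<^sub>C b, l\<rangle>" for l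
  proof -
    have "\<langle>v, l\<rangle> = \<langle>v, \<Sum>b\<in>B. \<langle>b, l\<rangle> *\<^sub>C d b\<rangle>" for v
    proof -
      have "\<langle>v, l\<rangle> = \<langle>\<Sum>b\<in>B. co b v *\<^sub>C b, l\<rangle>" by (simp add: B(3))
      then show ?thesis
        by (simp add: pairing_sum_left pairing_sum_right pairing_scale_left pairing_scale_right
            d_def pairing_Abs_cdual B(2) mult.commute)
    qed
    then have "l = (\<Sum>b\<in>B. \<langle>b, l\<rangle> *\<^sub>C d b)" by (rule cdual_eqI)
    then have "\<phi> l = \<phi> (\<Sum>b\<in>B. \<langle>b, l\<rangle> *\<^sub>C d b)" by simp
    then show ?thesis
      by (simp add: clinear_sum[OF lin] clinear_scale[OF lin] pairing_sum_left pairing_scale_left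
          scaleC_complex_def mult.commute)
  qed
  then show thesis using that by blast
qed

lemma pairing_separates:
  fixes u :: "'a::complex_space"
  assumes fd: "finite_dimensional TYPE('a)" and "\<And>l. \<langle>u, l\<rangle> = \<langle>v, l\<rangle>"
  shows "u = v"
proof -
  obtain B :: "'a set" and co where "dual_bases B co" using dual_bases_exist[OF fd] .
  note B = dual_basesD[OF this]
  have "co b u = co b v" for b
    using assms(2)[of "Abs_cdual (co b)"] by (simp add: pairing_Abs_cdual B(2))
  then have "(\<Sum>b\<in>B. co b u *\<^sub>C b) = (\<Sum>b\<in>B. co b v *\<^sub>C b)" by simp
  then show ?thesis unfolding B(3) .
qed

lemma pairing_cpretranspose:
  fixes v :: "'a::complex_space"
  assumes fd: "finite_dimensional TYPE('a)" and lin: "clinear M"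
  shows "\<langle>cpretranspose M v, l\<rangle> = \<langle>v, M l\<rangle>"
proof -
  have "clinear (\<lambda>l. \<langle>v, M l\<rangle>)" by (rule clinear_compose[OF clinear_pairing_right lin])
  then obtain u where "\<And>l. \<langle>v, M l\<rangle> = \<langle>u, l\<rangle>" by (rule biduality[OF fd]) auto
  then have "\<forall>l. \<langle>cpretranspose M v, l\<rangle> = \<langle>v, M l\<rangle>"
    unfolding cpretranspose_def
    by (intro theI[of "\<lambda>u. \<forall>l. \<langle>u, l\<rangle> = \<langle>v, M l\<rangle>" u]) (auto intro: pairing_separates[OF fd])
  then show ?thesis ..
qed

text \<open>Otherwise some nonzero linear form on the dual kills \<open>L\<close>. By biduality it is evaluation at a
  nonzero vector, and such a vector is excluded by \<open>ann\<close>.\<close>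

lemma dual_subspace_eq_UNIV:
  fixes L :: "'a::complex_space cdual set"
  assumes fd: "finite_dimensional TYPE('a)" and sub: "cspace.subspace L"
    and ann: "\<And>w. (\<And>l. l \<in> L \<Longrightarrow> \<langle>w, l\<rangle> = 0) \<Longrightarrow> w = 0"
  shows "L = UNIV"
proof (rule ccontr)
  assume "L \<noteq> UNIV"
  then obtain m where m: "m \<notin> L" by blast
  obtain C where C: "C \<subseteq> L" "cspace.independent C" "L \<subseteq> cspace.span C"
    using cspace.maximal_independent_subset[of L] by blast
  have "cspace.span C \<subseteq> L" using C(1) sub by (simp add: cspace.span_minimal)
  then have mC: "m \<notin> cspace.span C" "m \<notin> C" using m C by auto
  then have ind: "cspace.independent (insert m C)" using C(2) by (simp add: cspace.independent_insert)
  interpret vector_space_pair "scaleC :: complex \<Rightarrow> 'a cdual \<Rightarrow> 'a cdual"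
    "scaleC :: complex \<Rightarrow> complex \<Rightarrow> complex" ..
  obtain \<phi> :: "'a cdual \<Rightarrow> complex" where \<phi>: "clinear \<phi>"
    "\<forall>x\<in>insert m C. \<phi> x = (if x = m then 1 else 0)"
    using linear_independent_extend[OF ind, of "\<lambda>x. if x = m then 1 else 0"] by auto
  have \<phi>L: "\<phi> l = 0" if "l \<in> L" for l
  proof -
    have "l \<in> cspace.span C" using that C by blast
    then show ?thesis
    proof (induction rule: cspace.span_induct_alt)
      case base show ?case by (simp add: clinear_zero[OF \<phi>(1)])
    next
      case (step c x y)
      then have "\<phi> x = 0" using \<phi>(2) mC by auto
      then show ?case
        by (simp add: clinear_add[OF \<phi>(1)] clinear_scale[OF \<phi>(1)] scaleC_complex_def step)
    qed
  qed
  obtain u where u: "\<And>l. \<phi> l = \<langle>u, l\<rangle>" using biduality[OF fd \<phi>(1)] by blast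
  have "u = 0" using ann[of u] \<phi>L u by simp
  then have "\<phi> m = 0" by (simp add: u pairing_zero_left)
  then show False using \<phi>(2) by simp
qed

section \<open>Schur's lemma and Burnside's theorem\<close>

definition poly_at :: "('a::complex_space \<Rightarrow> 'a) \<Rightarrow> complex poly \<Rightarrow> 'a \<Rightarrow> 'a" where
  "poly_at S p v = (\<Sum>i\<le>degree p. coeff p i *\<^sub>C (S ^^ i) v)"

lemma poly_at_bound:
  assumes "degree p \<le> n"
  shows "poly_at S p v = (\<Sum>i\<le>n. coeff p i *\<^sub>C (S ^^ i) v)"
  unfolding poly_at_def
  by (rule sum.mono_neutral_left) (use assms in \<open>auto simp: coeff_eq_0\<close>)

lemma poly_at_linear_factor:
  assumes S: "clinear S"
  shows "poly_at S ([:-a, 1:] * q) v = S (poly_at S q v) - a *\<^sub>C poly_at S q v"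
proof -
  let ?n = "degree q" and ?p = "[:-a, 1:] * q"
  have p: "?p = pCons 0 q - smult a q" by simp
  have "degree ?p \<le> Suc ?n" using degree_mult_le[of "[:-a, 1:]" q] by simp
  then have "poly_at S ?p v = (\<Sum>i\<le>Suc ?n. coeff ?p i *\<^sub>C (S ^^ i) v)" by (rule poly_at_bound)
  also have "\<dots> = (\<Sum>i\<le>Suc ?n. coeff (pCons 0 q) i *\<^sub>C (S ^^ i) v)
      - (\<Sum>i\<le>Suc ?n. (a * coeff q i) *\<^sub>C (S ^^ i) v)"
    unfolding p by (simp add: sum_subtractf cspace.scale_left_diff_distrib)
  also have "(\<Sum>i\<le>Suc ?n. coeff (pCons 0 q) i *\<^sub>C (S ^^ i) v) = (\<Sum>i\<le>?n. coeff q i *\<^sub>C (S ^^ Suc i) v)"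
    by (subst sum.atMost_Suc_shift) simp
  also have "\<dots> = S (poly_at S q v)"
    by (simp add: poly_at_def clinear_sum[OF S] clinear_scale[OF S])
  also have "(\<Sum>i\<le>Suc ?n. (a * coeff q i) *\<^sub>C (S ^^ i) v) = a *\<^sub>C poly_at S q v"
    by (subst poly_at_bound[of q "Suc ?n"])
       (simp_all add: cspace.scale_sum_right scaleC_scaleC scaleC_add_right coeff_eq_0)
  finally show ?thesis .
qed

text \<open>If \<open>p(S)\<close> kills a nonzero vector, some root of \<open>p\<close> is an eigenvalue of \<open>S\<close>: split off the
  roots one at a time until the remaining factor no longer kills the vector.\<close>

lemma eigenvector_of_killing_poly:
  assumes S: "clinear S" and v: "v \<noteq> 0"
  shows "p \<noteq> 0 \<Longrightarrow> poly_at S p v = 0 \<Longrightarrow> \<exists>a u. u \<noteq> 0 \<and> S u = a *\<^sub>C u"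
proof (induction "degree p" arbitrary: p)
  case 0
  then obtain c where "p = [:c:]" "c \<noteq> 0" by (metis degree_eq_zeroE pCons_0_0)
  then show ?case using 0 v by (simp add: poly_at_def)
next
  case (Suc n)
  then have "\<not> constant (poly p)" by (simp add: constant_degree)
  then obtain a where "poly p a = 0" using fundamental_theorem_of_algebra by blast
  then obtain q where q: "p = [:-a, 1:] * q" by (metis poly_eq_0_iff_dvd dvdE)
  have "q \<noteq> 0" using Suc q by auto
  then have deg: "n = degree q" using Suc(2) q by (subst (asm) q, subst (asm) degree_mult_eq) auto
  show ?case
  proof (cases "poly_at S q v = 0")
    case True
    then show ?thesis using Suc(1)[OF deg \<open>q \<noteq> 0\<close>] by blast
  next
    case False
    have "S (poly_at S q v) = a *\<^sub>C poly_at S q v"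
      using Suc(4) poly_at_linear_factor[OF S, of a q v] q by simp
    then show ?thesis using False by blast
  qed
qed

lemma eigenvector_exists:
  fixes S :: "'a::complex_space \<Rightarrow> 'a"
  assumes fd: "finite_dimensional TYPE('a)" and S: "clinear S" and v: "v \<noteq> (0::'a)"
  obtains a u where "u \<noteq> 0" "S u = a *\<^sub>C u"
proof -
  obtain F :: "'a set" where F: "finite F" "cspace.span F = UNIV"
    using fd unfolding finite_dimensional_def by blast
  let ?n = "card F"
  \<comment> \<open>One iterate more than a spanning set has elements; when two iterates coincide, their difference
    is already a relation.\<close>
  have "\<exists>c. (\<exists>i\<le>?n. c i \<noteq> 0) \<and> (\<Sum>i\<le>?n. c i *\<^sub>C (S ^^ i) v) = 0"
  proof (cases "inj_on (\<lambda>i. (S ^^ i) v) {..?n}")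
    case True
    let ?A = "(\<lambda>i. (S ^^ i) v) ` {..?n}"
    have "card ?A = Suc ?n" using True by (simp add: card_image)
    then have "cspace.dependent ?A"
      using cspace.independent_span_bound[OF F(1), of ?A] F(2) by auto
    then obtain u where u: "\<exists>x\<in>?A. u x \<noteq> 0" "(\<Sum>x\<in>?A. u x *\<^sub>C x) = 0"
      using cspace.dependent_finite[of ?A] by auto
    have "(\<Sum>i\<le>?n. u ((S ^^ i) v) *\<^sub>C (S ^^ i) v) = 0"
      using u(2) True by (simp add: sum.reindex)
    then show ?thesis using u(1) by (intro exI[of _ "\<lambda>i. u ((S ^^ i) v)"]) auto
  next
    case False
    then obtain i j where ij: "i \<le> ?n" "j \<le> ?n" "i \<noteq> j" "(S ^^ i) v = (S ^^ j) v"
      unfolding inj_on_def by auto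
    let ?c = "\<lambda>k. if k = i then 1 else if k = j then -1 else (0::complex)"
    have "(\<Sum>k\<le>?n. ?c k *\<^sub>C (S ^^ k) v) = (\<Sum>k\<in>{i,j}. ?c k *\<^sub>C (S ^^ k) v)"
      by (rule sum.mono_neutral_right) (use ij in auto)
    also have "\<dots> = 0" using ij by (simp add: scaleC_one)
    finally show ?thesis using ij(1) by (intro exI[of _ ?c]) auto
  qed
  then obtain c where c: "\<exists>i\<le>?n. c i \<noteq> 0" "(\<Sum>i\<le>?n. c i *\<^sub>C (S ^^ i) v) = 0" by blast
  define p where "p = (\<Sum>i\<le>?n. monom (c i) i)"
  have cp: "coeff p k = (if k \<le> ?n then c k else 0)" for k
    by (simp add: p_def coeff_sum)
  have "p \<noteq> 0" using c(1) cp by (metis coeff_0)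
  moreover have "degree p \<le> ?n" by (rule degree_le) (simp add: cp)
  then have "poly_at S p v = 0" using c(2) by (simp add: poly_at_bound cp)
  ultimately show thesis using eigenvector_of_killing_poly[OF S v] that by blast
qed

lemma irreducible_linear:
  "irreducible_representation H (UNIV :: 'a::complex_space set) \<rho> \<Longrightarrow> h \<in> carrier H \<Longrightarrow> clinear (\<rho> h)"
  by (simp add: irreducible_representation_def representation_def linear_on_space_def clinear_iff)

lemma schur_scalar:
  fixes \<rho> :: "'g \<Rightarrow> 'a::complex_space \<Rightarrow> 'a"
  assumes irr: "irreducible_representation H UNIV \<rho>" and fd: "finite_dimensional TYPE('a)"
    and S: "clinear S" and comm: "\<And>h v. h \<in> carrier H \<Longrightarrow> S (\<rho> h v) = \<rho> h (S v)"
  obtains a where "\<And>v. S v = a *\<^sub>C v"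
proof -
  obtain v0 :: 'a where "v0 \<noteq> 0"
    using irr unfolding irreducible_representation_def by blast
  then obtain a u where u: "u \<noteq> 0" "S u = a *\<^sub>C u" using eigenvector_exists[OF fd S] by metis
  let ?E = "{v. S v = a *\<^sub>C v}"
  have "cspace.subspace ?E"
    by (simp add: cspace.subspace_def clinear_zero[OF S] clinear_add[OF S] clinear_scale[OF S]
        scaleC_add_right scaleC_scaleC mult.commute)
  moreover have "\<rho> h ` ?E \<subseteq> ?E" if "h \<in> carrier H" for h
    using comm[OF that] clinear_scale[OF irreducible_linear[OF irr that]] by auto
  ultimately have "?E = {0} \<or> ?E = UNIV"
    using irr unfolding irreducible_representation_def by blast
  then show thesis using u that by blast
qed

text \<open>The sum over \<open>H\<close> of the conjugates of \<open>y \<mapsto> l(y) z\<close> commutes with \<open>H\<close>, so it is a scalar \<open>\<mu>\<close>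
  by Schur; comparing traces, computed in a basis, gives \<open>dim \<cdot> \<mu> = |H| l(z)\<close>. Read as a function
  of \<open>z\<close>, this writes every operator of rank one, and therefore every operator, as a combination
  of the \<open>\<rho>(h)\<close>.\<close>

theorem burnside:
  fixes \<rho> :: "'g \<Rightarrow> 'a::complex_space \<Rightarrow> 'a"
  assumes irr: "irreducible_representation H UNIV \<rho>" and fd: "finite_dimensional TYPE('a)"
    and H: "group H" "finite (carrier H)" and A: "clinear A"
  obtains a where "\<And>z. A z = (\<Sum>h\<in>carrier H. a h *\<^sub>C \<rho> h z)"
proof -
  interpret H: group H by (rule H(1))
  let ?H = "carrier H"
  note lin = irreducible_linear[OF irr]
  have mult: "\<rho> (g \<otimes>\<^bsub>H\<^esub> h) v = \<rho> g (\<rho> h v)" if "g \<in> ?H" "h \<in> ?H" for g h v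
    using irr that unfolding irreducible_representation_def representation_def by auto
  have one: "\<rho> \<one>\<^bsub>H\<^esub> v = v" for v
    using irr unfolding irreducible_representation_def representation_def by auto
  obtain v0 :: 'a where v0: "v0 \<noteq> 0"
    using irr unfolding irreducible_representation_def by blast
  obtain B :: "'a set" and co where "dual_bases B co" using dual_bases_exist[OF fd] .
  note B = dual_basesD[OF this]
  have "B \<noteq> {}" using B(3)[of v0] v0 by auto
  then have cB: "complex_of_nat (card B) \<noteq> 0" using B(1) by simp
  have key: "(\<Sum>h\<in>?H. l (\<rho> (inv\<^bsub>H\<^esub> h) y) *\<^sub>C \<rho> h z)
      = (of_nat (card ?H) / of_nat (card B) * l z) *\<^sub>C y" if l: "clinear l" for l y z
  proof -
    define S where "S y = (\<Sum>h\<in>?H. l (\<rho> (inv\<^bsub>H\<^esub> h) y) *\<^sub>C \<rho> h z)" for y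
    have S: "clinear S"
      unfolding S_def clinear_iff
      by (simp add: clinear_add[OF lin] clinear_scale[OF lin] clinear_add[OF l] clinear_scale[OF l]
          scaleC_add_left sum.distrib cspace.scale_sum_right scaleC_scaleC scaleC_complex_def)
    have "S (\<rho> k v) = \<rho> k (S v)" if k: "k \<in> ?H" for k v
    proof -
      have "S (\<rho> k v) = (\<Sum>h\<in>?H. l (\<rho> (inv\<^bsub>H\<^esub> (k \<otimes>\<^bsub>H\<^esub> h)) (\<rho> k v)) *\<^sub>C \<rho> (k \<otimes>\<^bsub>H\<^esub> h) z)"
        unfolding S_def
        by (rule sum.reindex_bij_witness[of _ "\<lambda>h. k \<otimes>\<^bsub>H\<^esub> h" "\<lambda>h. inv\<^bsub>H\<^esub> k \<otimes>\<^bsub>H\<^esub> h"])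
           (use k in \<open>auto simp: H.m_assoc[symmetric]\<close>)
      also have "\<dots> = (\<Sum>h\<in>?H. l (\<rho> (inv\<^bsub>H\<^esub> h) v) *\<^sub>C \<rho> k (\<rho> h z))"
      proof (rule sum.cong[OF refl])
        fix h assume h: "h \<in> ?H"
        have "\<rho> (inv\<^bsub>H\<^esub> (k \<otimes>\<^bsub>H\<^esub> h)) (\<rho> k v) = \<rho> (inv\<^bsub>H\<^esub> h) v"
          using h k by (simp add: mult[symmetric] H.inv_mult_group H.m_assoc)
        then show "l (\<rho> (inv\<^bsub>H\<^esub> (k \<otimes>\<^bsub>H\<^esub> h)) (\<rho> k v)) *\<^sub>C \<rho> (k \<otimes>\<^bsub>H\<^esub> h) z
            = l (\<rho> (inv\<^bsub>H\<^esub> h) v) *\<^sub>C \<rho> k (\<rho> h z)"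
          using h k by (simp add: mult)
      qed
      also have "\<dots> = \<rho> k (S v)"
        by (simp add: S_def clinear_sum[OF lin[OF k]] clinear_scale[OF lin[OF k]])
      finally show ?thesis .
    qed
    then obtain \<mu> where \<mu>: "\<And>v. S v = \<mu> *\<^sub>C v" using schur_scalar[OF irr fd S] by metis
    have "of_nat (card B) * \<mu> = (\<Sum>b\<in>B. co b (S b))"
      by (simp add: \<mu> clinear_scale[OF B(2)] B(4) scaleC_complex_def)
    also have "\<dots> = (\<Sum>b\<in>B. \<Sum>h\<in>?H. l (\<rho> (inv\<^bsub>H\<^esub> h) b) * co b (\<rho> h z))"
      by (simp add: S_def clinear_sum[OF B(2)] clinear_scale[OF B(2)] scaleC_complex_def)
    also have "\<dots> = (\<Sum>h\<in>?H. \<Sum>b\<in>B. l (\<rho> (inv\<^bsub>H\<^esub> h) b) * co b (\<rho> h z))"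
      by (rule sum.swap)
    also have "\<dots> = (\<Sum>h\<in>?H. l z)"
    proof (rule sum.cong[OF refl])
      fix h assume h: "h \<in> ?H"
      have "(\<Sum>b\<in>B. l (\<rho> (inv\<^bsub>H\<^esub> h) b) * co b (\<rho> h z))
          = l (\<rho> (inv\<^bsub>H\<^esub> h) (\<Sum>b\<in>B. co b (\<rho> h z) *\<^sub>C b))"
        using h by (simp add: clinear_sum[OF lin] clinear_sum[OF l] clinear_scale[OF lin]
            clinear_scale[OF l] scaleC_complex_def mult.commute)
      also have "\<dots> = l z" using h by (simp add: B(3) mult[symmetric] one)
      finally show "(\<Sum>b\<in>B. l (\<rho> (inv\<^bsub>H\<^esub> h) b) * co b (\<rho> h z)) = l z" .
    qed
    finally have "\<mu> = of_nat (card ?H) / of_nat (card B) * l z"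
      using cB by (simp add: field_simps)
    then show ?thesis using \<mu>[of y] by (simp add: S_def)
  qed
  have cH: "complex_of_nat (card ?H) \<noteq> 0" using H(2) H.one_closed by auto
  let ?k = "complex_of_nat (card B) / of_nat (card ?H)"
  define a where "a h = (\<Sum>b\<in>B. ?k * co b (\<rho> (inv\<^bsub>H\<^esub> h) (A b)))" for h
  have "A z = (\<Sum>h\<in>?H. a h *\<^sub>C \<rho> h z)" for z
  proof -
    have "(\<Sum>h\<in>?H. a h *\<^sub>C \<rho> h z) = (\<Sum>h\<in>?H. \<Sum>b\<in>B. ?k *\<^sub>C co b (\<rho> (inv\<^bsub>H\<^esub> h) (A b)) *\<^sub>C \<rho> h z)"
      by (simp add: a_def cspace.scale_sum_left scaleC_scaleC)
    also have "\<dots> = (\<Sum>b\<in>B. ?k *\<^sub>C (\<Sum>h\<in>?H. co b (\<rho> (inv\<^bsub>H\<^esub> h) (A b)) *\<^sub>C \<rho> h z))"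
      by (subst sum.swap) (simp add: cspace.scale_sum_right)
    also have "\<dots> = (\<Sum>b\<in>B. co b z *\<^sub>C A b)"
      unfolding key[OF B(2)] using cB cH by (simp add: scaleC_scaleC)
    also have "\<dots> = A (\<Sum>b\<in>B. co b z *\<^sub>C b)"
      by (simp add: clinear_sum[OF A] clinear_scale[OF A])
    finally show ?thesis by (simp add: B(3))
  qed
  then show thesis using that by blast
qed

text \<open>An orbit spans a nonzero stable subspace.\<close>

lemma irreducible_finite_dimensional:
  fixes \<rho> :: "'g \<Rightarrow> 'a::complex_space \<Rightarrow> 'a"
  assumes irr: "irreducible_representation H UNIV \<rho>" and H: "group H" "finite (carrier H)"
  shows "finite_dimensional TYPE('a)"
proof -
  interpret H: group H by (rule H(1))
  note lin = irreducible_linear[OF irr]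
  obtain v0 :: 'a where v0: "v0 \<noteq> 0"
    using irr unfolding irreducible_representation_def by blast
  let ?O = "(\<lambda>h. \<rho> h v0) ` carrier H"
  have st: "\<rho> g x \<in> cspace.span ?O" if g: "g \<in> carrier H" and x: "x \<in> cspace.span ?O" for g x
    using x
  proof (induction rule: cspace.span_induct_alt)
    case base show ?case by (simp add: clinear_zero[OF lin[OF g]] cspace.span_zero)
  next
    case (step c x y)
    then obtain h where h: "h \<in> carrier H" "x = \<rho> h v0" by blast
    have "\<rho> g x = \<rho> (g \<otimes>\<^bsub>H\<^esub> h) v0"
      using irr g h unfolding irreducible_representation_def representation_def by auto
    then have "\<rho> g x \<in> ?O" using g h by blast
    then show ?case
      by (simp add: clinear_add[OF lin[OF g]] clinear_scale[OF lin[OF g]] cspace.span_add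
          cspace.span_scale cspace.span_base step)
  qed
  have "\<rho> \<one>\<^bsub>H\<^esub> v0 = v0"
    using irr unfolding irreducible_representation_def representation_def by auto
  then have "v0 \<in> ?O" using H.one_closed by (metis imageI)
  then have "v0 \<in> cspace.span ?O" by (rule cspace.span_base)
  then have "cspace.span ?O \<noteq> {0}" using v0 by blast
  moreover have "cspace.span ?O = {0} \<or> cspace.span ?O = UNIV"
    using irr st cspace.subspace_span[of ?O]
    unfolding irreducible_representation_def by (simp add: image_subset_iff)
  ultimately have "cspace.span ?O = UNIV" by blast
  then show ?thesis unfolding finite_dimensional_def using H(2) by blast
qed

section \<open>Sums over cosets\<close>

lemma coset_sum_eq_sum:
  assumes "finite F" "F \<subseteq> \<C>" "\<And>C. C \<in> \<C> - F \<Longrightarrow> t (SOME x. x \<in> C) = 0"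
  shows "coset_sum \<C> t = (\<Sum>C\<in>F. t (SOME x. x \<in> C))"
  unfolding coset_sum_def
  by (rule sum.mono_neutral_left) (use assms in auto)

locale group_with_subgroup = group G + J: subgroup J G for G (structure) and J
begin

text \<open>Representatives over which a coset sum of a function supported in \<open>S\<close> may be taken. Cosets that
  do not meet \<open>S\<close> are allowed, so that one transversal can serve several functions.\<close>

definition right_transversal :: "'a set \<Rightarrow> 'a set \<Rightarrow> bool" where
  "right_transversal R S \<longleftrightarrow> finite R \<and> R \<subseteq> carrier G \<and> inj_on (\<lambda>r. J #> r) R \<and>
     S \<inter> carrier G \<subseteq> (\<Union>r\<in>R. J #> r)"

lemma right_transversal_subset:
  "right_transversal R S \<Longrightarrow> S' \<subseteq> S \<Longrightarrow> right_transversal R S'"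
  unfolding right_transversal_def by blast

lemma right_transversal_exists:
  assumes "finite R" "R \<subseteq> carrier G" "S \<inter> carrier G \<subseteq> (\<Union>r\<in>R. J #> r)"
  obtains R' where "right_transversal R' S"
proof -
  let ?f = "\<lambda>r. J #> r"
  obtain R' where "R' \<subseteq> R \<and> inj_on ?f R' \<and> ?f ` R = ?f ` R'"
    using subset_image_inj[THEN iffD1, OF subset_refl[of "?f ` R"]] by (elim exE)
  then have R': "R' \<subseteq> R" "inj_on ?f R'" "?f ` R = ?f ` R'" by simp_all
  have "right_transversal R' S"
    unfolding right_transversal_def
    using assms R'(1,2) finite_subset[OF R'(1)] unfolding R'(3) by blast
  then show thesis by (rule that)
qed

lemma rcos_memE:
  assumes "x \<in> J #> r" obtains j where "j \<in> J" "x = j \<otimes> r"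
  using assms unfolding r_coset_def by blast

lemma lcos_memE:
  assumes "x \<in> r <# J" obtains j where "j \<in> J" "x = r \<otimes> j"
  using assms unfolding l_coset_def by blast

lemma some_rcos:
  assumes "r \<in> carrier G"
  obtains j where "j \<in> J" "(SOME x. x \<in> J #> r) = j \<otimes> r"
proof -
  have "(SOME x. x \<in> J #> r) \<in> J #> r"
    using rcos_self[OF assms J.subgroup_axioms] by (rule someI)
  then show thesis using that by (rule rcos_memE)
qed

lemma some_lcos:
  assumes "r \<in> carrier G"
  obtains j where "j \<in> J" "(SOME x. x \<in> r <# J) = r \<otimes> j"
proof -
  have "r \<in> r <# J" using assms J.one_closed unfolding l_coset_def by force
  then have "(SOME x. x \<in> r <# J) \<in> r <# J" by (rule someI)
  then show thesis using that by (rule lcos_memE)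
qed

lemma rcos_eq_mult: "j \<in> J \<Longrightarrow> r \<in> carrier G \<Longrightarrow> J #> (j \<otimes> r) = J #> r"
  by (metis rcosI repr_independence J.subgroup_axioms J.subset)

lemma coset_sum_rcosets:
  assumes R: "right_transversal R S"
    and inv: "\<And>j g. j \<in> J \<Longrightarrow> g \<in> carrier G \<Longrightarrow> t (j \<otimes> g) = t g"
    and supp: "\<And>g. g \<in> carrier G \<Longrightarrow> t g \<noteq> 0 \<Longrightarrow> g \<in> S"
  shows "coset_sum (rcosets J) t = (\<Sum>r\<in>R. t r)"
proof -
  note R' = R[unfolded right_transversal_def]
  have some: "t (SOME x. x \<in> J #> r) = t r" if r: "r \<in> carrier G" for r
    by (rule some_rcos[OF r]) (simp add: inv r)
  let ?F = "(\<lambda>r. J #> r) ` R"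
  have "coset_sum (rcosets J) t = (\<Sum>C\<in>?F. t (SOME x. x \<in> C))"
  proof (rule coset_sum_eq_sum)
    show "finite ?F" using R' by simp
    show "?F \<subseteq> rcosets J" using R' unfolding RCOSETS_def by auto
    fix C assume C: "C \<in> rcosets J - ?F"
    then obtain a where a: "a \<in> carrier G" "C = J #> a" unfolding RCOSETS_def by auto
    have "t a = 0"
    proof (rule ccontr)
      assume "t a \<noteq> 0"
      then obtain r where r: "r \<in> R" "a \<in> J #> r" using supp a R' by blast
      then have "C = J #> r" using a R' repr_independence[OF r(2) _ J.subgroup_axioms] by auto
      then show False using r C by blast
    qed
    then show "t (SOME x. x \<in> C) = 0" using some a by simp
  qed
  also have "\<dots> = (\<Sum>r\<in>R. t (SOME x. x \<in> J #> r))" using R' by (simp add: sum.reindex)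
  also have "\<dots> = (\<Sum>r\<in>R. t r)" by (rule sum.cong) (use R' some in auto)
  finally show ?thesis .
qed

text \<open>Inversion carries right cosets to left cosets, so translating the inverses of a right
  transversal yields the left cosets that are needed.\<close>

lemma coset_sum_lcosets:
  assumes R: "right_transversal R S" and y: "y \<in> carrier G"
    and inv: "\<And>j g. j \<in> J \<Longrightarrow> g \<in> carrier G \<Longrightarrow> t (g \<otimes> j) = t g"
    and supp: "\<And>g. g \<in> carrier G \<Longrightarrow> t g \<noteq> 0 \<Longrightarrow> inv g \<otimes> y \<in> S"
  shows "coset_sum (lcosets J) t = (\<Sum>r\<in>R. t (y \<otimes> inv r))"
proof -
  note R' = R[unfolded right_transversal_def]
  have Rc: "r \<in> carrier G" if "r \<in> R" for r using R' that by auto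
  have some: "t (SOME x. x \<in> r <# J) = t r" if r: "r \<in> carrier G" for r
    by (rule some_lcos[OF r]) (simp add: inv r)
  let ?f = "\<lambda>r. (y \<otimes> inv r) <# J"
  let ?F = "?f ` R"
  have inj: "inj_on ?f R"
  proof (rule inj_onI)
    fix r s assume rs: "r \<in> R" "s \<in> R" "?f r = ?f s"
    have "y \<otimes> inv r \<in> ?f r" using y Rc[OF rs(1)] J.one_closed unfolding l_coset_def by force
    then have "y \<otimes> inv r \<in> ?f s" using rs(3) by simp
    then obtain j where j: "j \<in> J" "y \<otimes> inv r = (y \<otimes> inv s) \<otimes> j"
      by (rule lcos_memE)
    have jc: "j \<in> carrier G" using j(1) J.subset by blast
    have "inv r = inv s \<otimes> j" using j(2) y Rc rs jc by (simp add: m_assoc)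
    then have "inv (inv r) = inv (inv s \<otimes> j)" by simp
    then have "r = inv j \<otimes> s" using Rc rs jc by (simp add: inv_mult_group)
    then have "J #> r = J #> s" using rcos_eq_mult[of "inv j" s] j(1) Rc rs by simp
    then show "r = s" using R' rs by (auto dest: inj_onD)
  qed
  have "coset_sum (lcosets J) t = (\<Sum>C\<in>?F. t (SOME x. x \<in> C))"
  proof (rule coset_sum_eq_sum)
    show "finite ?F" using R' by simp
    show "?F \<subseteq> lcosets J" 
    proof
      fix C assume "C \<in> ?F"
      then obtain r where "C = ?f r" "r \<in> R" by blast
      note \<open>C = ?f r\<close>
      moreover have "y \<otimes> inv r \<in> carrier G" using y Rc \<open>r \<in> R\<close> by simp
      ultimately show "C \<in> lcosets J" unfolding LCOSETS_def by blast
    qed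
    fix C assume C: "C \<in> lcosets J - ?F"
    then obtain a where a: "a \<in> carrier G" "C = a <# J" unfolding LCOSETS_def by auto
    have "t a = 0"
    proof (rule ccontr)
      assume "t a \<noteq> 0"
      then have "inv a \<otimes> y \<in> S \<inter> carrier G" using supp a y by auto
      then obtain r where r: "r \<in> R" "inv a \<otimes> y \<in> J #> r" using R' by blast
      obtain j where j: "j \<in> J" "inv a \<otimes> y = j \<otimes> r" using r(2) by (rule rcos_memE)
      have jc: "j \<in> carrier G" using j(1) J.subset by blast
      have "y = a \<otimes> (j \<otimes> r)" using j(2) a y jc Rc[OF r(1)] by (metis inv_solve_left m_closed)
      then have "y \<otimes> inv r = a \<otimes> j" using a jc Rc[OF r(1)] by (simp add: m_assoc)
      then have "?f r = a <# (j <# J)" using a jc J.subset by (simp add: lcos_m_assoc)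
      then have "?f r = C" using a(2) coset_join3[OF jc J.subgroup_axioms j(1)] by simp
      then show False using r C by blast
    qed
    then show "t (SOME x. x \<in> C) = 0" using some a by simp
  qed
  also have "\<dots> = (\<Sum>r\<in>R. t (SOME x. x \<in> ?f r))" using inj by (simp add: sum.reindex)
  also have "\<dots> = (\<Sum>r\<in>R. t (y \<otimes> inv r))" by (rule sum.cong) (use Rc y some in auto)
  finally show ?thesis .
qed

lemma right_transversal_translate:
  assumes R: "right_transversal R S" and a: "a \<in> carrier G"
  shows "inj_on (\<lambda>r. r \<otimes> a) R"
    and "right_transversal ((\<lambda>r. r \<otimes> a) ` R) {g. g \<in> carrier G \<longrightarrow> g \<otimes> inv a \<in> S}"
proof -
  note R' = R[unfolded right_transversal_def]
  show inj: "inj_on (\<lambda>r. r \<otimes> a) R"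
    using R' a by (intro inj_onI) (metis right_cancel subsetD)
  have tr: "J #> (r \<otimes> a) #> inv a = J #> r" if "r \<in> R" for r
  proof -
    have "r \<in> carrier G" using that R' by auto
    then show ?thesis using a J.subset by (simp add: coset_mult_assoc m_assoc)
  qed
  show "right_transversal ((\<lambda>r. r \<otimes> a) ` R) {g. g \<in> carrier G \<longrightarrow> g \<otimes> inv a \<in> S}"
    unfolding right_transversal_def
  proof (intro conjI subsetI)
    show "inj_on ((#>) J) ((\<lambda>r. r \<otimes> a) ` R)"
    proof (rule inj_onI, elim imageE, hypsubst)
      fix r s assume rs: "J #> (r \<otimes> a) = J #> (s \<otimes> a)" "r \<in> R" "s \<in> R"
      then have "J #> r = J #> s" using tr by metis
      then have "r = s" using rs R' by (auto dest: inj_onD)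
      then show "r \<otimes> a = s \<otimes> a" by simp
    qed
  next
    fix g assume "g \<in> {g. g \<in> carrier G \<longrightarrow> g \<otimes> inv a \<in> S} \<inter> carrier G"
    then have g: "g \<in> carrier G" "g \<otimes> inv a \<in> S \<inter> carrier G" using a by auto
    then obtain r where r: "r \<in> R" "g \<otimes> inv a \<in> J #> r" using R' by blast
    obtain j where j: "j \<in> J" "g \<otimes> inv a = j \<otimes> r" using r(2) by (rule rcos_memE)
    have c: "j \<in> carrier G" "r \<in> carrier G" using j r R' J.subset by auto
    have "g = j \<otimes> r \<otimes> a" using j(2) g(1) a c by (metis inv_solve_right m_closed)
    then have "g = j \<otimes> (r \<otimes> a)" using a c by (simp add: m_assoc)
    then have "g \<in> J #> (r \<otimes> a)" using j(1) unfolding r_coset_def by blast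
    then show "g \<in> (\<Union>r\<in>(\<lambda>r. r \<otimes> a) ` R. J #> r)" using r(1) by blast
  qed (use R' a in auto)
qed

end

section \<open>The module of a type and its Hecke algebra\<close>

text \<open>The last assumptions isolate what is used of the topology: compact sets meet finitely many
  cosets, translation preserves compactness, and a subgroup containing the kernel of \<open>lam\<close> is
  open.\<close>

locale type_of_group = group_with_subgroup G J for G (structure) and J +
  fixes T :: "'a topology" and lam :: "'a \<Rightarrow> 'w::complex_space \<Rightarrow> 'w"
  assumes fd: "finite_dimensional TYPE('w)"
    and lam_linear: "j \<in> J \<Longrightarrow> clinear (lam j)"
    and lam_mult: "j \<in> J \<Longrightarrow> k \<in> J \<Longrightarrow> lam (j \<otimes> k) w = lam j (lam k w)"
    and lam_one: "lam \<one> w = w"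
    and lam_irreducible: "cspace.subspace U \<Longrightarrow> (\<And>j. j \<in> J \<Longrightarrow> lam j ` U \<subseteq> U) \<Longrightarrow> U = {0} \<or> U = UNIV"
    and right_cover: "compactin T C \<Longrightarrow> \<exists>R. finite R \<and> R \<subseteq> carrier G \<and> C \<subseteq> (\<Union>r\<in>R. J #> r)"
    and left_cover: "compactin T C \<Longrightarrow> \<exists>R. finite R \<and> R \<subseteq> carrier G \<and> C \<subseteq> (\<Union>r\<in>R. r <# J)"
    and compact_translate: "compactin T C \<Longrightarrow> a \<in> carrier G \<Longrightarrow> compactin T ((\<lambda>g. g \<otimes> a) ` C)"
    and kernel_open: "subgroup S G \<Longrightarrow> {j \<in> J. \<forall>w. lam j w = w} \<subseteq> S \<Longrightarrow> openin T S"
begin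

abbreviation "lam' \<equiv> contragredient_action G lam"
abbreviation "\<X> \<equiv> type_module G T J lam"

lemma J_carrier: "j \<in> J \<Longrightarrow> j \<in> carrier G"
  using J.subset by blast

lemma lam_inv: "j \<in> J \<Longrightarrow> lam (inv j) (lam j w) = w" "j \<in> J \<Longrightarrow> lam j (lam (inv j) w) = w"
  using lam_mult[of "inv j" j] lam_mult[of j "inv j"] by (simp_all add: lam_one J_carrier)

lemma pairing_lam': "j \<in> J \<Longrightarrow> \<langle>w, lam' j l\<rangle> = \<langle>lam (inv j) w, l\<rangle>"
  unfolding contragredient_action_def by (rule pairing_ctranspose) (simp add: lam_linear)

lemma lam'_one: "lam' \<one> l = l"
  by (rule cdual_eqI) (simp add: pairing_lam' lam_one)

lemma lam'_inv: "j \<in> J \<Longrightarrow> lam' (inv j) (lam' j l) = l"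
  by (rule cdual_eqI) (simp add: pairing_lam' lam_inv J_carrier)

definition equivariant' :: "('a \<Rightarrow> 'w cdual) \<Rightarrow> bool" where
  "equivariant' \<Lambda> \<longleftrightarrow> (\<forall>j\<in>J. \<forall>g\<in>carrier G. \<Lambda> (j \<otimes> g) = lam' j (\<Lambda> g))"

lemma hecke_spaceD:
  assumes "\<Psi> \<in> hecke_space G J lam"
  shows "g \<notin> carrier G \<Longrightarrow> \<Psi> g = 0" "g \<in> carrier G \<Longrightarrow> clinear (\<Psi> g)"
    "j \<in> J \<Longrightarrow> g \<in> carrier G \<Longrightarrow> \<Psi> (j \<otimes> g) l = lam' j (\<Psi> g l)"
    "j \<in> J \<Longrightarrow> g \<in> carrier G \<Longrightarrow> \<Psi> (g \<otimes> j) l = \<Psi> g (lam' j l)"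
proof -
  note d = assms[unfolded hecke_space_def mem_Collect_eq]
  show "g \<notin> carrier G \<Longrightarrow> \<Psi> g = 0" "g \<in> carrier G \<Longrightarrow> clinear (\<Psi> g)" using d by auto
  have e: "\<Psi> (j \<otimes> g \<otimes> k) l = lam' j (\<Psi> g (lam' k l))" if "j \<in> J" "k \<in> J" "g \<in> carrier G" for j k g l
  proof -
    have "\<Psi> (j \<otimes> g \<otimes> k) = lam' j \<circ> \<Psi> g \<circ> lam' k"
      using d[THEN conjunct2, THEN conjunct2] that by (simp del: o_apply)
    then show ?thesis by simp
  qed
  show "j \<in> J \<Longrightarrow> g \<in> carrier G \<Longrightarrow> \<Psi> (j \<otimes> g) l = lam' j (\<Psi> g l)"
    using e[of j \<one> g l] by (simp add: lam'_one J_carrier)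
  show "j \<in> J \<Longrightarrow> g \<in> carrier G \<Longrightarrow> \<Psi> (g \<otimes> j) l = \<Psi> g (lam' j l)"
    using e[of \<one> j g l] by (simp add: lam'_one)
qed

lemma hecke_space_equivariant': "\<Psi> \<in> hecke_space G J lam \<Longrightarrow> equivariant' (\<lambda>g. \<Psi> g l)"
  unfolding equivariant'_def by (simp add: hecke_spaceD)

lemma type_moduleD:
  assumes "f \<in> \<X>"
  shows "g \<notin> carrier G \<Longrightarrow> f g = 0" "j \<in> J \<Longrightarrow> g \<in> carrier G \<Longrightarrow> f (j \<otimes> g) = lam j (f g)"
    "compactly_supported T f"
  using assms by (auto simp: type_module_def equivariant_functions_def)

lemma compact_support:
  assumes "compactly_supported T (f :: 'a \<Rightarrow> 'v::zero)"
  obtains C where "compactin T C" "{x. f x \<noteq> 0} \<subseteq> C"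
  using assms unfolding compactly_supported_def by blast

lemma type_module_subspace: "cspace.subspace \<X>"
proof (rule cspace.subspaceI)
  show "0 \<in> \<X>"
    by (auto simp: type_module_def equivariant_functions_def compactly_supported_def
        clinear_zero[OF lam_linear])
next
  fix f g assume fg: "f \<in> \<X>" "g \<in> \<X>"
  obtain C where C: "compactin T C" "{x. f x \<noteq> 0} \<subseteq> C"
    using compact_support[OF type_moduleD(3)[OF fg(1)]] .
  obtain D where D: "compactin T D" "{x. g x \<noteq> 0} \<subseteq> D"
    using compact_support[OF type_moduleD(3)[OF fg(2)]] .
  have "(f + g) x \<noteq> 0 \<Longrightarrow> x \<in> C \<union> D" for x using C(2) D(2) by force
  then have "compactly_supported T (f + g)"
    unfolding compactly_supported_def using compactin_Un[OF C(1) D(1)] by blast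
  then show "f + g \<in> \<X>"
    using fg by (simp add: type_module_def equivariant_functions_def clinear_add[OF lam_linear])
next
  fix a f assume f: "f \<in> \<X>"
  obtain C where C: "compactin T C" "{x. f x \<noteq> 0} \<subseteq> C"
    using compact_support[OF type_moduleD(3)[OF f]] .
  have "(a *\<^sub>C f) x \<noteq> 0 \<Longrightarrow> x \<in> C" for x using C(2) by (auto simp: scaleC_fun_def)
  then have "compactly_supported T (a *\<^sub>C f)"
    unfolding compactly_supported_def using C(1) by blast
  then show "a *\<^sub>C f \<in> \<X>"
    using f by (simp add: type_module_def equivariant_functions_def scaleC_fun_def
        clinear_scale[OF lam_linear])
qed

lemma compact_transversal:
  assumes "compactin T C" obtains R where "right_transversal R C"
proof -
  obtain R where "finite R" "R \<subseteq> carrier G" "C \<subseteq> (\<Union>r\<in>R. J #> r)"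
    using right_cover[OF assms] by blast
  then show thesis using right_transversal_exists[of R C] that by blast
qed

lemma type_module_transversal:
  assumes "f \<in> \<X>" obtains R where "right_transversal R {g. f g \<noteq> 0}"
proof -
  obtain C where C: "compactin T C" "{x. f x \<noteq> 0} \<subseteq> C"
    using compact_support[OF type_moduleD(3)[OF assms]] .
  obtain R where "right_transversal R C" using compact_transversal[OF C(1)] .
  then have "right_transversal R {g. f g \<noteq> 0}"
    by (rule right_transversal_subset) (rule C(2))
  then show thesis by (rule that)
qed

lemma right_translation_type_module:
  assumes f: "f \<in> \<X>" and a: "a \<in> carrier G"
  shows "right_translation G a f \<in> \<X>"
proof -
  obtain C where C: "compactin T C" "{x. f x \<noteq> 0} \<subseteq> C"
    using compact_support[OF type_moduleD(3)[OF f]] .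
  have "x \<in> (\<lambda>g. g \<otimes> inv a) ` C" if "right_translation G a f x \<noteq> 0" for x
  proof (rule image_eqI)
    show "x = (x \<otimes> a) \<otimes> inv a" "x \<otimes> a \<in> C"
      using that C(2) a
      by (auto simp: right_translation_def m_assoc split: if_splits)
  qed
  then have "compactly_supported T (right_translation G a f)"
    unfolding compactly_supported_def using compact_translate[OF C(1), of "inv a"] a by blast
  then show ?thesis
    using f a by (auto simp: type_module_def equivariant_functions_def right_translation_def
        m_assoc J_carrier)
qed

lemma type_pairing_eq:
  assumes f: "f \<in> \<X>" and \<Lambda>: "equivariant' \<Lambda>" and R: "right_transversal R {g. f g \<noteq> 0}"
  shows "type_pairing G J f \<Lambda> = (\<Sum>r\<in>R. \<langle>f r, \<Lambda> r\<rangle>)"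
  unfolding type_pairing_def
proof (rule coset_sum_rcosets[OF R])
  fix j g assume "j \<in> J" "g \<in> carrier G"
  then show "\<langle>f (j \<otimes> g), \<Lambda> (j \<otimes> g)\<rangle> = \<langle>f g, \<Lambda> g\<rangle>"
    using \<Lambda> unfolding equivariant'_def by (simp add: type_moduleD[OF f] pairing_lam' lam_inv)
qed (auto simp: pairing_zero_left)

lemma type_pairing_linear:
  assumes \<Lambda>: "equivariant' \<Lambda>"
  shows "linear_on_space \<X> (\<lambda>f. type_pairing G J f \<Lambda>)"
proof -
  have "type_pairing G J (f + g) \<Lambda> = type_pairing G J f \<Lambda> + type_pairing G J g \<Lambda>"
    if fg: "f \<in> \<X>" "g \<in> \<X>" for f g
  proof -
    obtain C where C: "compactin T C" "{x. f x \<noteq> 0} \<subseteq> C"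
      using compact_support[OF type_moduleD(3)[OF fg(1)]] .
    obtain D where D: "compactin T D" "{x. g x \<noteq> 0} \<subseteq> D"
      using compact_support[OF type_moduleD(3)[OF fg(2)]] .
    obtain R where R: "right_transversal R (C \<union> D)"
      using compact_transversal[OF compactin_Un[OF C(1) D(1)]] .
    have "right_transversal R {x. f x \<noteq> 0}" "right_transversal R {x. g x \<noteq> 0}"
      "right_transversal R {x. (f + g) x \<noteq> 0}"
      by (rule right_transversal_subset[OF R]; use C(2) D(2) in force)+
    then show ?thesis
      using fg cspace.subspace_add[OF type_module_subspace fg]
      by (simp add: type_pairing_eq[OF _ \<Lambda>] pairing_add_left sum.distrib)
  qed
  moreover have "type_pairing G J (a *\<^sub>C f) \<Lambda> = a *\<^sub>C type_pairing G J f \<Lambda>"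
    if f: "f \<in> \<X>" for a f
  proof -
    obtain R where R: "right_transversal R {x. f x \<noteq> 0}" using type_module_transversal[OF f] .
    have "right_transversal R {x. (a *\<^sub>C f) x \<noteq> 0}"
      by (rule right_transversal_subset[OF R]) (auto simp: scaleC_fun_def)
    then show ?thesis
      using f R cspace.subspace_scale[OF type_module_subspace f]
      by (simp add: type_pairing_eq[OF _ \<Lambda>] scaleC_fun_def pairing_scale_left sum_distrib_left
          scaleC_complex_def)
  qed
  ultimately show ?thesis unfolding linear_on_space_def by blast
qed

lemma pairing_hecke_tilde:
  assumes "\<phi> \<in> hecke_space G J lam" "x \<in> carrier G"
  shows "\<langle>hecke_tilde G \<phi> x v, l\<rangle> = \<langle>v, \<phi> (inv x) l\<rangle>"
  unfolding hecke_tilde_def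
  by (rule pairing_cpretranspose[OF fd]) (simp add: hecke_spaceD[OF assms(1)] assms(2))

text \<open>The action on the module is adjoint to convolution: the pairing of \<open>\<phi> f\<close> with \<open>\<Psi>\<close> and that of \<open>f\<close>
  with the convolution of \<open>\<phi>\<close> and \<open>\<Psi>\<close> both unfold to the sum of \<open>\<langle>f z, \<phi> (z y\<inverse>) (\<Psi> y l)\<rangle>\<close> over \<open>z\<close>
  in a transversal \<open>Z\<close> of the support of \<open>f\<close> and \<open>y\<close> in a transversal \<open>Y\<close> of the cosets that \<open>\<phi>\<close> links
  to \<open>Z\<close>.\<close>

lemma type_pairing_hecke_act:
  assumes f: "f \<in> \<X>" and \<phi>: "\<phi> \<in> hecke_algebra G T J lam" and \<Psi>: "\<Psi> \<in> hecke_space G J lam"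
    and act: "hecke_act G J \<phi> f \<in> \<X>" and eig: "hecke_conv G J \<phi> \<Psi> = a *\<^sub>C \<Psi>"
  shows "type_pairing G J (hecke_act G J \<phi> f) (\<lambda>g. \<Psi> g l) = a * type_pairing G J f (\<lambda>g. \<Psi> g l)"
proof -
  have \<phi>h: "\<phi> \<in> hecke_space G J lam" and \<phi>c: "compactly_supported T \<phi>"
    using \<phi> unfolding hecke_algebra_def by auto
  note \<phi>D = hecke_spaceD[OF \<phi>h] and \<Psi>D = hecke_spaceD[OF \<Psi>]
  obtain Z where Z: "right_transversal Z {g. f g \<noteq> 0}" using type_module_transversal[OF f] .
  have Zc: "finite Z" "Z \<subseteq> carrier G" using Z unfolding right_transversal_def by auto
  obtain C where C: "compactin T C" "{x. \<phi> x \<noteq> 0} \<subseteq> C"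
    using compact_support[OF \<phi>c] .
  obtain L where L: "finite L" "L \<subseteq> carrier G" "C \<subseteq> (\<Union>r\<in>L. r <# J)"
    using left_cover[OF C(1)] by blast
  \<comment> \<open>If \<open>\<phi> (z y\<inverse>) \<noteq> 0\<close>, then \<open>z y\<inverse>\<close> lies in \<open>b J\<close> for some \<open>b\<close> in \<open>L\<close>, and \<open>y\<close> lies in \<open>J b\<inverse> z\<close>.\<close>
  define Y0 where "Y0 = (\<lambda>(l, z). inv l \<otimes> z) ` (L \<times> Z)"
  have Y0: "finite Y0" "Y0 \<subseteq> carrier G" using L Zc by (auto simp: Y0_def)
  obtain Y where Y: "right_transversal Y (\<Union>r\<in>Y0. J #> r)"
    using right_transversal_exists[OF Y0, of "\<Union>r\<in>Y0. J #> r"] by blast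
  have Yc: "Y \<subseteq> carrier G" using Y unfolding right_transversal_def by auto
  have linked: "y \<in> (\<Union>r\<in>Y0. J #> r)"
    if z: "z \<in> Z" and y: "y \<in> carrier G" and ne: "\<phi> (z \<otimes> inv y) \<noteq> 0" for z y
  proof -
    have zc: "z \<in> carrier G" using z Zc by auto
    obtain b j where b: "b \<in> L" "j \<in> J" "z \<otimes> inv y = b \<otimes> j"
      using C(2) ne L(3) by (fastforce simp: l_coset_def)
    then have bc: "b \<in> carrier G" "j \<in> carrier G" using L J_carrier by auto
    have "z = (b \<otimes> j) \<otimes> y" using b(3) bc zc y by (metis inv_closed inv_solve_right' inv_inv m_closed)
    then have "inv j \<otimes> (inv b \<otimes> z) = y" using bc y by (simp add: m_assoc[symmetric])
    then have "y \<in> J #> (inv b \<otimes> z)"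
      using b(2) rcosI[of "inv j" J "inv b \<otimes> z"] bc zc J.subset by simp
    moreover have "inv b \<otimes> z \<in> Y0" using b(1) z unfolding Y0_def by force
    ultimately show ?thesis by blast
  qed
  have conv: "hecke_conv G J \<phi> \<Psi> z l = (\<Sum>y\<in>Y. \<phi> (z \<otimes> inv y) (\<Psi> y l))" if z: "z \<in> Z" for z
  proof -
    have zc: "z \<in> carrier G" using z Zc by auto
    have "coset_sum (rcosets J) (\<lambda>x. \<phi> (z \<otimes> inv x) (\<Psi> x l)) = (\<Sum>y\<in>Y. \<phi> (z \<otimes> inv y) (\<Psi> y l))"
    proof (rule coset_sum_rcosets[OF Y])
      fix j g assume j: "j \<in> J" and g: "g \<in> carrier G"
      have "z \<otimes> inv (j \<otimes> g) = (z \<otimes> inv g) \<otimes> inv j"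
        using j g zc by (simp add: inv_mult_group m_assoc J_carrier)
      then show "\<phi> (z \<otimes> inv (j \<otimes> g)) (\<Psi> (j \<otimes> g) l) = \<phi> (z \<otimes> inv g) (\<Psi> g l)"
        using j g zc by (simp add: \<phi>D \<Psi>D lam'_inv)
    next
      fix g assume g: "g \<in> carrier G" and ne: "\<phi> (z \<otimes> inv g) (\<Psi> g l) \<noteq> 0"
      from ne have "\<phi> (z \<otimes> inv g) \<noteq> 0" by (auto simp: zero_fun_def)
      then show "g \<in> (\<Union>r\<in>Y0. J #> r)" by (rule linked[OF z g])
    qed
    then show ?thesis using zc unfolding hecke_conv_def by simp
  qed
  have acts: "hecke_act G J \<phi> f y = (\<Sum>z\<in>Z. hecke_tilde G \<phi> (y \<otimes> inv z) (f z))"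
    if y: "y \<in> carrier G" for y
  proof -
    have "coset_sum (lcosets J) (\<lambda>x. hecke_tilde G \<phi> x (f (inv x \<otimes> y)))
        = (\<Sum>z\<in>Z. hecke_tilde G \<phi> (y \<otimes> inv z) (f (inv (y \<otimes> inv z) \<otimes> y)))"
    proof (rule coset_sum_lcosets[OF Z y])
      fix j g assume j: "j \<in> J" and g: "g \<in> carrier G"
      have "f (inv (g \<otimes> j) \<otimes> y) = lam (inv j) (f (inv g \<otimes> y))"
        using j g y by (simp add: inv_mult_group m_assoc J_carrier type_moduleD[OF f])
      moreover have "\<phi> (inv (g \<otimes> j)) m = lam' (inv j) (\<phi> (inv g) m)" for m
        using j g by (simp add: inv_mult_group J_carrier \<phi>D)
      ultimately show "hecke_tilde G \<phi> (g \<otimes> j) (f (inv (g \<otimes> j) \<otimes> y)) = hecke_tilde G \<phi> g (f (inv g \<otimes> y))"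
        using j g by (intro pairing_separates[OF fd])
          (simp add: pairing_hecke_tilde[OF \<phi>h] pairing_lam' lam_inv J_carrier)
    next
      fix g assume g: "g \<in> carrier G" and ne: "hecke_tilde G \<phi> g (f (inv g \<otimes> y)) \<noteq> 0"
      have "hecke_tilde G \<phi> g 0 = 0"
        by (rule pairing_separates[OF fd]) (simp add: pairing_hecke_tilde[OF \<phi>h g] pairing_zero_left)
      then show "inv g \<otimes> y \<in> {g. f g \<noteq> 0}" using ne by auto
    qed
    moreover have "inv (y \<otimes> inv z) \<otimes> y = z" if "z \<in> Z" for z
    proof -
      have "z \<in> carrier G" using that Zc by auto
      then show ?thesis using y by (simp add: inv_mult_group m_assoc)
    qed
    ultimately show ?thesis using y unfolding hecke_act_def by simp
  qed
  have "right_transversal Y {y. hecke_act G J \<phi> f y \<noteq> 0}"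
    unfolding right_transversal_def
  proof (intro conjI)
    show "{y. hecke_act G J \<phi> f y \<noteq> 0} \<inter> carrier G \<subseteq> (\<Union>r\<in>Y. J #> r)"
    proof
      fix y assume "y \<in> {y. hecke_act G J \<phi> f y \<noteq> 0} \<inter> carrier G"
      then have y: "y \<in> carrier G" "hecke_act G J \<phi> f y \<noteq> 0" by auto
      then obtain z where z: "z \<in> Z" "hecke_tilde G \<phi> (y \<otimes> inv z) (f z) \<noteq> 0"
        using acts[OF y(1)] by (metis (no_types, lifting) sum.neutral)
      have zc: "z \<in> carrier G" using z Zc by auto
      have "\<phi> (z \<otimes> inv y) \<noteq> 0"
      proof
        assume 0: "\<phi> (z \<otimes> inv y) = 0"
        have "hecke_tilde G \<phi> (y \<otimes> inv z) (f z) = 0"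
          by (rule pairing_separates[OF fd])
             (simp add: pairing_hecke_tilde[OF \<phi>h] y zc inv_mult_group 0 pairing_zero_left pairing_zero_right)
        then show False using z(2) by simp
      qed
      then have "y \<in> (\<Union>r\<in>Y0. J #> r) \<inter> carrier G" using linked[OF z(1) y(1)] y(1) by blast
      then show "y \<in> (\<Union>r\<in>Y. J #> r)" using Y unfolding right_transversal_def by blast
    qed
  qed (use Y in \<open>auto simp: right_transversal_def\<close>)
  then have "type_pairing G J (hecke_act G J \<phi> f) (\<lambda>g. \<Psi> g l)
      = (\<Sum>y\<in>Y. \<langle>hecke_act G J \<phi> f y, \<Psi> y l\<rangle>)"
    by (rule type_pairing_eq[OF act hecke_space_equivariant'[OF \<Psi>]])
  also have "\<dots> = (\<Sum>y\<in>Y. \<Sum>z\<in>Z. \<langle>f z, \<phi> (z \<otimes> inv y) (\<Psi> y l)\<rangle>)"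
  proof (rule sum.cong[OF refl])
    fix y assume "y \<in> Y"
    then have y: "y \<in> carrier G" using Yc by auto
    show "\<langle>hecke_act G J \<phi> f y, \<Psi> y l\<rangle> = (\<Sum>z\<in>Z. \<langle>f z, \<phi> (z \<otimes> inv y) (\<Psi> y l)\<rangle>)"
      unfolding acts[OF y] pairing_sum_left
    proof (rule sum.cong[OF refl])
      fix z assume "z \<in> Z"
      then have "z \<in> carrier G" using Zc by auto
      then show "\<langle>hecke_tilde G \<phi> (y \<otimes> inv z) (f z), \<Psi> y l\<rangle> = \<langle>f z, \<phi> (z \<otimes> inv y) (\<Psi> y l)\<rangle>"
        using y by (simp add: pairing_hecke_tilde[OF \<phi>h] inv_mult_group)
    qed
  qed
  also have "\<dots> = (\<Sum>z\<in>Z. \<Sum>y\<in>Y. \<langle>f z, \<phi> (z \<otimes> inv y) (\<Psi> y l)\<rangle>)" by (rule sum.swap)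
  also have "\<dots> = (\<Sum>z\<in>Z. \<langle>f z, hecke_conv G J \<phi> \<Psi> z l\<rangle>)"
    by (rule sum.cong) (simp_all add: conv pairing_sum_right)
  also have "\<dots> = a * (\<Sum>z\<in>Z. \<langle>f z, \<Psi> z l\<rangle>)"
    by (simp add: eig scaleC_fun_def pairing_scale_right sum_distrib_left)
  also have "(\<Sum>z\<in>Z. \<langle>f z, \<Psi> z l\<rangle>) = type_pairing G J f (\<lambda>g. \<Psi> g l)"
    by (rule type_pairing_eq[OF f hecke_space_equivariant'[OF \<Psi>] Z, symmetric])
  finally show ?thesis .
qed

end

section \<open>Matrix coefficients on a quotient of the module\<close>

locale type_quotient = type_of_group G J T lam for G (structure) and J and T and
    lam :: "'a \<Rightarrow> 'w::complex_space \<Rightarrow> 'w" +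
  fixes \<pi> :: "'a \<Rightarrow> 'v::complex_space \<Rightarrow> 'v" and p :: "('a \<Rightarrow> 'w) \<Rightarrow> 'v"
    and chi :: "('a \<Rightarrow> 'w cdual \<Rightarrow> 'w cdual) \<Rightarrow> complex" and \<Psi> :: "'a \<Rightarrow> 'w cdual \<Rightarrow> 'w cdual"
  assumes pi_rep: "representation G UNIV \<pi>" and pi_nonzero: "(UNIV :: 'v set) \<noteq> {0}"
    and quot: "quotient_map_of_representations G \<X> (right_translation G)
           (eigen_relations G T J lam chi) UNIV \<pi> p"
    and Psi: "\<Psi> \<in> hecke_space G J lam"
    and Psi_eigen: "\<phi> \<in> hecke_algebra G T J lam \<Longrightarrow> hecke_conv G J \<phi> \<Psi> = chi \<phi> *\<^sub>C \<Psi>"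
begin

lemma p_add: "f \<in> \<X> \<Longrightarrow> g \<in> \<X> \<Longrightarrow> p (f + g) = p f + p g"
  and p_scale: "f \<in> \<X> \<Longrightarrow> p (a *\<^sub>C f) = a *\<^sub>C p f"
  and p_translation: "f \<in> \<X> \<Longrightarrow> x \<in> carrier G \<Longrightarrow> p (right_translation G x f) = \<pi> x (p f)"
  and p_surj: "p ` \<X> = UNIV"
  and p_kernel: "{f \<in> \<X>. p f = 0} = eigen_relations G T J lam chi"
  using quot unfolding quotient_map_of_representations_def intertwiner_def linear_on_space_def
  by auto

lemma p_preimage: obtains f where "f \<in> \<X>" "p f = v"
  using p_surj by (metis UNIV_I imageE)

lemma pi_linear: "g \<in> carrier G \<Longrightarrow> clinear (\<pi> g)"
  and pi_mult: "g \<in> carrier G \<Longrightarrow> h \<in> carrier G \<Longrightarrow> \<pi> (g \<otimes> h) v = \<pi> g (\<pi> h v)"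
  and pi_one: "\<pi> \<one> v = v"
  using pi_rep by (auto simp: representation_def linear_on_space_def clinear_iff)

lemma pairing_pi': "g \<in> carrier G \<Longrightarrow> \<langle>v, contragredient_action G \<pi> g l\<rangle> = \<langle>\<pi> (inv g) v, l\<rangle>"
  unfolding contragredient_action_def by (rule pairing_ctranspose) (simp add: pi_linear)

text \<open>The support of a function in the module is left \<open>J\<close>-invariant, because \<open>lam j\<close> is invertible, and lies in
  a compact set. As the quotient is nonzero, some function in the module is nonzero, and a
  translate of its support contains \<open>J\<close>. So \<open>J\<close> lies in a compact set.\<close>

lemma J_in_compact: obtains C where "compactin T C" "J \<subseteq> C"
proof -
  obtain v :: 'v where v: "v \<noteq> 0" using pi_nonzero by blast
  obtain f where f: "f \<in> \<X>" "p f = v" by (rule p_preimage)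
  have "p 0 = 0"
    using p_scale[OF f(1), of 0] by simp
  then have "f \<noteq> 0" using f v by blast
  then obtain x where x: "f x \<noteq> 0" by (auto simp: fun_eq_iff)
  then have xc: "x \<in> carrier G" using type_moduleD(1)[OF f(1)] by blast
  obtain C where C: "compactin T C" "{x. f x \<noteq> 0} \<subseteq> C"
    using compact_support[OF type_moduleD(3)[OF f(1)]] .
  have "j \<in> (\<lambda>g. g \<otimes> inv x) ` C" if j: "j \<in> J" for j
  proof (rule image_eqI)
    have "lam (inv j) (f (j \<otimes> x)) = f x" using j xc by (simp add: type_moduleD[OF f(1)] lam_inv)
    then have "f (j \<otimes> x) \<noteq> 0"
      using x j clinear_zero[OF lam_linear, of "inv j"] by auto
    then show "j \<otimes> x \<in> C" using C(2) by blast
    show "j = (j \<otimes> x) \<otimes> inv x" using j xc by (simp add: m_assoc J_carrier)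
  qed
  then show thesis using that compact_translate[OF C(1), of "inv x"] xc by blast
qed

lemma mult_in_J_iff: "j \<in> J \<Longrightarrow> g \<in> carrier G \<Longrightarrow> j \<otimes> g \<in> J \<longleftrightarrow> g \<in> J"
  "j \<in> J \<Longrightarrow> g \<in> carrier G \<Longrightarrow> g \<otimes> j \<in> J \<longleftrightarrow> g \<in> J"
proof -
  assume j: "j \<in> J" and g: "g \<in> carrier G"
  have "inv j \<otimes> (j \<otimes> g) = g" "(g \<otimes> j) \<otimes> inv j = g"
    using j g by (simp_all add: m_assoc[symmetric] J_carrier) (simp add: m_assoc J_carrier)
  then show "j \<otimes> g \<in> J \<longleftrightarrow> g \<in> J" "g \<otimes> j \<in> J \<longleftrightarrow> g \<in> J"
    using j J.m_closed J.m_inv_closed by metis+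
qed

lemma type_vector_in_module: "type_vector J lam w \<in> \<X>"
proof -
  obtain C where "compactin T C" "J \<subseteq> C" by (rule J_in_compact)
  then have "compactly_supported T (type_vector J lam w)"
    unfolding compactly_supported_def type_vector_def by auto
  moreover have "type_vector J lam w (j \<otimes> g) = lam j (type_vector J lam w g)"
    if "j \<in> J" "g \<in> carrier G" for j g
    using that by (simp add: type_vector_def mult_in_J_iff lam_mult clinear_zero[OF lam_linear])
  moreover have "type_vector J lam w g = 0" if "g \<notin> carrier G" for g
    using that J_carrier unfolding type_vector_def by auto
  ultimately show ?thesis unfolding type_module_def equivariant_functions_def by blast
qed

lemma type_vector_translation:
  assumes j: "j \<in> J"
  shows "right_translation G j (type_vector J lam w) = type_vector J lam (lam j w)"
proof
  fix x
  show "right_translation G j (type_vector J lam w) x = type_vector J lam (lam j w) x"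
    using j J_carrier[of x]
    by (auto simp: right_translation_def type_vector_def mult_in_J_iff lam_mult)
qed

lemma type_pairing_eigen_relations:
  assumes "f \<in> eigen_relations G T J lam chi"
  shows "type_pairing G J f (\<lambda>g. \<Psi> g l) = 0"
proof -
  let ?P = "\<lambda>f. type_pairing G J f (\<lambda>g. \<Psi> g l)"
  have lin: "\<And>f g. f \<in> \<X> \<Longrightarrow> g \<in> \<X> \<Longrightarrow> ?P (f + g) = ?P f + ?P g"
    "\<And>a f. f \<in> \<X> \<Longrightarrow> ?P (a *\<^sub>C f) = a * ?P f"
    using type_pairing_linear[OF hecke_space_equivariant'[OF Psi]]
    unfolding linear_on_space_def scaleC_complex_def by auto
  have zero: "?P 0 = 0"
    using lin(2)[OF cspace.subspace_0[OF type_module_subspace], of 0] by simp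
  have "f \<in> \<X> \<and> ?P f = 0"
    using assms unfolding eigen_relations_def
  proof (induction rule: cspace.span_induct_alt)
    case base
    show ?case by (intro conjI zero cspace.subspace_0[OF type_module_subspace])
  next
    case (step c h k)
    then obtain \<phi> f where \<phi>f: "\<phi> \<in> hecke_algebra G T J lam" "f \<in> \<X>"
      and h: "h = hecke_act G J \<phi> f - chi \<phi> *\<^sub>C f" by blast
    have "h \<in> eigen_relations G T J lam chi"
      unfolding eigen_relations_def by (rule cspace.span_base) (use step(1) in blast)
    then have hX: "h \<in> \<X>" using p_kernel by blast
    note fX = cspace.subspace_scale[OF type_module_subspace \<phi>f(2)]
    have act: "hecke_act G J \<phi> f = h + chi \<phi> *\<^sub>C f" by (simp add: h)
    then have actX: "hecke_act G J \<phi> f \<in> \<X>"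
      using cspace.subspace_add[OF type_module_subspace hX fX] by simp
    have "?P (hecke_act G J \<phi> f) = chi \<phi> * ?P f"
      by (rule type_pairing_hecke_act[OF \<phi>f(2,1) Psi actX Psi_eigen[OF \<phi>f(1)]])
    then have "?P h = 0" unfolding act using lin(1)[OF hX fX] lin(2)[OF \<phi>f(2)] by simp
    note chX = cspace.subspace_scale[OF type_module_subspace hX, of c]
    have "?P (c *\<^sub>C h + k) = c * ?P h + ?P k"
      using step(2) by (simp only: lin(1)[OF chX] lin(2)[OF hX])
    then have "?P (c *\<^sub>C h + k) = 0" using step(2) \<open>?P h = 0\<close> by simp
    moreover have "c *\<^sub>C h + k \<in> \<X>"
      using cspace.subspace_add[OF type_module_subspace chX] step(2) by blast
    ultimately show ?case by blast
  qed
  then show ?thesis ..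
qed

text \<open>The second of the two embeddings; the first is \<open>w \<mapsto> p (type_vector J lam w)\<close>.\<close>

definition dual_form :: "'w cdual \<Rightarrow> 'v cdual" where
  "dual_form l = dual_vector G T J lam p (\<lambda>g. \<Psi> g l)"

text \<open>The pairing vanishes on the kernel of \<open>p\<close>, so a form on the quotient is obtained by evaluating it
  at any preimage.\<close>

lemma pairing_dual_form:
  assumes f: "f \<in> \<X>"
  shows "\<langle>p f, dual_form l\<rangle> = type_pairing G J f (\<lambda>g. \<Psi> g l)"
proof -
  let ?P = "\<lambda>f. type_pairing G J f (\<lambda>g. \<Psi> g l)"
  have lin: "\<And>f g. f \<in> \<X> \<Longrightarrow> g \<in> \<X> \<Longrightarrow> ?P (f + g) = ?P f + ?P g"
    "\<And>a f. f \<in> \<X> \<Longrightarrow> ?P (a *\<^sub>C f) = a * ?P f"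
    using type_pairing_linear[OF hecke_space_equivariant'[OF Psi]]
    unfolding linear_on_space_def scaleC_complex_def by auto
  have wd: "?P f = ?P g" if fg: "f \<in> \<X>" "g \<in> \<X>" "p f = p g" for f g
  proof -
    note gX = cspace.subspace_scale[OF type_module_subspace fg(2), of "-1"]
    have "f + (-1) *\<^sub>C g \<in> \<X>" by (rule cspace.subspace_add[OF type_module_subspace fg(1) gX])
    moreover have "p (f + (-1) *\<^sub>C g) = p f + (-1) *\<^sub>C p g"
      by (simp only: p_add[OF fg(1) gX] p_scale[OF fg(2)])
    then have "p (f + (-1) *\<^sub>C g) = 0"
      using fg(3) cspace.scale_minus_left[of 1 "p g"] by (simp only: scaleC_one) simp
    ultimately have "?P (f + (-1) *\<^sub>C g) = 0"
      using p_kernel type_pairing_eigen_relations by blast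
    then show ?thesis using lin(1)[OF fg(1) gX] lin(2)[OF fg(2), of "-1"] by simp
  qed
  define s where "s v = (SOME f. f \<in> \<X> \<and> p f = v)" for v
  have s: "s v \<in> \<X>" "p (s v) = v" for v
    using someI_ex[of "\<lambda>f. f \<in> \<X> \<and> p f = v"] p_preimage[of v] unfolding s_def by blast+
  define F where "F v = ?P (s v)" for v
  have Fp: "F (p f) = ?P f" if "f \<in> \<X>" for f
    unfolding F_def by (rule wd) (use s that in auto)
  have "F (v + w) = F v + F w" for v w
    using Fp[OF cspace.subspace_add[OF type_module_subspace s(1) s(1)], of v w]
    by (simp add: p_add s lin F_def)
  moreover have "F (a *\<^sub>C v) = a *\<^sub>C F v" for a v
    using Fp[OF cspace.subspace_scale[OF type_module_subspace s(1)], of a v]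
    by (simp add: p_scale s lin F_def scaleC_complex_def)
  ultimately have "clinear F" by (simp add: clinear_iff)
  then have ex: "\<forall>f\<in>\<X>. \<langle>p f, Abs_cdual F\<rangle> = ?P f" by (simp add: pairing_Abs_cdual Fp)
  have "\<forall>f\<in>\<X>. \<langle>p f, dual_form l\<rangle> = ?P f"
    unfolding dual_form_def dual_vector_def
  proof (rule theI[where P = "\<lambda>l. \<forall>f\<in>\<X>. \<langle>p f, l\<rangle> = ?P f", OF ex])
    fix m assume m: "\<forall>f\<in>\<X>. \<langle>p f, m\<rangle> = ?P f"
    show "m = Abs_cdual F"
    proof (rule cdual_eqI)
      fix v
      obtain f where "f \<in> \<X>" "p f = v" by (rule p_preimage)
      then show "\<langle>v, m\<rangle> = \<langle>v, Abs_cdual F\<rangle>" using m ex by metis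
    qed
  qed
  then show ?thesis using f by blast
qed

text \<open>Only the coset \<open>J g\<inverse>\<close> meets the support of the translate of \<open>type_vector J lam w\<close> by \<open>g\<close>.\<close>

theorem matrix_coefficient_formula:
  assumes g: "g \<in> carrier G"
  shows "\<langle>\<pi> g (p (type_vector J lam w)), dual_form l\<rangle> = \<langle>w, \<Psi> (inv g) l\<rangle>"
proof -
  let ?f = "right_translation G g (type_vector J lam w)"
  note fX = right_translation_type_module[OF type_vector_in_module g]
  have "right_transversal {inv g} {x. ?f x \<noteq> 0}"
    unfolding right_transversal_def
  proof (intro conjI subsetI)
    fix x assume "x \<in> {x. ?f x \<noteq> 0} \<inter> carrier G"
    then have x: "x \<in> carrier G" "x \<otimes> g \<in> J"
      by (auto simp: right_translation_def type_vector_def split: if_splits)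
    then have "x = (x \<otimes> g) \<otimes> inv g" using g by (simp add: m_assoc)
    then have "x \<in> J #> inv g" using x(2) unfolding r_coset_def by blast
    then show "x \<in> (\<Union>r\<in>{inv g}. J #> r)" by simp
  qed (use g in auto)
  then have "type_pairing G J ?f (\<lambda>g. \<Psi> g l) = \<langle>?f (inv g), \<Psi> (inv g) l\<rangle>"
    by (simp add: type_pairing_eq[OF fX hecke_space_equivariant'[OF Psi]])
  also have "?f (inv g) = w" using g by (simp add: right_translation_def type_vector_def lam_one)
  finally show ?thesis
    using pairing_dual_form[OF fX] p_translation[OF type_vector_in_module g] by simp
qed

lemma Psi_eq_0_if_coefficients_vanish:
  assumes "\<And>g w l. g \<in> carrier G \<Longrightarrow> \<langle>\<pi> g (p (type_vector J lam w)), dual_form l\<rangle> = 0"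
  shows "\<Psi> = 0"
proof -
  have "\<Psi> g l = 0" for g l
  proof (cases "g \<in> carrier G")
    case True
    have "\<langle>w, \<Psi> g l\<rangle> = 0" for w
      using matrix_coefficient_formula[of "inv g" w l] assms[of "inv g" w l] True by simp
    then show ?thesis by (intro cdual_eqI) (simp add: pairing_zero_right)
  qed (simp add: hecke_spaceD(1)[OF Psi])
  then show ?thesis by (simp add: fun_eq_iff)
qed

lemma embed_linear: "clinear (\<lambda>w. p (type_vector J lam w))"
proof -
  have "type_vector J lam (v + w) = type_vector J lam v + type_vector J lam w" for v w
    by (auto simp: type_vector_def clinear_add[OF lam_linear])
  moreover have "type_vector J lam (a *\<^sub>C w) = a *\<^sub>C type_vector J lam w" for a w
    by (auto simp: type_vector_def scaleC_fun_def clinear_scale[OF lam_linear])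
  ultimately show ?thesis
    by (simp add: clinear_iff p_add p_scale type_vector_in_module)
qed

lemma embed_equivariant:
  "j \<in> J \<Longrightarrow> p (type_vector J lam (lam j w)) = \<pi> j (p (type_vector J lam w))"
  using p_translation[OF type_vector_in_module, of j w] J_carrier
  by (simp add: type_vector_translation)

lemma dual_form_linear: "clinear dual_form"
proof -
  note eq = type_pairing_eq[OF _ hecke_space_equivariant'[OF Psi]]
  have "\<langle>v, dual_form (l + m)\<rangle> = \<langle>v, dual_form l + dual_form m\<rangle>"
    "\<langle>v, dual_form (a *\<^sub>C l)\<rangle> = \<langle>v, a *\<^sub>C dual_form l\<rangle>" for v l m a
  proof -
    obtain f where f: "f \<in> \<X>" "p f = v" by (rule p_preimage)
    obtain R where R: "right_transversal R {g. f g \<noteq> 0}" using type_module_transversal[OF f(1)] .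
    have P: "\<langle>v, dual_form k\<rangle> = (\<Sum>r\<in>R. \<langle>f r, \<Psi> r k\<rangle>)" for k
      using pairing_dual_form[OF f(1)] eq[OF f(1) R] f(2) by simp
    have lin: "clinear (\<Psi> r)" if "r \<in> R" for r
      using that R hecke_spaceD(2)[OF Psi] unfolding right_transversal_def by blast
    show "\<langle>v, dual_form (l + m)\<rangle> = \<langle>v, dual_form l + dual_form m\<rangle>"
      by (simp add: P pairing_add_right clinear_add[OF lin] sum.distrib)
    show "\<langle>v, dual_form (a *\<^sub>C l)\<rangle> = \<langle>v, a *\<^sub>C dual_form l\<rangle>"
      by (simp add: P pairing_scale_right clinear_scale[OF lin] sum_distrib_left)
  qed
  then show ?thesis by (auto simp: clinear_iff intro: cdual_eqI)
qed

lemma dual_form_equivariant: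
  assumes j: "j \<in> J"
  shows "dual_form (lam' j l) = contragredient_action G \<pi> j (dual_form l)"
proof (rule cdual_eqI)
  fix v
  obtain f where f: "f \<in> \<X>" "p f = v" by (rule p_preimage)
  obtain R where R: "right_transversal R {g. f g \<noteq> 0}" using type_module_transversal[OF f(1)] .
  note eq = type_pairing_eq[OF _ hecke_space_equivariant'[OF Psi]]
  note jc = J_carrier[OF j]
  let ?f = "right_translation G (inv j) f"
  note fX = right_translation_type_module[OF f(1) inv_closed[OF jc]]
  have "right_transversal ((\<lambda>r. r \<otimes> j) ` R) {g. ?f g \<noteq> 0}"
    by (rule right_transversal_subset[OF right_transversal_translate(2)[OF R jc]])
       (auto simp: right_translation_def)
  then have "type_pairing G J ?f (\<lambda>g. \<Psi> g l) = (\<Sum>r\<in>(\<lambda>r. r \<otimes> j) ` R. \<langle>?f r, \<Psi> r l\<rangle>)"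
    by (rule eq[OF fX])
  also have "\<dots> = (\<Sum>r\<in>R. \<langle>?f (r \<otimes> j), \<Psi> (r \<otimes> j) l\<rangle>)"
    by (simp add: sum.reindex[OF right_transversal_translate(1)[OF R jc]])
  also have "\<dots> = (\<Sum>r\<in>R. \<langle>f r, \<Psi> r (lam' j l)\<rangle>)"
  proof (rule sum.cong[OF refl])
    fix r assume "r \<in> R"
    then have "r \<in> carrier G" using R unfolding right_transversal_def by blast
    then show "\<langle>?f (r \<otimes> j), \<Psi> (r \<otimes> j) l\<rangle> = \<langle>f r, \<Psi> r (lam' j l)\<rangle>"
      using jc j by (simp add: right_translation_def m_assoc hecke_spaceD[OF Psi])
  qed
  also have "\<dots> = \<langle>v, dual_form (lam' j l)\<rangle>"
    using eq[OF f(1) R] pairing_dual_form[OF f(1)] f(2) by simp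
  finally show "\<langle>v, dual_form (lam' j l)\<rangle> = \<langle>v, contragredient_action G \<pi> j (dual_form l)\<rangle>"
    using pairing_dual_form[OF fX] p_translation[OF f(1) inv_closed[OF jc]] f(2) jc
    by (simp add: pairing_pi')
qed

lemma stabilizer_subgroup:
  "subgroup {g \<in> carrier G. contragredient_action G \<pi> g l = l} G" (is "subgroup ?S G")
proof -
  have mult: "contragredient_action G \<pi> (g \<otimes> h) l = contragredient_action G \<pi> g (contragredient_action G \<pi> h l)"
    if "g \<in> carrier G" "h \<in> carrier G" for g h l
    using that by (intro cdual_eqI) (simp add: pairing_pi' inv_mult_group pi_mult)
  have one: "contragredient_action G \<pi> \<one> l = l" for l
    by (rule cdual_eqI) (simp add: pairing_pi' pi_one)
  show ?thesis
  proof (rule subgroupI)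
    show "?S \<noteq> {}" using one by auto
    fix g assume g: "g \<in> ?S"
    then have "contragredient_action G \<pi> (inv g) (contragredient_action G \<pi> g l) = l"
      using mult[of "inv g" g l] one by simp
    then show "inv g \<in> ?S" using g by simp
    fix h assume "h \<in> ?S"
    then show "g \<otimes> h \<in> ?S" using g mult by simp
  qed auto
qed

text \<open>By equivariance the stabilizer of the form contains the kernel of \<open>lam\<close>.\<close>

lemma dual_form_smooth: "dual_form l \<in> smooth_dual G T \<pi>"
proof -
  have "{j \<in> J. \<forall>w. lam j w = w} \<subseteq> {g \<in> carrier G. contragredient_action G \<pi> g (dual_form l) = dual_form l}"
  proof
    fix j assume "j \<in> {j \<in> J. \<forall>w. lam j w = w}"
    then have j: "j \<in> J" "\<And>w. lam j w = w" by auto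
    have "lam (inv j) w = w" for w using lam_inv(1)[OF j(1), of w] j(2) by simp
    then have "lam' j l = l" using j(1) by (intro cdual_eqI) (simp add: pairing_lam')
    then show "j \<in> {g \<in> carrier G. contragredient_action G \<pi> g (dual_form l) = dual_form l}"
      using dual_form_equivariant[OF j(1), of l] J_carrier[OF j(1)] by simp
  qed
  then show ?thesis
    unfolding smooth_dual_def smooth_vector_def
    using kernel_open[OF stabilizer_subgroup] by simp
qed

text \<open>The kernel is a \<open>J\<close>-stable subspace of the irreducible space \<open>W\<close>; were it everything, the matrix
  coefficients, hence \<open>\<Psi>\<close>, would vanish.\<close>

lemma embed_inj:
  assumes "\<Psi> \<noteq> 0"
  shows "inj (\<lambda>w. p (type_vector J lam w))"
proof (rule clinear_injI[OF embed_linear])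
  let ?K = "{w. p (type_vector J lam w) = 0}"
  have sub: "cspace.subspace ?K"
    by (simp add: cspace.subspace_def clinear_zero[OF embed_linear] clinear_add[OF embed_linear]
        clinear_scale[OF embed_linear])
  have "lam j ` ?K \<subseteq> ?K" if "j \<in> J" for j
    using that clinear_zero[OF pi_linear[OF J_carrier[OF that]]] by (auto simp: embed_equivariant)
  then have "?K = {0} \<or> ?K = UNIV" by (rule lam_irreducible[OF sub])
  moreover have "?K \<noteq> UNIV"
  proof
    assume "?K = UNIV"
    then have "p (type_vector J lam w) = 0" for w by blast
    then have "\<Psi> = 0"
      by (intro Psi_eq_0_if_coefficients_vanish) (simp add: clinear_zero[OF pi_linear] pairing_zero_left)
    then show False using assms by contradiction
  qed
  ultimately show "w = 0" if "p (type_vector J lam w) = 0" for w using that by blast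
qed

text \<open>Here irreducibility is applied to the annihilator in \<open>W\<close> of the kernel: if that is \<open>W\<close>, the
  kernel is zero; if it is zero, the kernel is the whole dual of \<open>W\<close> and \<open>\<Psi>\<close> vanishes.\<close>

lemma dual_form_inj:
  assumes "\<Psi> \<noteq> 0"
  shows "inj dual_form"
proof (rule clinear_injI[OF dual_form_linear])
  let ?K = "{l. dual_form l = 0}"
  have sub: "cspace.subspace ?K"
    by (simp add: cspace.subspace_def clinear_zero[OF dual_form_linear]
        clinear_add[OF dual_form_linear] clinear_scale[OF dual_form_linear])
  have stab: "lam' j l \<in> ?K" if "j \<in> J" "l \<in> ?K" for j l
    using that by (auto intro!: cdual_eqI
        simp: dual_form_equivariant pairing_pi' J_carrier pairing_zero_right)
  let ?A = "{w. \<forall>l\<in>?K. \<langle>w, l\<rangle> = 0}"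
  have subA: "cspace.subspace ?A"
    by (simp add: cspace.subspace_def pairing_zero_left pairing_add_left pairing_scale_left)
  have "lam j ` ?A \<subseteq> ?A" if j: "j \<in> J" for j
  proof (intro image_subsetI CollectI ballI)
    fix w l assume w: "w \<in> ?A" and l: "l \<in> ?K"
    have "lam' (inv j) l \<in> ?K" using stab[of "inv j" l] j l by simp
    then have "\<langle>w, lam' (inv j) l\<rangle> = 0" using w by blast
    then show "\<langle>lam j w, l\<rangle> = 0" using j by (simp add: pairing_lam' J_carrier)
  qed
  then have "?A = {0} \<or> ?A = UNIV" by (rule lam_irreducible[OF subA])
  moreover have "?A \<noteq> {0}"
  proof
    assume A: "?A = {0}"
    have "?K = UNIV" by (rule dual_subspace_eq_UNIV[OF fd sub]) (use A in blast)
    then have "dual_form l = 0" for l by blast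
    then have "\<Psi> = 0" by (intro Psi_eq_0_if_coefficients_vanish) (simp add: pairing_zero_right)
    then show False using assms by contradiction
  qed
  ultimately have A: "?A = UNIV" by blast
  show "l = 0" if "dual_form l = 0" for l
  proof (rule cdual_eqI)
    fix w
    have "w \<in> ?A" using A by blast
    then show "\<langle>w, l\<rangle> = \<langle>w, 0\<rangle>" using that by (simp add: pairing_zero_right)
  qed
qed

end

section \<open>Tensor powers\<close>

lemma multilinear_cong: "multilinear e m \<Longrightarrow> (\<And>i. i < e \<Longrightarrow> x i = y i) \<Longrightarrow> m x = m y"
  unfolding multilinear_def by blast

lemma multilinear_slot: "multilinear e m \<Longrightarrow> i < e \<Longrightarrow> clinear (\<lambda>v. m (x(i := v)))"
  unfolding multilinear_def by blast

lemma multilinear_compose: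
  fixes m :: "(nat \<Rightarrow> 'b::complex_space) \<Rightarrow> 'c::complex_space"
    and A :: "nat \<Rightarrow> 'a::complex_space \<Rightarrow> 'b"
  assumes m: "multilinear e m" and A: "\<forall>i<e. clinear (A i)"
  shows "multilinear e (\<lambda>x. m (\<lambda>i. A i (x i)))"
  unfolding multilinear_def
proof (intro conjI allI impI)
  fix x y :: "nat \<Rightarrow> 'a" assume "\<forall>i<e. x i = y i"
  then show "m (\<lambda>i. A i (x i)) = m (\<lambda>i. A i (y i))" by (intro multilinear_cong[OF m]) simp
next
  fix k x assume k: "k < e"
  have eq: "(\<lambda>i. A i ((x(k := v)) i)) = (\<lambda>i. A i (x i))(k := A k v)" for v by auto
  show "clinear (\<lambda>v. m (\<lambda>i. A i ((x(k := v)) i)))"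
    unfolding eq by (rule clinear_compose[OF multilinear_slot[OF m k] A[rule_format, OF k]])
qed

lemma multilinear_linear_compose:
  fixes m :: "(nat \<Rightarrow> 'a::complex_space) \<Rightarrow> 'b::complex_space"
  assumes "multilinear e m" "clinear l"
  shows "multilinear e (\<lambda>x. l (m x))"
  unfolding multilinear_def
proof (intro conjI allI impI)
  fix x y :: "nat \<Rightarrow> 'a" assume "\<forall>i<e. x i = y i"
  then have "m x = m y" by (intro multilinear_cong[OF assms(1)]) simp
  then show "l (m x) = l (m y)" by simp
next
  fix k x assume "k < e"
  then show "clinear (\<lambda>v. l (m (x(k := v))))"
    by (intro clinear_compose[OF assms(2)] multilinear_slot[OF assms(1)])
qed

lemma multilinear_scale:
  assumes m: "multilinear e m"
  shows "m (\<lambda>i. c i *\<^sub>C x i) = (\<Prod>i<e. c i) *\<^sub>C m x"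
proof -
  have "k \<le> e \<Longrightarrow> m (\<lambda>i. if i < k then c i *\<^sub>C x i else x i) = (\<Prod>i<k. c i) *\<^sub>C m x" for k
  proof (induction k)
    case 0 show ?case by (simp add: scaleC_one)
  next
    case (Suc k)
    then have k: "k < e" by simp
    let ?y = "\<lambda>i. if i < k then c i *\<^sub>C x i else x i"
    have "(\<lambda>i. if i < Suc k then c i *\<^sub>C x i else x i) = ?y(k := c k *\<^sub>C x k)"
      by (simp add: fun_eq_iff less_Suc_eq)
    then have "m (\<lambda>i. if i < Suc k then c i *\<^sub>C x i else x i) = m (?y(k := c k *\<^sub>C x k))"
      by (rule arg_cong)
    also have "\<dots> = c k *\<^sub>C m (?y(k := x k))" by (rule clinear_scale[OF multilinear_slot[OF m k]])
    also have "?y(k := x k) = ?y" by auto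
    also have "m ?y = (\<Prod>i<k. c i) *\<^sub>C m x" using Suc by simp
    finally show ?case by (simp add: scaleC_scaleC mult.commute)
  qed
  from this[of e] have "(\<Prod>i<e. c i) *\<^sub>C m x = m (\<lambda>i. if i < e then c i *\<^sub>C x i else x i)" by simp
  also have "\<dots> = m (\<lambda>i. c i *\<^sub>C x i)" by (rule multilinear_cong[OF m]) simp
  finally show ?thesis by simp
qed

lemma multilinear_prod_forms:
  assumes "\<And>i. clinear (l i :: 'a::complex_space \<Rightarrow> complex)"
  shows "multilinear e (\<lambda>z. \<Prod>i<e. l i (z i))"
  unfolding multilinear_def
proof (intro conjI allI impI)
  fix x y :: "nat \<Rightarrow> 'a" assume "\<forall>i<e. x i = y i"
  then show "(\<Prod>i<e. l i (x i)) = (\<Prod>i<e. l i (y i))" by (intro prod.cong) auto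
next
  fix k and x :: "nat \<Rightarrow> 'a" assume k: "k < e"
  have "(\<Prod>i<e. l i ((x(k := v)) i)) = (\<Prod>i\<in>{..<e} - {k}. l i (x i)) *\<^sub>C l k v" for v
  proof -
    have "(\<Prod>i<e. l i ((x(k := v)) i)) = l k v * (\<Prod>i\<in>{..<e} - {k}. l i ((x(k := v)) i))"
      using k by (subst prod.remove[of _ k]) auto
    also have "(\<Prod>i\<in>{..<e} - {k}. l i ((x(k := v)) i)) = (\<Prod>i\<in>{..<e} - {k}. l i (x i))"
      by (rule prod.cong) auto
    finally show ?thesis by (simp add: scaleC_complex_def mult.commute)
  qed
  then have eq: "(\<lambda>v. \<Prod>i<e. l i ((x(k := v)) i)) = (\<lambda>v. (\<Prod>i\<in>{..<e} - {k}. l i (x i)) *\<^sub>C l k v)"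
    by (rule ext)
  show "clinear (\<lambda>v. \<Prod>i<e. l i ((x(k := v)) i))"
    unfolding eq by (rule clinear_scalar_scale[OF assms])
qed

lemma tensor_powerD:
  assumes "tensor_power e T"
  shows "multilinear e T" "cspace.span (range T) = UNIV"
    "multilinear e m \<Longrightarrow> \<exists>l. clinear l \<and> (\<forall>x. m x = (l (T x) :: complex))"
  using assms unfolding tensor_power_def by auto

lemma tensor_eqI:
  assumes "tensor_power e T" "clinear L" "clinear M" "\<And>x. L (T x) = M (T x)"
  shows "L = M"
  by (rule clinear_eq_on_span[OF assms(2,3) tensor_powerD(2)[OF assms(1)]]) (use assms(4) in auto)

text \<open>Expanding each argument in a basis of the factor shows that the tensors of basis vectors
  span.\<close>

lemma tensor_power_finite_dimensional:
  fixes T :: "(nat \<Rightarrow> 'a::complex_space) \<Rightarrow> 'b::complex_space"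
  assumes T: "tensor_power e T" and fd: "finite_dimensional TYPE('a)"
  shows "finite_dimensional TYPE('b)"
proof -
  note m = tensor_powerD(1)[OF T]
  obtain B :: "'a set" and co where "dual_bases B co" using dual_bases_exist[OF fd] .
  note B = dual_basesD[OF this]
  let ?S = "{x. \<forall>i. (i \<in> {..<e} \<longrightarrow> x i \<in> B) \<and> (i \<notin> {..<e} \<longrightarrow> x i = 0)}"
  let ?F = "T ` ?S"
  have fin: "finite ?F" using finite_set_of_finite_funs[of "{..<e}" B 0] B(1) by simp
  have "k \<le> e \<Longrightarrow> (\<And>i. k \<le> i \<Longrightarrow> i < e \<Longrightarrow> x i \<in> B) \<Longrightarrow> T x \<in> cspace.span ?F" for k x
  proof (induction k arbitrary: x)
    case 0
    let ?y = "\<lambda>i. if i < e then x i else 0"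
    have "T x = T ?y" by (rule multilinear_cong[OF m]) simp
    moreover have "?y \<in> ?S" using 0 by simp
    ultimately show ?case by (metis (no_types, lifting) cspace.span_base imageI)
  next
    case (Suc k)
    then have k: "k < e" by simp
    have "T x = T (x(k := \<Sum>b\<in>B. co b (x k) *\<^sub>C b))" by (simp add: B(3))
    also have "\<dots> = (\<Sum>b\<in>B. co b (x k) *\<^sub>C T (x(k := b)))"
      by (simp only: clinear_sum[OF multilinear_slot[OF m k]] clinear_scale[OF multilinear_slot[OF m k]])
    also have "\<dots> \<in> cspace.span ?F"
    proof (intro cspace.span_sum cspace.span_scale)
      fix b assume "b \<in> B"
      then show "T (x(k := b)) \<in> cspace.span ?F" using Suc k by (intro Suc.IH) auto
    qed
    finally show ?case .
  qed
  from this[of e] have "range T \<subseteq> cspace.span ?F" by auto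
  then have "cspace.span (range T) \<subseteq> cspace.span ?F"
    by (rule cspace.span_minimal) (rule cspace.subspace_span)
  then show ?thesis
    using fin tensor_powerD(2)[OF T] unfolding finite_dimensional_def by blast
qed

lemma tensor_map_pure:
  fixes T :: "(nat \<Rightarrow> 'a::complex_space) \<Rightarrow> 'b::complex_space"
  assumes T: "tensor_power e T" and fd: "finite_dimensional TYPE('b)"
    and A: "\<forall>i<e. clinear (A i)"
  shows "clinear (tensor_map T A)" "tensor_map T A (T x) = T (\<lambda>i. A i (x i))"
proof -
  obtain B :: "'b set" and co where "dual_bases B co" using dual_bases_exist[OF fd] .
  note B = dual_basesD[OF this]
  have "\<exists>l. clinear l \<and> (\<forall>x. co b (T (\<lambda>i. A i (x i))) = (l (T x) :: complex))" for b
    by (rule tensor_powerD(3)[OF T])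
       (rule multilinear_linear_compose[OF multilinear_compose[OF tensor_powerD(1)[OF T] A] B(2)])
  then have "\<exists>l. \<forall>b. clinear (l b) \<and> (\<forall>x. co b (T (\<lambda>i. A i (x i))) = (l b (T x) :: complex))"
    by (intro choice allI)
  then obtain l where l: "\<And>b. clinear (l b)" "\<And>b x. co b (T (\<lambda>i. A i (x i))) = l b (T x)"
    by blast
  define L where "L w = (\<Sum>b\<in>B. l b w *\<^sub>C b)" for w
  have "clinear L"
    unfolding clinear_iff L_def
    by (simp add: clinear_add[OF l(1)] clinear_scale[OF l(1)] scaleC_add_left sum.distrib
        cspace.scale_sum_right scaleC_scaleC scaleC_complex_def)
  moreover have "L (T x) = T (\<lambda>i. A i (x i))" for x
    using B(3) by (simp add: L_def l(2)[symmetric])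
  ultimately have ex: "clinear L \<and> (\<forall>x. L (T x) = T (\<lambda>i. A i (x i)))" by blast
  have "clinear (tensor_map T A) \<and> (\<forall>x. tensor_map T A (T x) = T (\<lambda>i. A i (x i)))"
    unfolding tensor_map_def
  proof (rule theI[where P = "\<lambda>L. clinear L \<and> (\<forall>x. L (T x) = T (\<lambda>i. A i (x i)))", OF ex])
    fix M assume "clinear M \<and> (\<forall>x. M (T x) = T (\<lambda>i. A i (x i)))"
    then show "M = L" using ex by (intro tensor_eqI[OF T]) simp_all
  qed
  then show "clinear (tensor_map T A)" "tensor_map T A (T x) = T (\<lambda>i. A i (x i))" by auto
qed

lemma tensor_map_compose:
  fixes T :: "(nat \<Rightarrow> 'a::complex_space) \<Rightarrow> 'b::complex_space"
  assumes T: "tensor_power e T" and fd: "finite_dimensional TYPE('b)"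
    and A: "\<forall>i<e. clinear (A i)" and B: "\<forall>i<e. clinear (B i)"
    and C: "\<And>i v. i < e \<Longrightarrow> C i v = A i (B i v)"
  shows "tensor_map T C w = tensor_map T A (tensor_map T B w)"
proof -
  have Cl: "\<forall>i<e. clinear (C i)"
  proof (intro allI impI)
    fix i assume i: "i < e"
    have "C i = (\<lambda>v. A i (B i v))" by (rule ext) (rule C[OF i])
    then show "clinear (C i)" using clinear_compose[of "A i" "B i"] A B i by simp
  qed
  note pA = tensor_map_pure[OF T fd A] and pB = tensor_map_pure[OF T fd B]
    and pC = tensor_map_pure[OF T fd Cl]
  have "tensor_map T C = (\<lambda>w. tensor_map T A (tensor_map T B w))"
  proof (rule tensor_eqI[OF T pC(1) clinear_compose[OF pA(1) pB(1)]])
    show "tensor_map T C (T x) = tensor_map T A (tensor_map T B (T x))" for x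
      unfolding pA(2) pB(2) pC(2) by (rule multilinear_cong[OF tensor_powerD(1)[OF T]]) (rule C)
  qed
  then show ?thesis by simp
qed

lemma tensor_map_id:
  fixes T :: "(nat \<Rightarrow> 'a::complex_space) \<Rightarrow> 'b::complex_space"
  assumes T: "tensor_power e T" and fd: "finite_dimensional TYPE('b)"
    and A: "\<And>i v. i < e \<Longrightarrow> A i v = v"
  shows "tensor_map T A w = w"
proof -
  have Al: "\<forall>i<e. clinear (A i)" using A by (simp add: clinear_iff)
  note pA = tensor_map_pure[OF T fd Al]
  have "tensor_map T A = (\<lambda>w. w)"
    by (rule tensor_eqI[OF T pA(1) clinear_id], unfold pA(2))
       (rule multilinear_cong[OF tensor_powerD(1)[OF T]], rule A)
  then show ?thesis by simp
qed

lemma tensor_map_cong: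
  assumes T: "tensor_power e T" and "\<And>i. i < e \<Longrightarrow> A i = B i"
  shows "tensor_map T A = tensor_map T B"
proof -
  have "T (\<lambda>i. A i (x i)) = T (\<lambda>i. B i (x i))" for x
    by (rule multilinear_cong[OF tensor_powerD(1)[OF T]]) (simp add: assms(2))
  then show ?thesis unfolding tensor_map_def by simp
qed

lemma tensor_map_slot_sum:
  fixes T :: "(nat \<Rightarrow> 'a::complex_space) \<Rightarrow> 'b::complex_space"
  assumes T: "tensor_power e T" and fd: "finite_dimensional TYPE('b)"
    and A: "\<forall>i<e. clinear (A i)" and k: "k < e"
    and B: "\<forall>j\<in>I. clinear (B j)"
    and AB: "\<And>z. A k z = (\<Sum>j\<in>I. c j *\<^sub>C B j z)"
  shows "tensor_map T A w = (\<Sum>j\<in>I. c j *\<^sub>C tensor_map T (A(k := B j)) w)"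
proof -
  note m = tensor_powerD(1)[OF T]
  have Al: "\<forall>i<e. clinear ((A(k := B j)) i)" if "j \<in> I" for j using A B that by simp
  note pA = tensor_map_pure[OF T fd A]
  note pB = tensor_map_pure[OF T fd Al]
  have "tensor_map T A = (\<lambda>w. \<Sum>j\<in>I. c j *\<^sub>C tensor_map T (A(k := B j)) w)"
  proof (rule tensor_eqI[OF T pA(1)])
    show "clinear (\<lambda>w. \<Sum>j\<in>I. c j *\<^sub>C tensor_map T (A(k := B j)) w)"
      by (rule clinear_lincomb) (rule pB(1))
    fix x
    let ?y = "\<lambda>i. A i (x i)"
    have "tensor_map T A (T x) = T (?y(k := \<Sum>j\<in>I. c j *\<^sub>C B j (x k)))"
      unfolding pA(2) by (rule multilinear_cong[OF m]) (simp add: AB)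
    also have "\<dots> = (\<Sum>j\<in>I. c j *\<^sub>C T (?y(k := B j (x k))))"
      by (simp only: clinear_sum[OF multilinear_slot[OF m k]] clinear_scale[OF multilinear_slot[OF m k]])
    also have "\<dots> = (\<Sum>j\<in>I. c j *\<^sub>C tensor_map T (A(k := B j)) (T x))"
    proof (rule sum.cong[OF refl])
      fix j assume j: "j \<in> I"
      have "T (?y(k := B j (x k))) = tensor_map T (A(k := B j)) (T x)"
        unfolding pB(2)[OF j] by (rule multilinear_cong[OF m]) simp
      then show "c j *\<^sub>C T (?y(k := B j (x k))) = c j *\<^sub>C tensor_map T (A(k := B j)) (T x)" by simp
    qed
    finally show "tensor_map T A (T x) = (\<Sum>j\<in>I. c j *\<^sub>C tensor_map T (A(k := B j)) (T x))" .
  qed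
  then show ?thesis by simp
qed

text \<open>The slots are treated one after the other: by Burnside's theorem an arbitrary operator in a slot
  is a combination of group elements, and a tensor of operators is linear in each slot.\<close>

lemma tensor_stable_all_operators:
  fixes T :: "(nat \<Rightarrow> 'a::complex_space) \<Rightarrow> 'b::complex_space"
  assumes T: "tensor_power e T" and fd: "finite_dimensional TYPE('a)"
    and irr: "irreducible_representation H UNIV \<rho>" and H: "group H" "finite (carrier H)"
    and U: "cspace.subspace U"
    and stable: "\<And>h w. (\<And>i. i < e \<Longrightarrow> h i \<in> carrier H) \<Longrightarrow> w \<in> U \<Longrightarrow> tensor_map T (\<lambda>i. \<rho> (h i)) w \<in> U"
    and A: "\<forall>i<e. clinear (A i)" and w: "w \<in> U"
  shows "tensor_map T A w \<in> U"
proof -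
  note fdT = tensor_power_finite_dimensional[OF T fd]
  note lin = irreducible_linear[OF irr]
  have "k \<le> e \<Longrightarrow> (\<And>i. i < k \<Longrightarrow> clinear (A i)) \<Longrightarrow> (\<And>i. k \<le> i \<Longrightarrow> i < e \<Longrightarrow> A i \<in> \<rho> ` carrier H) \<Longrightarrow>
    tensor_map T A w \<in> U" for k A
  proof (induction k arbitrary: A)
    case 0
    have "\<forall>i. \<exists>g. i < e \<longrightarrow> g \<in> carrier H \<and> A i = \<rho> g" using 0(3) by auto
    then obtain h where "\<forall>i. i < e \<longrightarrow> h i \<in> carrier H \<and> A i = \<rho> (h i)" by (rule choice[THEN exE])
    then have h: "\<And>i. i < e \<Longrightarrow> h i \<in> carrier H" "\<And>i. i < e \<Longrightarrow> A i = \<rho> (h i)" by simp_all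
    have "tensor_map T A = tensor_map T (\<lambda>i. \<rho> (h i))" by (rule tensor_map_cong[OF T h(2)])
    then show ?case using stable[of h, OF h(1) w] by simp
  next
    case (Suc k)
    then have k: "k < e" by simp
    have Al: "\<forall>i<e. clinear (A i)"
    proof (intro allI impI)
      fix i assume i: "i < e"
      show "clinear (A i)"
      proof (cases "i < Suc k")
        case False
        then have "A i \<in> \<rho> ` carrier H" using Suc.prems(3)[of i] i by simp
        then show ?thesis using lin by auto
      qed (rule Suc.prems(2))
    qed
    have "\<exists>a. \<forall>z. A k z = (\<Sum>h\<in>carrier H. a h *\<^sub>C \<rho> h z)"
      by (rule burnside[OF irr fd H Al[rule_format, OF k]]) blast
    then obtain a where a: "\<And>z. A k z = (\<Sum>h\<in>carrier H. a h *\<^sub>C \<rho> h z)" by blast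
    have "tensor_map T A w = (\<Sum>h\<in>carrier H. a h *\<^sub>C tensor_map T (A(k := \<rho> h)) w)"
      using tensor_map_slot_sum[OF T fdT Al k _ a] lin by blast
    also have "\<dots> \<in> U"
    proof (intro cspace.subspace_sum[OF U] cspace.subspace_scale[OF U])
      fix h assume "h \<in> carrier H"
      then show "tensor_map T (A(k := \<rho> h)) w \<in> U"
        using Suc.prems(2,3) k by (intro Suc.IH) auto
    qed
    finally show ?case .
  qed
  from this[of e A] show ?thesis using A by simp
qed

text \<open>Let \<open>w \<noteq> 0\<close> lie in a stable subspace. As the identity is the sum of the tensors of the rank one
  projections to basis vectors, some product \<open>l\<close> of coordinate forms does not vanish at \<open>w\<close>; the tensors of operators of
  rank one then map \<open>w\<close> to \<open>l(w)\<close> times any given pure tensor.\<close>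

theorem tensor_power_irreducible:
  fixes T :: "(nat \<Rightarrow> 'a::complex_space) \<Rightarrow> 'b::complex_space"
  assumes T: "tensor_power e T" and fd: "finite_dimensional TYPE('a)"
    and irr: "irreducible_representation H UNIV \<rho>" and H: "group H" "finite (carrier H)"
    and U: "cspace.subspace U"
    and stable: "\<And>h w. (\<And>i. i < e \<Longrightarrow> h i \<in> carrier H) \<Longrightarrow> w \<in> U \<Longrightarrow> tensor_map T (\<lambda>i. \<rho> (h i)) w \<in> U"
  shows "U = {0} \<or> U = UNIV"
proof (rule disjCI)
  assume "U \<noteq> UNIV"
  show "U = {0}"
  proof (rule ccontr)
    assume "U \<noteq> {0}"
    then obtain w where w: "w \<in> U" "w \<noteq> 0" using cspace.subspace_0[OF U] by blast
    note fdT = tensor_power_finite_dimensional[OF T fd] and m = tensor_powerD(1)[OF T]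
    obtain B :: "'a set" and co where "dual_bases B co" using dual_bases_exist[OF fd] .
    note B = dual_basesD[OF this]
    \<comment> \<open>\<open>E \<beta> k\<close> projects to the line of \<open>\<beta> i\<close> in the slots \<open>i < k\<close>; the basis vectors are chosen one slot
      at a time so that \<open>w\<close> keeps a nonzero image.\<close>
    define E where "E = (\<lambda>\<beta> k i (z::'a). if i < (k::nat) then co (\<beta> i) z *\<^sub>C \<beta> i else z)"
    have El: "\<forall>i<e. clinear (E \<beta> k i)" for \<beta> k
    proof (intro allI impI)
      show "clinear (E \<beta> k i)" for i
        unfolding E_def by (cases "i < k") (simp_all add: clinear_scale_vector[OF B(2)] clinear_id)
    qed
    have "k \<le> e \<Longrightarrow> \<exists>\<beta>. tensor_map T (E \<beta> k) w \<noteq> 0" for k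
    proof (induction k)
      case 0
      have "tensor_map T (E \<beta> 0) w = w" for \<beta> by (rule tensor_map_id[OF T fdT]) (simp add: E_def)
      then show ?case using w by simp
    next
      case (Suc k)
      then have k: "k < e" by simp
      obtain \<beta> where \<beta>: "tensor_map T (E \<beta> k) w \<noteq> 0" using Suc by auto
      have "tensor_map T (E \<beta> k) w = (\<Sum>b\<in>B. 1 *\<^sub>C tensor_map T ((E \<beta> k)(k := \<lambda>z. co b z *\<^sub>C b)) w)"
      proof (rule tensor_map_slot_sum[OF T fdT El k])
        show "\<forall>b\<in>B. clinear (\<lambda>z. co b z *\<^sub>C b)" by (simp add: clinear_scale_vector[OF B(2)])
        show "E \<beta> k k z = (\<Sum>b\<in>B. 1 *\<^sub>C co b z *\<^sub>C b)" for z
          by (simp only: scaleC_one B(3)) (simp add: E_def)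
      qed
      then have "\<exists>b\<in>B. tensor_map T ((E \<beta> k)(k := \<lambda>z. co b z *\<^sub>C b)) w \<noteq> 0"
        using \<beta> by (metis (no_types, lifting) scaleC_one sum.neutral)
      then obtain b where "tensor_map T ((E \<beta> k)(k := \<lambda>z. co b z *\<^sub>C b)) w \<noteq> 0" by blast
      moreover have "(E \<beta> k)(k := \<lambda>z. co b z *\<^sub>C b) = E (\<beta>(k := b)) (Suc k)"
        by (auto simp: E_def fun_eq_iff)
      ultimately have "tensor_map T (E (\<beta>(k := b)) (Suc k)) w \<noteq> 0" by simp
      then show ?case by blast
    qed
    then obtain \<beta> where \<beta>: "tensor_map T (E \<beta> e) w \<noteq> 0" by blast
    obtain l where l: "clinear l" "\<And>z. (\<Prod>i<e. co (\<beta> i) (z i)) = (l (T z) :: complex)"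
      using tensor_powerD(3)[OF T multilinear_prod_forms[of "\<lambda>i. co (\<beta> i)" e, OF B(2)]] by blast
    have rank1: "tensor_map T (\<lambda>i z. co (\<beta> i) z *\<^sub>C x i) = (\<lambda>u. l u *\<^sub>C T x)" for x
    proof (rule tensor_eqI[OF T])
      have "\<forall>i<e. clinear (\<lambda>z. co (\<beta> i) z *\<^sub>C x i)" by (simp add: clinear_scale_vector[OF B(2)])
      note p = tensor_map_pure[OF T fdT this]
      show "clinear (tensor_map T (\<lambda>i z. co (\<beta> i) z *\<^sub>C x i))" by (rule p(1))
      show "clinear (\<lambda>u. l u *\<^sub>C T x)" by (rule clinear_scale_vector[OF l(1)])
      show "tensor_map T (\<lambda>i z. co (\<beta> i) z *\<^sub>C x i) (T z) = l (T z) *\<^sub>C T x" for z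
        unfolding p(2) l(2)[symmetric] by (rule multilinear_scale[OF m])
    qed
    have "tensor_map T (E \<beta> e) = tensor_map T (\<lambda>i z. co (\<beta> i) z *\<^sub>C \<beta> i)"
      by (rule tensor_map_cong[OF T]) (simp add: E_def)
    then have lw: "l w \<noteq> 0" using \<beta> rank1[of \<beta>] by auto
    have "T x \<in> U" for x
    proof -
      have "tensor_map T (\<lambda>i z. co (\<beta> i) z *\<^sub>C x i) w \<in> U"
        by (rule tensor_stable_all_operators[OF T fd irr H U stable _ w(1)])
           (simp_all add: clinear_scale_vector[OF B(2)])
      then have "l w *\<^sub>C T x \<in> U" by (simp add: rank1)
      then have "inverse (l w) *\<^sub>C l w *\<^sub>C T x \<in> U" by (rule cspace.subspace_scale[OF U])
      then show ?thesis using lw by (simp add: scaleC_scaleC scaleC_one)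
    qed
    then have "cspace.span (range T) \<subseteq> U" by (intro cspace.span_minimal U) auto
    then show False using tensor_powerD(2)[OF T] \<open>U \<noteq> UNIV\<close> by blast
  qed
qed

section \<open>Matrices over a local field\<close>

lemma GL_simps:
  "carrier (GL n) = Units (ring_mat TYPE('a::field) n ())"
  "x \<otimes>\<^bsub>GL n\<^esub> y = x * (y :: 'a::field mat)" "\<one>\<^bsub>GL n\<^esub> = (1\<^sub>m n :: 'a::field mat)"
  by (simp_all add: GL_def units_of_def ring_mat_simps)

lemma group_GL: "group (GL n :: 'a::field mat monoid)"
proof -
  interpret ring "ring_mat TYPE('a) n ()" by (rule ring_mat)
  show ?thesis unfolding GL_def by (rule units_group)
qed

lemma GL_carrier_mat: "(A :: 'a::field mat) \<in> carrier (GL n) \<Longrightarrow> A \<in> carrier_mat n n"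
  by (simp add: GL_simps Units_def ring_mat_simps)

lemma GL_inv:
  assumes "(A :: 'a::field mat) \<in> carrier (GL n)"
  shows "inv\<^bsub>GL n\<^esub> A \<in> carrier_mat n n" "A * inv\<^bsub>GL n\<^esub> A = 1\<^sub>m n" "inv\<^bsub>GL n\<^esub> A * A = 1\<^sub>m n"
proof -
  interpret group "GL n :: 'a mat monoid" by (rule group_GL)
  show "inv\<^bsub>GL n\<^esub> A \<in> carrier_mat n n" using assms by (intro GL_carrier_mat) simp
  show "A * inv\<^bsub>GL n\<^esub> A = 1\<^sub>m n" "inv\<^bsub>GL n\<^esub> A * A = 1\<^sub>m n"
    using r_inv[OF assms] l_inv[OF assms] by (simp_all add: GL_simps)
qed

lemma GL_right_inverse:
  assumes A: "(A :: 'a::field mat) \<in> carrier_mat n n" "B \<in> carrier_mat n n" "A * B = 1\<^sub>m n"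
  shows "A \<in> carrier (GL n)" "inv\<^bsub>GL n\<^esub> A = B" "B \<in> carrier (GL n)"
proof -
  interpret group "GL n :: 'a mat monoid" by (rule group_GL)
  have BA: "B * A = 1\<^sub>m n" by (rule mat_mult_left_right_inverse[OF A])
  show c: "A \<in> carrier (GL n)" "B \<in> carrier (GL n)"
    using A BA by (auto simp: GL_simps Units_def ring_mat_simps)
  show "inv\<^bsub>GL n\<^esub> A = B" by (rule inv_equality) (use c BA in \<open>simp_all add: GL_simps\<close>)
qed

lemma mat_mult_entry:
  assumes "A \<in> carrier_mat n m" "B \<in> carrier_mat m k" "i < n" "j < k"
  shows "(A * B) $$ (i, j) = (\<Sum>l<m. A $$ (i, l) * B $$ (l, j))"
  using assms by (simp add: scalar_prod_def lessThan_atLeast0)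

lemma finite_GL:
  assumes "finite (UNIV :: 'k::field set)"
  shows "finite (carrier (GL n :: 'k mat monoid))"
proof -
  let ?F = "{g. \<forall>x. (x \<in> {..<n} \<times> {..<n} \<longrightarrow> g x \<in> (UNIV :: 'k set)) \<and> (x \<notin> {..<n} \<times> {..<n} \<longrightarrow> g x = 0)}"
  have "carrier (GL n :: 'k mat monoid) \<subseteq> mat n n ` ?F"
  proof
    fix A :: "'k mat" assume "A \<in> carrier (GL n)"
    then have A: "A \<in> carrier_mat n n" by (rule GL_carrier_mat)
    have eq: "A = mat n n (\<lambda>x. if x \<in> {..<n} \<times> {..<n} then A $$ x else 0)" using A by auto
    have "(\<lambda>x. if x \<in> {..<n} \<times> {..<n} then A $$ x else 0) \<in> ?F" by simp
    then show "A \<in> mat n n ` ?F" by (subst eq) (rule imageI)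
  qed
  moreover have "finite ?F" by (rule finite_set_of_finite_funs) (use assms in auto)
  ultimately show ?thesis by (meson finite_imageI finite_subset)
qed

lemma exists_maximizer:
  assumes "finite I" "I \<noteq> {}"
  obtains i where "i \<in> I" "\<And>k. k \<in> I \<Longrightarrow> (f k :: real) \<le> f i"
proof -
  have "Max (f ` I) \<in> f ` I" using assms by (intro Max_in) auto
  then obtain i where "i \<in> I" "f i = Max (f ` I)" by auto
  then show thesis using that assms(1) by (metis Max_ge finite_imageI imageI)
qed

locale local_field =
  fixes N :: "'a::{field,topological_space} \<Rightarrow> real" and red :: "'a \<Rightarrow> 'k::field"
  assumes nonarch: "nonarch_local_field N red"
begin

lemma N_nonneg: "N x \<ge> 0" and N_eq_0: "N x = 0 \<longleftrightarrow> x = 0"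
  and N_mult: "N (x * y) = N x * N y" and N_add: "N (x + y) \<le> max (N x) (N y)"
  and open_iff_ball: "open U \<longleftrightarrow> (\<forall>x\<in>U. \<exists>\<epsilon>>0. \<forall>y. N (y - x) < \<epsilon> \<longrightarrow> y \<in> U)"
  and not_discrete: "\<not> open {0 :: 'a}"
  using nonarch unfolding nonarch_local_field_def by auto

lemma red_1: "red 1 = 1"
  and red_add: "N x \<le> 1 \<Longrightarrow> N y \<le> 1 \<Longrightarrow> red (x + y) = red x + red y"
  and red_mult: "N x \<le> 1 \<Longrightarrow> N y \<le> 1 \<Longrightarrow> red (x * y) = red x * red y"
  using nonarch unfolding nonarch_local_field_def residue_map_def integer_ring_def by auto

lemma red_surj: "\<exists>x. N x \<le> 1 \<and> red x = z"
proof -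
  have "red ` integer_ring N = UNIV"
    using nonarch unfolding nonarch_local_field_def residue_map_def by blast
  then have "z \<in> red ` integer_ring N" by simp
  then show ?thesis unfolding integer_ring_def by auto
qed

lemma red_eq_0: "N x \<le> 1 \<Longrightarrow> red x = 0 \<longleftrightarrow> N x < 1"
proof -
  have "{x \<in> integer_ring N. red x = 0} = max_ideal N"
    using nonarch unfolding nonarch_local_field_def residue_map_def by blast
  then show "N x \<le> 1 \<Longrightarrow> red x = 0 \<longleftrightarrow> N x < 1"
    unfolding integer_ring_def max_ideal_def by blast
qed

lemma N_0: "N 0 = 0" by (simp add: N_eq_0)

lemma N_1: "N 1 = 1"
  using N_mult[of 1 1] N_eq_0[of 1] by simp

lemma N_minus: "N (- x) = N x"
proof -
  have "N (-1) * N (-1) = 1" using N_mult[of "-1" "-1"] N_1 by simp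
  then have "N (-1) = 1"
    using N_nonneg[of "-1"] by (metis abs_of_nonneg abs_1 power2_eq_1_iff power2_eq_square abs_minus)
  then show ?thesis using N_mult[of "-1" x] by simp
qed

lemma N_diff: "N (x - y) \<le> max (N x) (N y)"
  using N_add[of x "- y"] by (simp add: N_minus)

lemma N_sum_le: "0 \<le> c \<Longrightarrow> (\<And>i. i \<in> I \<Longrightarrow> N (f i) \<le> c) \<Longrightarrow> N (\<Sum>i\<in>I. f i) \<le> c"
proof (induction I rule: infinite_finite_induct)
  case (insert i I)
  then have "N (f i) \<le> c" "N (\<Sum>i\<in>I. f i) \<le> c" by auto
  then show ?case using insert(1,2) N_add[of "f i" "\<Sum>i\<in>I. f i"] by simp
qed (simp_all add: N_0)

lemma N_sum_less: "0 < c \<Longrightarrow> (\<And>i. i \<in> I \<Longrightarrow> N (f i) < c) \<Longrightarrow> N (\<Sum>i\<in>I. f i) < c"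
proof (induction I rule: infinite_finite_induct)
  case (insert i I)
  then have "N (f i) < c" "N (\<Sum>i\<in>I. f i) < c" by auto
  then show ?case using insert(1,2) N_add[of "f i" "\<Sum>i\<in>I. f i"] by simp
qed (simp_all add: N_0)

lemma N_mult_le_1: "N x \<le> 1 \<Longrightarrow> N y \<le> 1 \<Longrightarrow> N (x * y) \<le> 1"
  by (simp add: N_mult N_nonneg mult_le_one)

lemma N_mult_less_1: "N x < 1 \<Longrightarrow> N y \<le> 1 \<Longrightarrow> N (x * y) < 1" "N x \<le> 1 \<Longrightarrow> N y < 1 \<Longrightarrow> N (x * y) < 1"
proof -
  show *: "N x < 1 \<Longrightarrow> N y \<le> 1 \<Longrightarrow> N (x * y) < 1" for x y
    using mult_left_le[of "N y" "N x"] by (simp add: N_mult N_nonneg)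
  show "N x \<le> 1 \<Longrightarrow> N y < 1 \<Longrightarrow> N (x * y) < 1" using *[of y x] by (simp add: mult.commute)
qed

lemma red_0: "red 0 = 0"
  using red_eq_0[of 0] by (simp add: N_0)

lemma red_sum: "(\<And>i. i \<in> I \<Longrightarrow> N (f i) \<le> 1) \<Longrightarrow> red (\<Sum>i\<in>I. f i) = (\<Sum>i\<in>I. red (f i))"
proof (induction I rule: infinite_finite_induct)
  case (insert i I)
  then have "N (\<Sum>i\<in>I. f i) \<le> 1" by (intro N_sum_le) auto
  then show ?case using insert by (simp add: red_add)
qed (simp_all add: red_0)

lemma red_eqD:
  assumes "N x \<le> 1" "N y \<le> 1" "red x = red y"
  shows "N (x - y) < 1"
proof -
  have 1: "N (x - y) \<le> 1" using N_diff[of x y] assms by simp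
  have "red x = red (x - y) + red y" using red_add[OF 1 assms(2)] by simp
  then show ?thesis using red_eq_0[OF 1] assms(3) by simp
qed

lemma red_congruent:
  assumes "N (x - y) < 1" "N y \<le> 1"
  shows "N x \<le> 1" "red x = red y"
proof -
  have "x = (x - y) + y" by simp
  then show "N x \<le> 1" using N_add[of "x - y" y] assms by simp
  have "red ((x - y) + y) = red (x - y) + red y" using assms by (intro red_add) auto
  then show "red x = red y" using red_eq_0[of "x - y"] assms by simp
qed

text \<open>An infinite residue field would have \<open>CARD('k) = 0\<close>, forcing the maximal ideal to be zero and
  the field to be discrete.\<close>

lemma finite_residue_field: "finite (UNIV :: 'k set)"
proof (rule ccontr)
  assume "infinite (UNIV :: 'k set)"
  then have "CARD('k) = 0" by simp
  moreover have "\<exists>t. max_ideal N = {t * x | x. x \<in> integer_ring N} \<and> N t = 1 / real CARD('k)"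
    using nonarch unfolding nonarch_local_field_def by (elim conjE)
  then obtain t where t: "max_ideal N = {t * x | x. x \<in> integer_ring N}" "N t = 1 / real CARD('k)"
    by (elim exE conjE)
  ultimately have "t = 0" using N_eq_0[of t] by simp
  then have "max_ideal N \<subseteq> {0}" using t(1) by auto
  then have "y = 0" if "N (y - 0) < 1" for y using that unfolding max_ideal_def by auto
  then have "open {0 :: 'a}" unfolding open_iff_ball by (auto intro!: exI[of _ 1])
  then show False using not_discrete by contradiction
qed

subsection \<open>The principal congruence subgroup\<close>

definition congruent_one :: "nat \<Rightarrow> 'a mat \<Rightarrow> bool" where
  "congruent_one n A \<longleftrightarrow> (\<forall>i<n. \<forall>j<n. N (A $$ (i, j) - (if i = j then 1 else 0)) < 1)"

lemma congruent_one_decompose: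
  fixes v :: "nat \<Rightarrow> 'a"
  assumes "A \<in> carrier_mat n n" "i < n"
  shows "(\<Sum>k<n. A $$ (i, k) * v k) = v i + (\<Sum>k<n. (A $$ (i, k) - (if i = k then 1 else 0)) * v k)"
proof -
  have "(\<Sum>k<n. (if i = k then 1 else 0) * v k) = (\<Sum>k<n. if i = k then v k else 0)"
    by (rule sum.cong) auto
  also have "\<dots> = v i" using assms by simp
  finally show ?thesis by (simp add: algebra_simps sum_subtractf)
qed

text \<open>If \<open>A v = 0\<close> with \<open>A \<equiv> 1\<close>, then \<open>v = - (A - 1) v\<close>, and comparing the absolute values at a
  coordinate of \<open>v\<close> of maximal absolute value gives \<open>v = 0\<close>.\<close>

lemma congruent_one_invertible:
  assumes A: "A \<in> carrier_mat n n" and c: "congruent_one n A"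
  shows "A \<in> carrier (GL n)"
proof -
  have "det A \<noteq> 0"
  proof
    assume "det A = 0"
    then obtain v where v: "v \<in> carrier_vec n" "v \<noteq> 0\<^sub>v n" "A *\<^sub>v v = 0\<^sub>v n"
      using det_0_iff_vec_prod_zero[OF A] by blast
    have n: "{..<n} \<noteq> {}"
    proof
      assume "{..<n} = {}"
      then have "v = 0\<^sub>v n" using v(1) by (intro eq_vecI) auto
      then show False using v(2) by contradiction
    qed
    obtain i where i: "i \<in> {..<n}" "\<And>k. k \<in> {..<n} \<Longrightarrow> N (v $ k) \<le> N (v $ i)"
      using exists_maximizer[OF _ n, of "\<lambda>k. N (v $ k)"] by auto
    have in_n: "i < n" using i(1) by simp
    have pos: "N (v $ i) > 0"
    proof (rule ccontr)
      assume "\<not> N (v $ i) > 0"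
      then have "N (v $ k) = 0" if "k < n" for k using i(2)[of k] N_nonneg[of "v $ k"] that by simp
      then have "v = 0\<^sub>v n" using v(1) by (intro eq_vecI) (auto simp: N_eq_0)
      then show False using v(2) by contradiction
    qed
    have "(A *\<^sub>v v) $ i = (\<Sum>k<n. A $$ (i, k) * v $ k)"
      using A v(1) in_n by (simp add: scalar_prod_def lessThan_atLeast0)
    then have "v $ i = - (\<Sum>k<n. (A $$ (i, k) - (if i = k then 1 else 0)) * v $ k)"
      using congruent_one_decompose[OF A in_n, of "\<lambda>k. v $ k"] v(3) in_n
      by (simp add: eq_neg_iff_add_eq_0)
    then have "N (v $ i) = N (\<Sum>k<n. (A $$ (i, k) - (if i = k then 1 else 0)) * v $ k)"
      using N_minus by metis
    also have "\<dots> < N (v $ i)"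
    proof (rule N_sum_less[OF pos])
      fix k assume k: "k \<in> {..<n}"
      let ?d = "A $$ (i, k) - (if i = k then 1 else 0)"
      have "N ?d < 1" using c k in_n unfolding congruent_one_def by simp
      then have "N ?d * N (v $ i) < 1 * N (v $ i)" using pos by (intro mult_strict_right_mono) auto
      moreover have "N ?d * N (v $ k) \<le> N ?d * N (v $ i)"
        using i(2)[OF k] N_nonneg by (intro mult_left_mono) auto
      ultimately show "N (?d * v $ k) < N (v $ i)" by (simp add: N_mult)
    qed
    finally show False by simp
  qed
  then show ?thesis using det_non_zero_imp_unit[OF A, of "()"] by (simp add: GL_simps)
qed

text \<open>The same comparison, applied to a column of the inverse.\<close>

lemma congruent_one_inverse:
  assumes A: "A \<in> carrier (GL n)" and c: "congruent_one n A"
  shows "congruent_one n (inv\<^bsub>GL n\<^esub> A)"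
proof -
  let ?B = "inv\<^bsub>GL n\<^esub> A"
  note AM = GL_carrier_mat[OF A] and B = GL_inv[OF A]
  let ?d = "\<lambda>i k. A $$ (i, k) - (if i = k then 1 else 0)"
  have d: "N (?d i k) < 1" if "i < n" "k < n" for i k using c that unfolding congruent_one_def by simp
  have eq: "?B $$ (i, j) = (if i = j then 1 else 0) - (\<Sum>k<n. ?d i k * ?B $$ (k, j))"
    if "i < n" "j < n" for i j
  proof -
    have "(\<Sum>k<n. A $$ (i, k) * ?B $$ (k, j)) = (if i = j then 1 else 0)"
      using mat_mult_entry[OF AM B(1) that] that by (simp add: B(2))
    then show ?thesis using congruent_one_decompose[OF AM that(1), of "\<lambda>k. ?B $$ (k, j)"]
      by (simp add: algebra_simps)
  qed
  have int: "N (?B $$ (i, j)) \<le> 1" if "i < n" "j < n" for i j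
  proof (rule ccontr)
    assume big: "\<not> N (?B $$ (i, j)) \<le> 1"
    have "{..<n} \<noteq> {}" using that by auto
    then obtain m where m: "m \<in> {..<n}" "\<And>k. k \<in> {..<n} \<Longrightarrow> N (?B $$ (k, j)) \<le> N (?B $$ (m, j))"
      using exists_maximizer[of "{..<n}" "\<lambda>k. N (?B $$ (k, j))"] by auto
    let ?M = "N (?B $$ (m, j))"
    have M: "1 < ?M" using m(2)[of i] big that by simp
    have "N (\<Sum>k<n. ?d m k * ?B $$ (k, j)) < ?M"
    proof (rule N_sum_less)
      show "0 < ?M" using M by simp
      fix k assume k: "k \<in> {..<n}"
      have "N (?d m k) * ?M < 1 * ?M" using d[of m k] m(1) k M by (intro mult_strict_right_mono) auto
      moreover have "N (?d m k) * N (?B $$ (k, j)) \<le> N (?d m k) * ?M"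
        using m(2)[OF k] N_nonneg by (intro mult_left_mono) auto
      ultimately show "N (?d m k * ?B $$ (k, j)) < ?M" by (simp add: N_mult)
    qed
    moreover have "N (if m = j then 1 else 0) < ?M" using M by (cases "m = j") (simp_all add: N_1 N_0)
    ultimately have "N ((if m = j then 1 else 0) - (\<Sum>k<n. ?d m k * ?B $$ (k, j))) < ?M"
      using N_diff[of "if m = j then 1 else 0" "\<Sum>k<n. ?d m k * ?B $$ (k, j)"] by linarith
    then show False using eq[of m j] m(1) that by simp
  qed
  show ?thesis
    unfolding congruent_one_def
  proof (intro allI impI)
    fix i j assume ij: "i < n" "j < n"
    have "N (\<Sum>k<n. ?d i k * ?B $$ (k, j)) < 1"
      by (rule N_sum_less) (simp_all only: zero_less_one lessThan_iff N_mult_less_1(1) d int ij)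
    then show "N (?B $$ (i, j) - (if i = j then 1 else 0)) < 1"
      by (subst eq[OF ij]) (simp add: N_minus)
  qed
qed

subsection \<open>The topology of the general linear group\<close>

lemma open_ball: "open {y. N (y - x) < \<epsilon>}"
  unfolding open_iff_ball
proof (intro ballI)
  fix z assume z: "z \<in> {y. N (y - x) < \<epsilon>}"
  have "N (y - x) < \<epsilon>" if "N (y - z) < \<epsilon>" for y
    using N_add[of "y - z" "z - x"] that z by simp
  moreover have "\<epsilon> > 0" using z N_nonneg[of "z - x"] by simp
  ultimately show "\<exists>\<delta>>0. \<forall>y. N (y - z) < \<delta> \<longrightarrow> y \<in> {y. N (y - x) < \<epsilon>}" by blast
qed

lemma GL_topology_topspace: "topspace (GL_topology n :: 'a mat topology) = carrier (GL n)"
  by (auto simp: GL_topology_def topspace_pullback_topology)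

lemma openin_GL:
  fixes S :: "'a mat set"
  assumes S: "S \<subseteq> carrier (GL n)"
    and near: "\<And>g. g \<in> S \<Longrightarrow> \<exists>\<epsilon>>0. \<forall>h\<in>carrier (GL n).
      (\<forall>i<n. \<forall>j<n. N (h $$ (i, j) - g $$ (i, j)) < \<epsilon>) \<longrightarrow> h \<in> S"
  shows "openin (GL_topology n) S"
proof (subst openin_subopen, intro ballI)
  fix g assume g: "g \<in> S"
  then obtain \<epsilon> where \<epsilon>: "\<epsilon> > 0" "\<forall>h\<in>carrier (GL n).
      (\<forall>i<n. \<forall>j<n. N (h $$ (i, j) - g $$ (i, j)) < \<epsilon>) \<longrightarrow> h \<in> S" using near by blast
  let ?I = "{..<n} \<times> {..<n}"
  let ?r = "\<lambda>A :: 'a mat. restrict (\<lambda>ij. A $$ ij) ?I"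
  let ?V = "Pi\<^sub>E ?I (\<lambda>ij. {y. N (y - g $$ ij) < \<epsilon>})"
  have "openin (product_topology (\<lambda>_. euclidean) ?I) ?V"
    by (subst openin_PiE_gen) (auto simp: open_ball)
  then have "openin (GL_topology n) (?r -` ?V \<inter> carrier (GL n))"
    unfolding GL_topology_def openin_pullback_topology by blast
  moreover have "g \<in> ?r -` ?V \<inter> carrier (GL n)" using g S \<epsilon>(1) by (auto simp: N_0)
  moreover have "?r -` ?V \<inter> carrier (GL n) \<subseteq> S"
  proof
    fix h assume h: "h \<in> ?r -` ?V \<inter> carrier (GL n)"
    have "N (h $$ (i, j) - g $$ (i, j)) < \<epsilon>" if "i < n" "j < n" for i j
    proof -
      have "?r h (i, j) \<in> {y. N (y - g $$ (i, j)) < \<epsilon>}"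
        using h that by (intro PiE_mem[of "?r h" ?I]) auto
      then show ?thesis using that by simp
    qed
    then show "h \<in> S" using \<epsilon>(2) h by blast
  qed
  ultimately show "\<exists>U. openin (GL_topology n) U \<and> g \<in> U \<and> U \<subseteq> S" by blast
qed

text \<open>The reciprocal of a bound for the entries serves as \<open>\<delta>\<close>.\<close>

lemma entries_bounded:
  fixes A :: "'a mat"
  obtains \<delta> where "\<delta> > 0" "\<And>i j x. i < n \<Longrightarrow> j < n \<Longrightarrow> N x < \<delta> * c \<Longrightarrow> c > 0 \<Longrightarrow> N (A $$ (i, j)) * N x < c"
proof -
  let ?M = "1 + (\<Sum>ij\<in>{..<n} \<times> {..<n}. N (A $$ ij))"
  have M: "?M > 0" using N_nonneg by (simp add: add_pos_nonneg sum_nonneg)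
  have "N (A $$ (i, j)) * N x < c" if "i < n" "j < n" "N x < 1 / ?M * c" "c > 0" for i j x
  proof -
    have "N (A $$ (i, j)) \<le> (\<Sum>ij\<in>{..<n} \<times> {..<n}. N (A $$ ij))"
      using that N_nonneg by (intro member_le_sum) auto
    then have "N (A $$ (i, j)) \<le> ?M" by simp
    then have "N (A $$ (i, j)) * N x \<le> ?M * N x" using N_nonneg by (intro mult_right_mono) auto
    also have "\<dots> < ?M * (1 / ?M * c)" using that(3) M by (intro mult_strict_left_mono)
    also have "\<dots> = c" using M by simp
    finally show ?thesis .
  qed
  then show thesis using that[of "1 / ?M"] M by simp
qed

lemma mult_near:
  fixes a g :: "'a mat"
  assumes a: "a \<in> carrier_mat n n" and g: "g \<in> carrier_mat n n" and c: "c > 0"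
  obtains \<epsilon> where "\<epsilon> > 0"
    "\<forall>h\<in>carrier_mat n n. (\<forall>i<n. \<forall>j<n. N (h $$ (i, j) - g $$ (i, j)) < \<epsilon>) \<longrightarrow>
       (\<forall>i<n. \<forall>j<n. N ((h * a) $$ (i, j) - (g * a) $$ (i, j)) < c \<and>
                     N ((a * h) $$ (i, j) - (a * g) $$ (i, j)) < c)"
proof -
  obtain \<delta> where \<delta>: "\<delta> > 0"
    "\<And>i j x. i < n \<Longrightarrow> j < n \<Longrightarrow> N x < \<delta> * c \<Longrightarrow> c > 0 \<Longrightarrow> N (a $$ (i, j)) * N x < c"
    by (rule entries_bounded) blast
  show thesis
  proof (rule that[of "\<delta> * c"])
    show "\<delta> * c > 0" using \<delta>(1) c by simp
    show "\<forall>h\<in>carrier_mat n n. (\<forall>i<n. \<forall>j<n. N (h $$ (i, j) - g $$ (i, j)) < \<delta> * c) \<longrightarrow>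
       (\<forall>i<n. \<forall>j<n. N ((h * a) $$ (i, j) - (g * a) $$ (i, j)) < c \<and>
                     N ((a * h) $$ (i, j) - (a * g) $$ (i, j)) < c)"
    proof (intro ballI impI allI)
      fix h :: "'a mat" and i j
      assume h: "h \<in> carrier_mat n n" and near: "\<forall>i<n. \<forall>j<n. N (h $$ (i, j) - g $$ (i, j)) < \<delta> * c"
        and ij: "i < n" "j < n"
      have "(h * a) $$ (i, j) - (g * a) $$ (i, j) = (\<Sum>k<n. a $$ (k, j) * (h $$ (i, k) - g $$ (i, k)))"
        using mat_mult_entry[OF h a ij] mat_mult_entry[OF g a ij]
        by (simp add: sum_subtractf algebra_simps)
      also have "N \<dots> < c"
        by (rule N_sum_less[OF c]) (use near ij \<delta>(2) c in \<open>simp add: N_mult\<close>)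
      finally have 1: "N ((h * a) $$ (i, j) - (g * a) $$ (i, j)) < c" .
      have "(a * h) $$ (i, j) - (a * g) $$ (i, j) = (\<Sum>k<n. a $$ (i, k) * (h $$ (k, j) - g $$ (k, j)))"
        using mat_mult_entry[OF a h ij] mat_mult_entry[OF a g ij]
        by (simp add: sum_subtractf algebra_simps)
      also have "N \<dots> < c"
        by (rule N_sum_less[OF c]) (use near ij \<delta>(2) c in \<open>simp add: N_mult\<close>)
      finally show "N ((h * a) $$ (i, j) - (g * a) $$ (i, j)) < c \<and> N ((a * h) $$ (i, j) - (a * g) $$ (i, j)) < c"
        using 1 by simp
    qed
  qed
qed

text \<open>The differences \<open>h g\<inverse> - 1 = (h - g) g\<inverse>\<close> and \<open>g\<inverse> h - 1 = g\<inverse> (h - g)\<close> are small with \<open>h - g\<close>.\<close>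

lemma near_congruent_one:
  assumes g: "g \<in> carrier (GL n)"
  obtains \<epsilon> where "\<epsilon> > 0"
    "\<forall>h\<in>carrier (GL n). (\<forall>i<n. \<forall>j<n. N (h $$ (i, j) - g $$ (i, j)) < \<epsilon>) \<longrightarrow>
       congruent_one n (h * inv\<^bsub>GL n\<^esub> g) \<and> congruent_one n (inv\<^bsub>GL n\<^esub> g * h)"
proof -
  note gi = GL_inv[OF g]
  obtain \<epsilon> where \<epsilon>: "\<epsilon> > 0"
    "\<forall>h\<in>carrier_mat n n. (\<forall>i<n. \<forall>j<n. N (h $$ (i, j) - g $$ (i, j)) < \<epsilon>) \<longrightarrow>
       (\<forall>i<n. \<forall>j<n. N ((h * inv\<^bsub>GL n\<^esub> g) $$ (i, j) - (g * inv\<^bsub>GL n\<^esub> g) $$ (i, j)) < 1 \<and>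
                     N ((inv\<^bsub>GL n\<^esub> g * h) $$ (i, j) - (inv\<^bsub>GL n\<^esub> g * g) $$ (i, j)) < 1)"
    using mult_near[OF gi(1) GL_carrier_mat[OF g], of 1] by auto
  show thesis
  proof (rule that[OF \<epsilon>(1)], intro ballI impI)
    fix h :: "'a mat"
    assume h: "h \<in> carrier (GL n)" and near: "\<forall>i<n. \<forall>j<n. N (h $$ (i, j) - g $$ (i, j)) < \<epsilon>"
    have "\<forall>i<n. \<forall>j<n. N ((h * inv\<^bsub>GL n\<^esub> g) $$ (i, j) - (1\<^sub>m n) $$ (i, j)) < 1 \<and>
                     N ((inv\<^bsub>GL n\<^esub> g * h) $$ (i, j) - (1\<^sub>m n) $$ (i, j)) < 1"
      using \<epsilon>(2) GL_carrier_mat[OF h] near unfolding gi(2,3) by blast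
    then show "congruent_one n (h * inv\<^bsub>GL n\<^esub> g) \<and> congruent_one n (inv\<^bsub>GL n\<^esub> g * h)"
      unfolding congruent_one_def by auto
  qed
qed

text \<open>Around a point \<open>g\<close> of the coset, the \<open>h\<close> for which \<open>h g\<inverse>\<close> (or \<open>g\<inverse> h\<close>, for left cosets) is congruent
  to 1 form a neighbourhood inside the coset.\<close>

lemma coset_open:
  assumes H: "subgroup H (GL n)" and K: "{A \<in> carrier (GL n). congruent_one n A} \<subseteq> H"
    and r: "r \<in> carrier (GL n)"
  shows "openin (GL_topology n) (H #>\<^bsub>GL n\<^esub> r)" "openin (GL_topology n) (r <#\<^bsub>GL n\<^esub> H)"
proof -
  interpret G: group "GL n :: 'a mat monoid" by (rule group_GL)
  interpret H: subgroup H "GL n :: 'a mat monoid" by (rule H)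
  show "openin (GL_topology n) (H #>\<^bsub>GL n\<^esub> r)"
  proof (rule openin_GL)
    show "H #>\<^bsub>GL n\<^esub> r \<subseteq> carrier (GL n)" using r H.subset by (rule G.r_coset_subset_G[rotated])
    fix g assume "g \<in> H #>\<^bsub>GL n\<^esub> r"
    then obtain k where k: "k \<in> H" "g = k \<otimes>\<^bsub>GL n\<^esub> r" unfolding r_coset_def by blast
    have kc: "k \<in> carrier (GL n)" using k(1) H.subset by blast
    have g: "g \<in> carrier (GL n)" using k kc r by simp
    obtain \<epsilon> where \<epsilon>: "\<epsilon> > 0"
      "\<forall>h\<in>carrier (GL n). (\<forall>i<n. \<forall>j<n. N (h $$ (i, j) - g $$ (i, j)) < \<epsilon>) \<longrightarrow>
       congruent_one n (h * inv\<^bsub>GL n\<^esub> g) \<and> congruent_one n (inv\<^bsub>GL n\<^esub> g * h)"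
      by (rule near_congruent_one[OF g])
    have "h \<in> H #>\<^bsub>GL n\<^esub> r" if h: "h \<in> carrier (GL n)"
      and near: "\<forall>i<n. \<forall>j<n. N (h $$ (i, j) - g $$ (i, j)) < \<epsilon>" for h
    proof -
      let ?u = "h \<otimes>\<^bsub>GL n\<^esub> inv\<^bsub>GL n\<^esub> g"
      have "?u \<in> carrier (GL n)" using h g by simp
      moreover have "congruent_one n ?u" using \<epsilon>(2) h near by (simp add: GL_simps(2))
      ultimately have "?u \<in> H" using K by blast
      then have "?u \<otimes>\<^bsub>GL n\<^esub> k \<in> H" using k(1) by (rule H.m_closed)
      moreover have "h = (?u \<otimes>\<^bsub>GL n\<^esub> k) \<otimes>\<^bsub>GL n\<^esub> r"
        using h g kc r by (simp add: G.m_assoc k(2)[symmetric])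
      ultimately show ?thesis unfolding r_coset_def by blast
    qed
    then show "\<exists>\<epsilon>>0. \<forall>h\<in>carrier (GL n).
      (\<forall>i<n. \<forall>j<n. N (h $$ (i, j) - g $$ (i, j)) < \<epsilon>) \<longrightarrow> h \<in> H #>\<^bsub>GL n\<^esub> r"
      using \<epsilon>(1) by blast
  qed
  show "openin (GL_topology n) (r <#\<^bsub>GL n\<^esub> H)"
  proof (rule openin_GL)
    show "r <#\<^bsub>GL n\<^esub> H \<subseteq> carrier (GL n)" using H.subset r by (rule G.l_coset_subset_G)
    fix g assume "g \<in> r <#\<^bsub>GL n\<^esub> H"
    then obtain k where k: "k \<in> H" "g = r \<otimes>\<^bsub>GL n\<^esub> k" unfolding l_coset_def by blast
    have kc: "k \<in> carrier (GL n)" using k(1) H.subset by blast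
    have g: "g \<in> carrier (GL n)" using k kc r by simp
    obtain \<epsilon> where \<epsilon>: "\<epsilon> > 0"
      "\<forall>h\<in>carrier (GL n). (\<forall>i<n. \<forall>j<n. N (h $$ (i, j) - g $$ (i, j)) < \<epsilon>) \<longrightarrow>
       congruent_one n (h * inv\<^bsub>GL n\<^esub> g) \<and> congruent_one n (inv\<^bsub>GL n\<^esub> g * h)"
      by (rule near_congruent_one[OF g])
    have "h \<in> r <#\<^bsub>GL n\<^esub> H" if h: "h \<in> carrier (GL n)"
      and near: "\<forall>i<n. \<forall>j<n. N (h $$ (i, j) - g $$ (i, j)) < \<epsilon>" for h
    proof -
      let ?u = "inv\<^bsub>GL n\<^esub> g \<otimes>\<^bsub>GL n\<^esub> h"
      have "?u \<in> carrier (GL n)" using h g by simp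
      moreover have "congruent_one n ?u" using \<epsilon>(2) h near by (simp add: GL_simps(2))
      ultimately have "?u \<in> H" using K by blast
      then have "k \<otimes>\<^bsub>GL n\<^esub> ?u \<in> H" by (rule H.m_closed[OF k(1)])
      moreover have "h = r \<otimes>\<^bsub>GL n\<^esub> (k \<otimes>\<^bsub>GL n\<^esub> ?u)"
        using h g kc r by (simp add: G.m_assoc[symmetric] k(2)[symmetric])
      ultimately show ?thesis unfolding l_coset_def by blast
    qed
    then show "\<exists>\<epsilon>>0. \<forall>h\<in>carrier (GL n).
      (\<forall>i<n. \<forall>j<n. N (h $$ (i, j) - g $$ (i, j)) < \<epsilon>) \<longrightarrow> h \<in> r <#\<^bsub>GL n\<^esub> H"
      using \<epsilon>(1) by blast
  qed
qed

lemma compact_cover_GL: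
  fixes C :: "'a mat set"
  assumes C: "compactin (GL_topology n) C"
    and F: "\<And>r. r \<in> carrier (GL n) \<Longrightarrow> openin (GL_topology n) (F r) \<and> r \<in> F r"
  shows "\<exists>R. finite R \<and> R \<subseteq> carrier (GL n) \<and> C \<subseteq> (\<Union>r\<in>R. F r)"
proof -
  have "C \<subseteq> carrier (GL n)" using C GL_topology_topspace unfolding compactin_def by blast
  then have "C \<subseteq> \<Union>(F ` carrier (GL n))" using F by blast
  moreover have "\<forall>U\<in>F ` carrier (GL n). openin (GL_topology n) U" using F by blast
  ultimately obtain \<F> where \<F>: "finite \<F>" "\<F> \<subseteq> F ` carrier (GL n)" "C \<subseteq> \<Union>\<F>"
    using C unfolding compactin_def by blast
  then obtain R where R: "R \<subseteq> carrier (GL n)" "finite R" "\<F> = F ` R"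
    using finite_subset_image[OF \<F>(1,2)] by blast
  show ?thesis by (rule exI[of _ R]) (use R \<F>(3) in auto)
qed

lemma compact_translate_GL:
  assumes C: "compactin (GL_topology n) C" and a: "(a :: 'a mat) \<in> carrier (GL n)"
  shows "compactin (GL_topology n) ((\<lambda>g. g \<otimes>\<^bsub>GL n\<^esub> a) ` C)"
proof (rule image_compactin[OF C])
  interpret G: group "GL n :: 'a mat monoid" by (rule group_GL)
  let ?I = "{..<n} \<times> {..<n}"
  let ?m = "\<lambda>g. g \<otimes>\<^bsub>GL n\<^esub> a"
  have "continuous_map (GL_topology n) euclidean (\<lambda>g. (g * a) $$ (i, j))" if ij: "i < n" "j < n" for i j
    unfolding continuous_map_def
  proof (intro conjI allI impI)
    fix U :: "'a set" assume U: "openin euclidean U"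
    show "openin (GL_topology n) {g \<in> topspace (GL_topology n). (g * a) $$ (i, j) \<in> U}"
      unfolding GL_topology_topspace
    proof (rule openin_GL)
      fix g assume "g \<in> {g \<in> carrier (GL n). (g * a) $$ (i, j) \<in> U}"
      then have g: "g \<in> carrier (GL n)" "(g * a) $$ (i, j) \<in> U" by auto
      then obtain c where c: "c > 0" "\<forall>y. N (y - (g * a) $$ (i, j)) < c \<longrightarrow> y \<in> U"
        using U open_iff_ball by (auto simp del: index_mult_mat)
      obtain \<epsilon> where \<epsilon>: "\<epsilon> > 0"
        "\<forall>h\<in>carrier_mat n n. (\<forall>i<n. \<forall>j<n. N (h $$ (i, j) - g $$ (i, j)) < \<epsilon>) \<longrightarrow>
         (\<forall>i<n. \<forall>j<n. N ((h * a) $$ (i, j) - (g * a) $$ (i, j)) < c \<and>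
                     N ((a * h) $$ (i, j) - (a * g) $$ (i, j)) < c)"
        by (rule mult_near[OF GL_carrier_mat[OF a] GL_carrier_mat[OF g(1)] c(1)])
      show "\<exists>\<epsilon>>0. \<forall>h\<in>carrier (GL n). (\<forall>i<n. \<forall>j<n. N (h $$ (i, j) - g $$ (i, j)) < \<epsilon>) \<longrightarrow>
          h \<in> {g \<in> carrier (GL n). (g * a) $$ (i, j) \<in> U}"
      proof (intro exI[of _ \<epsilon>] conjI ballI impI CollectI)
        fix h assume h: "h \<in> carrier (GL n)" and near: "\<forall>i<n. \<forall>j<n. N (h $$ (i, j) - g $$ (i, j)) < \<epsilon>"
        then have "N ((h * a) $$ (i, j) - (g * a) $$ (i, j)) < c"
          using \<epsilon>(2) GL_carrier_mat[OF h] ij by blast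
        then show "(h * a) $$ (i, j) \<in> U" using c(2) by blast
      qed (use \<epsilon>(1) in auto)
    qed auto
  qed auto
  then have "continuous_map (GL_topology n) (product_topology (\<lambda>_. euclidean) ?I)
      ((\<lambda>A :: 'a mat. restrict (\<lambda>ij. A $$ ij) ?I) \<circ> ?m)"
    unfolding continuous_map_componentwise by (auto simp: GL_simps(2))
  moreover have "topspace (GL_topology n) \<subseteq> ?m -` carrier (GL n)"
    using a by (auto simp: GL_topology_topspace)
  ultimately show "continuous_map (GL_topology n) (GL_topology n) ?m"
    unfolding GL_topology_def[of n] by (rule continuous_map_pullback'[where A = "carrier (GL n)", folded GL_topology_def])
qed

end

subsection \<open>The parahoric subgroup and its reductive quotient\<close>

context local_field
begin

lemma block_order_iff:
  "A \<in> block_order N e f \<longleftrightarrow> A \<in> carrier_mat (e * f) (e * f) \<and>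
     (\<forall>r<e * f. \<forall>s<e * f. N (A $$ (r, s)) \<le> 1 \<and> (s div f < r div f \<longrightarrow> N (A $$ (r, s)) < 1))"
proof -
  have "A $$ (r, s) \<in> (if r div f \<le> s div f then integer_ring N else max_ideal N) \<longleftrightarrow>
      N (A $$ (r, s)) \<le> 1 \<and> (s div f < r div f \<longrightarrow> N (A $$ (r, s)) < 1)" for r s
    unfolding integer_ring_def max_ideal_def by auto
  then show ?thesis unfolding block_order_def by simp
qed

lemma block_orderD:
  assumes "A \<in> block_order N e f"
  shows "A \<in> carrier_mat (e * f) (e * f)" "r < e * f \<Longrightarrow> s < e * f \<Longrightarrow> N (A $$ (r, s)) \<le> 1"
    "r < e * f \<Longrightarrow> s < e * f \<Longrightarrow> s div f < r div f \<Longrightarrow> N (A $$ (r, s)) < 1"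
  using assms unfolding block_order_iff by blast+

lemma block_order_mult:
  assumes A: "A \<in> block_order N e f" and B: "B \<in> block_order N e f"
  shows "A * B \<in> block_order N e f"
proof -
  note AD = block_orderD[OF A] and BD = block_orderD[OF B]
  have "N ((A * B) $$ (r, s)) \<le> 1" if "r < e * f" "s < e * f" for r s
    unfolding mat_mult_entry[OF AD(1) BD(1) that]
    by (rule N_sum_le) (use that in \<open>simp_all add: N_mult_le_1 AD(2) BD(2)\<close>)
  moreover have "N ((A * B) $$ (r, s)) < 1" if "r < e * f" "s < e * f" "s div f < r div f" for r s
    unfolding mat_mult_entry[OF AD(1) BD(1) that(1,2)]
  proof (rule N_sum_less)
    fix l assume "l \<in> {..<e * f}"
    then have l: "l < e * f" by simp
    show "N (A $$ (r, l) * B $$ (l, s)) < 1"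
    proof (cases "l div f < r div f")
      case True
      then show ?thesis using that l by (intro N_mult_less_1(1) AD(3) BD(2))
    next
      case False
      then show ?thesis using that l by (intro N_mult_less_1(2) AD(2) BD(3)) auto
    qed
  qed simp
  ultimately show ?thesis using AD(1) BD(1) unfolding block_order_iff by auto
qed

lemma congruent_one_block_order:
  assumes A: "A \<in> carrier_mat (e * f) (e * f)" and c: "congruent_one (e * f) A"
  shows "A \<in> block_order N e f"
  unfolding block_order_iff
proof (intro conjI allI impI A)
  fix r s assume rs: "r < e * f" "s < e * f"
  then have *: "N (A $$ (r, s) - (if r = s then 1 else 0)) < 1"
    using c unfolding congruent_one_def by blast
  show "N (A $$ (r, s)) \<le> 1"
    by (rule red_congruent(1)[OF *]) (simp add: N_1 N_0)
  assume "s div f < r div f"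
  then have "r \<noteq> s" by auto
  then show "N (A $$ (r, s)) < 1" using * by simp
qed

lemma congruent_one_parahoric:
  assumes A: "A \<in> carrier (GL (e * f))" and c: "congruent_one (e * f) A"
  shows "A \<in> block_parahoric N e f"
  using A congruent_one_block_order[OF GL_carrier_mat[OF A] c]
    congruent_one_block_order[OF GL_inv(1)[OF A] congruent_one_inverse[OF A c]]
  unfolding block_parahoric_def by blast

lemma congruent_one_one: "congruent_one n (1\<^sub>m n)"
  unfolding congruent_one_def by (simp add: N_0)

lemma parahoricD:
  assumes "j \<in> block_parahoric N e f"
  shows "j \<in> carrier (GL (e * f))" "j \<in> block_order N e f" "inv\<^bsub>GL (e * f)\<^esub> j \<in> block_order N e f"
  using assms unfolding block_parahoric_def by auto

lemma parahoric_subgroup: "subgroup (block_parahoric N e f) (GL (e * f))"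
proof -
  interpret G: group "GL (e * f) :: 'a mat monoid" by (rule group_GL)
  show ?thesis
  proof (rule G.subgroupI)
    show "block_parahoric N e f \<subseteq> carrier (GL (e * f))" using parahoricD by blast
    have "1\<^sub>m (e * f) \<in> block_parahoric N e f"
      using G.one_closed by (intro congruent_one_parahoric congruent_one_one) (simp add: GL_simps(3))
    then show "block_parahoric N e f \<noteq> {}" by blast
    fix j assume j: "j \<in> block_parahoric N e f"
    note jD = parahoricD[OF j]
    show "inv\<^bsub>GL (e * f)\<^esub> j \<in> block_parahoric N e f"
      using jD unfolding block_parahoric_def by simp
    fix k assume k: "k \<in> block_parahoric N e f"
    note kD = parahoricD[OF k]
    have "inv\<^bsub>GL (e * f)\<^esub> (j \<otimes>\<^bsub>GL (e * f)\<^esub> k) = inv\<^bsub>GL (e * f)\<^esub> k * inv\<^bsub>GL (e * f)\<^esub> j"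
      using G.inv_mult_group[OF jD(1) kD(1)] by (simp only: GL_simps(2))
    moreover have "j \<otimes>\<^bsub>GL (e * f)\<^esub> k \<in> carrier (GL (e * f))" using jD(1) kD(1) by simp
    ultimately show "j \<otimes>\<^bsub>GL (e * f)\<^esub> k \<in> block_parahoric N e f"
      using block_order_mult[OF jD(2) kD(2)] block_order_mult[OF kD(3) jD(3)]
      unfolding block_parahoric_def by (simp add: GL_simps(2))
  qed
qed

definition block_reduction :: "nat \<Rightarrow> nat \<Rightarrow> 'a mat \<Rightarrow> 'k mat" where
  "block_reduction f i A = map_mat red (diag_block f i A)"

lemma block_reduction_carrier: "block_reduction f i A \<in> carrier_mat f f"
  by (simp add: block_reduction_def diag_block_def)

lemma block_reduction_entry:
  "r < f \<Longrightarrow> s < f \<Longrightarrow> block_reduction f i A $$ (r, s) = red (A $$ (i * f + r, i * f + s))"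
  by (simp add: block_reduction_def diag_block_def)

lemma block_index:
  fixes i r e f :: nat
  assumes "i < e" "r < f"
  shows "i * f + r < e * f" "(i * f + r) div f = i" "(i * f + r) mod f = r"
proof -
  have "i * f + r < Suc i * f" using assms(2) by simp
  also have "\<dots> \<le> e * f" using assms(1) by (intro mult_le_mono1) simp
  finally show "i * f + r < e * f" .
qed (use assms in auto)

text \<open>A summand of an entry of \<open>A B\<close> in the \<open>i\<close>-th diagonal block whose inner index lies outside the
  \<open>i\<close>-th block contains a factor from below the diagonal and reduces to zero.\<close>

lemma block_reduction_mult:
  assumes A: "A \<in> block_order N e f" and B: "B \<in> block_order N e f" and i: "i < e"
  shows "block_reduction f i (A * B) = block_reduction f i A * block_reduction f i B"
proof (rule eq_matI)
  note AD = block_orderD[OF A] and BD = block_orderD[OF B]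
  fix r s
  assume "r < dim_row (block_reduction f i A * block_reduction f i B)"
    and "s < dim_col (block_reduction f i A * block_reduction f i B)"
  then have rs: "r < f" "s < f" using block_reduction_carrier by (metis carrier_matD index_mult_mat(2,3))+
  let ?r = "i * f + r" and ?s = "i * f + s"
  note ri = block_index[OF i rs(1)] and si = block_index[OF i rs(2)]
  have le: "N (A $$ (?r, l) * B $$ (l, ?s)) \<le> 1" if "l < e * f" for l
    using that ri(1) si(1) by (intro N_mult_le_1 AD(2) BD(2))
  have zero: "red (A $$ (?r, l) * B $$ (l, ?s)) = 0" if l: "l < e * f" and ne: "l div f \<noteq> i" for l
  proof -
    have "N (A $$ (?r, l) * B $$ (l, ?s)) < 1"
    proof (cases "l div f < i")
      case True
      then show ?thesis using ri si l by (intro N_mult_less_1(1) AD(3) BD(2)) auto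
    next
      case False
      then show ?thesis using ri si l ne by (intro N_mult_less_1(2) AD(2) BD(3)) auto
    qed
    then show ?thesis using red_eq_0[OF le[OF l]] by simp
  qed
  have "block_reduction f i (A * B) $$ (r, s) = red (\<Sum>l<e * f. A $$ (?r, l) * B $$ (l, ?s))"
    unfolding block_reduction_entry[OF rs] mat_mult_entry[OF AD(1) BD(1) ri(1) si(1)] ..
  also have "\<dots> = (\<Sum>l<e * f. red (A $$ (?r, l) * B $$ (l, ?s)))"
    by (rule red_sum) (use le in simp)
  also have "\<dots> = (\<Sum>l\<in>{i * f..<i * f + f}. red (A $$ (?r, l) * B $$ (l, ?s)))"
  proof (rule sum.mono_neutral_right)
    show "{i * f..<i * f + f} \<subseteq> {..<e * f}"
    proof
      fix l assume "l \<in> {i * f..<i * f + f}"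
      then show "l \<in> {..<e * f}" using block_index(1)[OF i, of "l - i * f" f] by auto
    qed
    show "\<forall>l\<in>{..<e * f} - {i * f..<i * f + f}. red (A $$ (?r, l) * B $$ (l, ?s)) = 0"
    proof
      fix l assume l: "l \<in> {..<e * f} - {i * f..<i * f + f}"
      have "l div f \<noteq> i"
      proof
        assume "l div f = i"
        then have "l = i * f + l mod f" by (metis div_mult_mod_eq)
        moreover have "l mod f < f" using rs(1) by simp
        ultimately have "l \<in> {i * f..<i * f + f}"
          by (metis atLeastLessThan_iff le_add1 nat_add_left_cancel_less)
        then show False using l by blast
      qed
      then show "red (A $$ (?r, l) * B $$ (l, ?s)) = 0" using zero l by simp
    qed
  qed simp
  also have "\<dots> = (\<Sum>k<f. red (A $$ (?r, i * f + k) * B $$ (i * f + k, ?s)))"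
    by (rule sum.reindex_bij_witness[of _ "\<lambda>k. i * f + k" "\<lambda>l. l - i * f"]) auto
  also have "\<dots> = (\<Sum>k<f. block_reduction f i A $$ (r, k) * block_reduction f i B $$ (k, s))"
  proof (rule sum.cong[OF refl])
    fix k assume "k \<in> {..<f}"
    then have k: "k < f" by simp
    note ki = block_index(1)[OF i k]
    show "red (A $$ (?r, i * f + k) * B $$ (i * f + k, ?s))
        = block_reduction f i A $$ (r, k) * block_reduction f i B $$ (k, s)"
      unfolding block_reduction_entry[OF rs(1) k] block_reduction_entry[OF k rs(2)]
      using ki ri(1) si(1) by (intro red_mult AD(2) BD(2))
  qed
  also have "\<dots> = (block_reduction f i A * block_reduction f i B) $$ (r, s)"
    by (rule mat_mult_entry[OF block_reduction_carrier block_reduction_carrier rs, symmetric])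
  finally show "block_reduction f i (A * B) $$ (r, s) = (block_reduction f i A * block_reduction f i B) $$ (r, s)" .
qed (use block_reduction_carrier in \<open>metis carrier_matD index_mult_mat(2,3)\<close>)+

lemma block_reduction_congruent_one:
  assumes c: "congruent_one (e * f) A" and i: "i < e"
  shows "block_reduction f i A = 1\<^sub>m f"
proof (rule eq_matI)
  fix r s assume "r < dim_row (1\<^sub>m f :: 'k mat)" "s < dim_col (1\<^sub>m f :: 'k mat)"
  then have rs: "r < f" "s < f" by auto
  let ?r = "i * f + r" and ?s = "i * f + s"
  have *: "N (A $$ (?r, ?s) - (if ?r = ?s then 1 else 0)) < 1"
    using c block_index(1)[OF i rs(1)] block_index(1)[OF i rs(2)] unfolding congruent_one_def by blast
  have "red (A $$ (?r, ?s)) = red (if ?r = ?s then 1 else 0)"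
    by (rule red_congruent(2)[OF *]) (simp add: N_1 N_0)
  then show "block_reduction f i A $$ (r, s) = 1\<^sub>m f $$ (r, s)"
    using rs by (simp add: block_reduction_entry red_1 red_0)
qed (use block_reduction_carrier[of f i A] in auto)

lemma block_reduction_GL:
  assumes j: "j \<in> block_parahoric N e f" and i: "i < e"
  shows "block_reduction f i j \<in> carrier (GL f)"
proof (rule GL_right_inverse(1)[OF block_reduction_carrier block_reduction_carrier])
  note jD = parahoricD[OF j]
  show "block_reduction f i j * block_reduction f i (inv\<^bsub>GL (e * f)\<^esub> j) = 1\<^sub>m f"
    unfolding block_reduction_mult[OF jD(2,3) i, symmetric] GL_inv(2)[OF jD(1)]
    by (rule block_reduction_congruent_one[OF congruent_one_one i])
qed

text \<open>Lift the given matrices and their inverses entrywise to block diagonal matrices \<open>A\<close> and \<open>B\<close>.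
  Then \<open>A B \<equiv> 1\<close>, so \<open>A B\<close> is invertible with inverse in the order, and \<open>B (A B)\<inverse>\<close> inverts \<open>A\<close>.\<close>

lemma block_reduction_surj:
  assumes k: "\<And>i. i < e \<Longrightarrow> k i \<in> carrier (GL f)"
  obtains j where "j \<in> block_parahoric N e f" "\<forall>i<e. block_reduction f i j = k i"
proof -
  define lift where "lift z = (SOME x. N x \<le> 1 \<and> red x = z)" for z
  have lift: "N (lift z) \<le> 1" "red (lift z) = z" for z
    using someI_ex[OF red_surj[of z]] unfolding lift_def by auto
  define D where "D k = mat (e * f) (e * f)
    (\<lambda>(r, s). if r div f = s div f then lift (k (r div f) $$ (r mod f, s mod f)) else 0)"
    for k :: "nat \<Rightarrow> 'k mat"
  have DO: "D k \<in> block_order N e f" for k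
    unfolding block_order_iff D_def by (auto simp: lift N_0)
  have Dred: "block_reduction f i (D k) = k i" if i: "i < e" and k: "k i \<in> carrier_mat f f" for i k
  proof (rule eq_matI)
    fix r s assume "r < dim_row (k i)" "s < dim_col (k i)"
    then have rs: "r < f" "s < f" using k by auto
    show "block_reduction f i (D k) $$ (r, s) = k i $$ (r, s)"
      unfolding block_reduction_entry[OF rs] D_def
      using block_index[OF i rs(1)] block_index[OF i rs(2)] by (simp add: lift)
  qed (use k block_reduction_carrier[of f i "D k"] in auto)
  let ?A = "D k" and ?B = "D (\<lambda>i. inv\<^bsub>GL f\<^esub> k i)"
  note AO = DO[of k] and BO = DO[of "\<lambda>i. inv\<^bsub>GL f\<^esub> k i"]
  note AM = block_orderD(1)[OF AO] and BM = block_orderD(1)[OF BO]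
  have ABred: "block_reduction f i (?A * ?B) = 1\<^sub>m f" if i: "i < e" for i
    unfolding block_reduction_mult[OF AO BO i]
    using Dred[OF i, of k] Dred[OF i, of "\<lambda>i. inv\<^bsub>GL f\<^esub> k i"] GL_carrier_mat[OF k[OF i]]
      GL_inv[OF k[OF i]] by simp
  have c: "congruent_one (e * f) (?A * ?B)"
    unfolding congruent_one_def
  proof (intro allI impI)
    fix r s assume rs: "r < e * f" "s < e * f"
    then have f: "0 < f" by (cases f) auto
    show "N ((?A * ?B) $$ (r, s) - (if r = s then 1 else 0)) < 1"
    proof (cases "r div f = s div f")
      case True
      let ?i = "r div f"
      have i: "?i < e" using rs(1) f by (simp add: less_mult_imp_div_less)
      have mods: "r mod f < f" "s mod f < f" using f by auto
      have r: "?i * f + r mod f = r" by simp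
      have s: "?i * f + s mod f = s" unfolding True by simp
      have "red ((?A * ?B) $$ (r, s)) = block_reduction f ?i (?A * ?B) $$ (r mod f, s mod f)"
        unfolding block_reduction_entry[OF mods] r s ..
      also have "\<dots> = (if r mod f = s mod f then 1 else 0)" using mods by (simp add: ABred[OF i])
      also have "\<dots> = red (if r = s then 1 else 0)" using r s by (metis red_0 red_1)
      finally show ?thesis
        by (rule red_eqD[rotated 2])
           (use block_orderD(2)[OF block_order_mult[OF AO BO] rs] in \<open>simp_all add: N_1 N_0\<close>)
    next
      case False
      have "(?A * ?B) $$ (r, s) = 0"
        unfolding mat_mult_entry[OF AM BM rs]
        by (rule sum.neutral) (use rs False in \<open>auto simp: D_def\<close>)
      then show ?thesis using False by (auto simp: N_0)
    qed
  qed
  have ABM: "?A * ?B \<in> carrier_mat (e * f) (e * f)" using AM BM by simp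
  note AB = congruent_one_invertible[OF ABM c]
  let ?U = "inv\<^bsub>GL (e * f)\<^esub> (?A * ?B)"
  have UM: "?U \<in> carrier_mat (e * f) (e * f)" by (rule GL_inv(1)[OF AB])
  have "?A * (?B * ?U) = (?A * ?B) * ?U" by (rule assoc_mult_mat[OF AM BM UM, symmetric])
  then have inv: "?A * (?B * ?U) = 1\<^sub>m (e * f)" using GL_inv(2)[OF AB] by simp
  have BUM: "?B * ?U \<in> carrier_mat (e * f) (e * f)" using BM UM by simp
  have "?B * ?U \<in> block_order N e f"
    by (intro block_order_mult BO congruent_one_block_order UM congruent_one_inverse AB c)
  then have "?A \<in> block_parahoric N e f"
    using GL_right_inverse(1,2)[OF AM BUM inv] AO unfolding block_parahoric_def by simp
  moreover have "\<forall>i<e. block_reduction f i ?A = k i"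
    by (intro allI impI Dred GL_carrier_mat k)
  ultimately show thesis by (rule that)
qed

end

section \<open>Level zero simple types\<close>

text \<open>The abstract results apply to the parahoric subgroup: the kernel of \<open>lam\<close> contains the
  principal congruence subgroup, and the reduction map carries irreducibility from the tensor power
  to \<open>lam\<close>.\<close>

lemma (in local_field) simple_type_of_group:
  fixes lam\<^sub>0 :: "'k mat \<Rightarrow> 'x::complex_space \<Rightarrow> 'x"
    and T :: "(nat \<Rightarrow> 'x) \<Rightarrow> 'w::complex_space"
  assumes irr: "irreducible_representation (GL f) UNIV lam\<^sub>0" and T: "tensor_power e T"
  shows "type_of_group (GL (e * f)) (block_parahoric N e f) (GL_topology (e * f)) (simple_type red f T lam\<^sub>0)"
proof -
  let ?G = "GL (e * f) :: 'a mat monoid" and ?J = "block_parahoric N e f"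
  let ?lam = "simple_type red f T lam\<^sub>0"
  interpret G: group ?G by (rule group_GL)
  interpret J: subgroup ?J ?G by (rule parahoric_subgroup)
  interpret R: group "GL f :: 'k mat monoid" by (rule group_GL)
  note fin = finite_GL[OF finite_residue_field, of f]
  note fdX = irreducible_finite_dimensional[OF irr group_GL fin]
  note fdW = tensor_power_finite_dimensional[OF T fdX]
  have "representation (GL f) UNIV lam\<^sub>0" using irr unfolding irreducible_representation_def by blast
  then have lam0_mult: "lam\<^sub>0 (g * h) v = lam\<^sub>0 g (lam\<^sub>0 h v)"
    and lam0_one: "lam\<^sub>0 (1\<^sub>m f) v = v"
    if "g \<in> carrier (GL f)" "h \<in> carrier (GL f)" for g h v
    using that by (simp_all add: representation_def GL_simps(2,3))
  note lam0_one = lam0_one[OF R.one_closed R.one_closed]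
  have lam: "?lam j = tensor_map T (\<lambda>i. lam\<^sub>0 (block_reduction f i j))" for j
    unfolding simple_type_def block_reduction_def ..
  have lin: "\<forall>i<e. clinear (lam\<^sub>0 (block_reduction f i j))" if "j \<in> ?J" for j
    using irreducible_linear[OF irr] block_reduction_GL[OF that] by blast
  have lam_cong: "?lam j w = w" if "congruent_one (e * f) j" for j w
    unfolding lam using that by (intro tensor_map_id[OF T fdW]) (simp add: block_reduction_congruent_one lam0_one)
  have K: "{A \<in> carrier ?G. congruent_one (e * f) A} \<subseteq> ?J" using congruent_one_parahoric by blast
  show ?thesis
  proof (intro type_of_group.intro type_of_group_axioms.intro group_with_subgroup.intro
      group_GL parahoric_subgroup)
    show "finite_dimensional TYPE('w)" by (rule fdW)
    show "clinear (?lam j)" if "j \<in> ?J" for j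
      unfolding lam by (rule tensor_map_pure(1)[OF T fdW lin[OF that]])
    show "?lam (j \<otimes>\<^bsub>?G\<^esub> k) w = ?lam j (?lam k w)" if "j \<in> ?J" "k \<in> ?J" for j k w
      unfolding lam
    proof (rule tensor_map_compose[OF T fdW lin[OF that(1)] lin[OF that(2)]])
      fix i v assume i: "i < e"
      show "lam\<^sub>0 (block_reduction f i (j \<otimes>\<^bsub>?G\<^esub> k)) v
          = lam\<^sub>0 (block_reduction f i j) (lam\<^sub>0 (block_reduction f i k) v)"
        using block_reduction_mult[OF parahoricD(2)[OF that(1)] parahoricD(2)[OF that(2)] i]
          lam0_mult[OF block_reduction_GL[OF that(1) i] block_reduction_GL[OF that(2) i]]
        by (simp add: GL_simps(2))
    qed
    show "?lam \<one>\<^bsub>?G\<^esub> w = w" for w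
      by (rule lam_cong) (simp add: GL_simps(3) congruent_one_one)
    show "\<exists>R. finite R \<and> R \<subseteq> carrier ?G \<and> C \<subseteq> (\<Union>r\<in>R. ?J #>\<^bsub>?G\<^esub> r)"
      if "compactin (GL_topology (e * f)) C" for C
      by (rule compact_cover_GL[OF that])
         (simp add: coset_open(1)[OF parahoric_subgroup K] G.rcos_self[OF _ parahoric_subgroup])
    show "\<exists>R. finite R \<and> R \<subseteq> carrier ?G \<and> C \<subseteq> (\<Union>r\<in>R. r <#\<^bsub>?G\<^esub> ?J)"
      if "compactin (GL_topology (e * f)) C" for C
    proof (rule compact_cover_GL[OF that], intro conjI)
      fix r assume r: "r \<in> carrier ?G"
      show "openin (GL_topology (e * f)) (r <#\<^bsub>?G\<^esub> ?J)" by (rule coset_open(2)[OF parahoric_subgroup K r])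
      have "r = r \<otimes>\<^bsub>?G\<^esub> \<one>\<^bsub>?G\<^esub>" using r by simp
      then show "r \<in> r <#\<^bsub>?G\<^esub> ?J" using J.one_closed unfolding l_coset_def by blast
    qed
    show "compactin (GL_topology (e * f)) ((\<lambda>g. g \<otimes>\<^bsub>?G\<^esub> a) ` C)"
      if "compactin (GL_topology (e * f)) C" "a \<in> carrier ?G" for C a
      by (rule compact_translate_GL[OF that])
    show "U = {0} \<or> U = UNIV" if U: "cspace.subspace U" and st: "\<And>j. j \<in> ?J \<Longrightarrow> ?lam j ` U \<subseteq> U" for U
    proof (rule tensor_power_irreducible[OF T fdX irr group_GL fin U])
      fix h w assume h: "\<And>i. i < e \<Longrightarrow> h i \<in> carrier (GL f :: 'k mat monoid)" and w: "w \<in> U"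
      obtain j where j: "j \<in> ?J" "\<forall>i<e. block_reduction f i j = h i"
        using block_reduction_surj[of e h f] h by blast
      have "?lam j = tensor_map T (\<lambda>i. lam\<^sub>0 (h i))"
        unfolding lam by (rule tensor_map_cong[OF T]) (simp add: j(2))
      then show "tensor_map T (\<lambda>i. lam\<^sub>0 (h i)) w \<in> U" using st[OF j(1)] w by auto
    qed
    show "openin (GL_topology (e * f)) S"
      if S: "subgroup S ?G" and ker: "{j \<in> ?J. \<forall>w. ?lam j w = w} \<subseteq> S" for S
    proof -
      have "{A \<in> carrier ?G. congruent_one (e * f) A} \<subseteq> S" using ker K lam_cong by blast
      then have "openin (GL_topology (e * f)) (S #>\<^bsub>?G\<^esub> \<one>\<^bsub>?G\<^esub>)"
        by (rule coset_open(1)[OF S _ G.one_closed])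
      then show ?thesis using G.coset_mult_one[OF subgroup.subset[OF S]] by simp
    qed
  qed
qed

theorem proposition3p4:
  fixes N :: "'a::{field,topological_space} \<Rightarrow> real"
    and red :: "'a \<Rightarrow> 'k::field"
    and n e f :: nat
    and lam\<^sub>0 :: "'k mat \<Rightarrow> 'x::complex_space \<Rightarrow> 'x"
    and Lam\<^sub>0 :: "'a mat \<Rightarrow> 'x \<Rightarrow> 'x"
    and \<tau> :: "'a mat \<Rightarrow> 't::complex_space \<Rightarrow> 't"
    and T\<^sub>\<tau> :: "(nat \<Rightarrow> 't) \<Rightarrow> 'u::complex_space"
    and \<pi> :: "'a mat \<Rightarrow> 'v::complex_space \<Rightarrow> 'v"
    and T\<^sub>X :: "(nat \<Rightarrow> 'x) \<Rightarrow> 'w::complex_space"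
    and G :: "'a mat monoid"
    and \<T> :: "'a mat topology"
    and J :: "'a mat set"
    and lam :: "'a mat \<Rightarrow> 'w \<Rightarrow> 'w"
    and chi :: "('a mat \<Rightarrow> 'w cdual \<Rightarrow> 'w cdual) \<Rightarrow> complex"
    and p :: "('a mat \<Rightarrow> 'w) \<Rightarrow> 'v"
    and \<Psi> :: "'a mat \<Rightarrow> 'w cdual \<Rightarrow> 'w cdual"
    and c :: "'w \<Rightarrow> 'w cdual \<Rightarrow> 'a mat \<Rightarrow> complex"
  assumes "nonarch_local_field N red"
    and "n \<ge> 2" and "e \<ge> 1" and "f \<ge> 1" and "e * f = n"
    and "G = GL n" and "\<T> = GL_topology n"
    and "level0_supercuspidal N red f lam\<^sub>0 Lam\<^sub>0 \<tau>"
    and "irreducible_representation (GL f) UNIV \<tau>" and "unitary_representation (GL f) \<tau>"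
    and "tensor_power e T\<^sub>\<tau>" and "is_steinberg N e f \<tau> T\<^sub>\<tau> \<pi>"
    and "tensor_power e T\<^sub>X"
    and "J = block_parahoric N e f" and "lam = simple_type red f T\<^sub>X lam\<^sub>0"
    and "chi = hecke_character G \<T> J lam \<pi>"
    and "quotient_map_of_representations G (type_module G \<T> J lam) (right_translation G)
           (eigen_relations G \<T> J lam chi) UNIV \<pi> p"
    and "\<Psi> \<in> hecke_space G J lam"
    and "\<forall>\<phi>\<in>hecke_algebra G \<T> J lam. hecke_conv G J \<phi> \<Psi> = chi \<phi> *\<^sub>C \<Psi>"
    and "\<And>w w'. c w w' = matrix_coefficient \<pi> (p (type_vector J lam w))
                            (dual_vector G \<T> J lam p (\<lambda>g. \<Psi> g w'))"
  shows "(\<forall>w w'. \<forall>g\<in>carrier G. c w w' g = \<langle>w, \<Psi> (inv\<^bsub>G\<^esub> g) w'\<rangle>) \<and>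
    (\<Psi> \<noteq> 0 \<longrightarrow>
      (\<exists>\<iota> \<iota>'. clinear \<iota> \<and> inj \<iota> \<and> (\<forall>j\<in>J. \<forall>w. \<iota> (lam j w) = \<pi> j (\<iota> w)) \<and>
              clinear \<iota>' \<and> inj \<iota>' \<and> range \<iota>' \<subseteq> smooth_dual G \<T> \<pi> \<and>
              (\<forall>j\<in>J. \<forall>w'. \<iota>' (contragredient_action G lam j w') =
                            contragredient_action G \<pi> j (\<iota>' w')) \<and>
              (\<forall>w w'. \<forall>g\<in>carrier G. c w w' g = matrix_coefficient \<pi> (\<iota> w) (\<iota>' w') g)))"
proof -
  interpret F: local_field N red by (rule local_field.intro) (rule assms(1))
  have G: "G = GL (e * f)" and \<T>: "\<T> = GL_topology (e * f)" using assms(5-7) by simp_all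
  have "irreducible_representation (GL f) UNIV lam\<^sub>0"
    using assms(8) unfolding level0_supercuspidal_def by blast
  then have "type_of_group G J \<T> lam"
    unfolding G \<T> assms(14,15) by (rule F.simple_type_of_group[OF _ assms(13)])
  moreover have "representation G UNIV \<pi>" "(UNIV :: 'v set) \<noteq> {0}"
    using assms(12) unfolding is_steinberg_def irreducible_representation_def G by blast+
  ultimately interpret Q: type_quotient G J \<T> lam \<pi> p chi \<Psi>
    using assms(17-19) by (simp add: type_quotient_def type_quotient_axioms_def)
  have coeff: "c w w' g = matrix_coefficient \<pi> (p (type_vector J lam w)) (Q.dual_form w') g" for w w' g
    unfolding assms(20) Q.dual_form_def ..
  show ?thesis
  proof (intro conjI impI allI ballI)
    show "c w w' g = \<langle>w, \<Psi> (inv\<^bsub>G\<^esub> g) w'\<rangle>" if "g \<in> carrier G" for w w' g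
      using Q.matrix_coefficient_formula[OF that] by (simp add: coeff matrix_coefficient_def)
    assume \<Psi>: "\<Psi> \<noteq> 0"
    show "\<exists>\<iota> \<iota>'. clinear \<iota> \<and> inj \<iota> \<and> (\<forall>j\<in>J. \<forall>w. \<iota> (lam j w) = \<pi> j (\<iota> w)) \<and>
              clinear \<iota>' \<and> inj \<iota>' \<and> range \<iota>' \<subseteq> smooth_dual G \<T> \<pi> \<and>
              (\<forall>j\<in>J. \<forall>w'. \<iota>' (contragredient_action G lam j w') =
                            contragredient_action G \<pi> j (\<iota>' w')) \<and>
              (\<forall>w w'. \<forall>g\<in>carrier G. c w w' g = matrix_coefficient \<pi> (\<iota> w) (\<iota>' w') g)"
      by (intro exI[of _ "\<lambda>w. p (type_vector J lam w)"] exI[of _ Q.dual_form] conjI ballI allI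
          image_subsetI Q.embed_linear Q.embed_inj[OF \<Psi>] Q.embed_equivariant Q.dual_form_linear
          Q.dual_form_inj[OF \<Psi>] Q.dual_form_smooth Q.dual_form_equivariant coeff)
  qed
qed

end
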